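(* Let $M$ be a closed oriented Riemannian three-manifold with a finite triangulation $K$, and let $C^1(K)=V_{\mathrm p}\oplus V_{\mathrm g}$ be the orthogonal splitting of the space of real simplicial $1$-cochains into the physical sector $V_{\mathrm p}=\mathcal H^1_K\oplus\operatorname{im}\delta_1^\ast$ and the gauge sector $V_{\mathrm g}=\operatorname{im}\delta_0$. Let $\mu,\nu$ be nondegenerate Gaussian probability measures on $V_{\mathrm p}\oplus V_{\mathrm g}$, with physical marginals $\mu_{\mathrm p}=(P_{\mathrm p})_\#\mu$, $\nu_{\mathrm p}=(P_{\mathrm p})_\#\nu$ and conditional gauge distributions $\mu_{\mathrm g|x}$, $\nu_{\mathrm g|x}$ for $x\in V_{\mathrm p}$. Then $$D(\mu\|\nu)=D(\mu_{\mathrm p}\|\nu_{\mathrm p})+\mathcal I_{\mathrm g}(\mu,\nu),\qquad \mathcal I_{\mathrm g}(\mu,\nu)=\int_{V_{\mathrm p}}D\left(\mu_{\mathrm g|x}\,\middle\|\,\nu_{\mathrm g|x}\right)\,d\mu_{\mathrm p}(x).$$ In particular, $\mathcal I_{\mathrm g}(\mu,\nu)\ge 0$ and $D(\mu_{\mathrm p}\|\nu_{\mathrm p})\le D(\mu\|\nu)$. Equality $D(\mu_{\mathrm p}\|\nu_{\mathrm p})=D(\mu\|\nu)$ holds if and only if $\mu_{\mathrm g|x}=\nu_{\mathrm g|x}$ for $\mu_{\mathrm p}$-almost every $x$.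
   Context: $C^k(K)=C^k(K;\mathbb R)$ is the space of real simplicial $k$-cochains of $K$, $\delta_k:C^k(K)\to C^{k+1}(K)$ is the coboundary ($\delta_{k+1}\delta_k=0$), and $W_k:C^k(K)\to\Omega^k_{\mathrm{pw}}(M)$ are the Whitney maps into piecewise smooth forms (the linear maps sending the cochain dual to an oriented simplex $[v_0,\dots,v_k]$ to $k!\sum_{i}(-1)^i\lambda_i\,d\lambda_0\wedge\cdots\wedge\widehat{d\lambda_i}\wedge\cdots\wedge d\lambda_k$, with $\lambda_i$ the barycentric coordinate function of $v_i$); they satisfy $dW_k=W_{k+1}\delta_k$. Each $C^k(K)$ carries the Whitney inner product $\langle u,v\rangle_k=\int_M W_k(u)\wedge\star W_k(v)$, and $\delta_k^\ast$ denotes the adjoint of $\delta_k$ for these inner products. The harmonic space is $\mathcal H^1_K=\ker\delta_1\cap\ker\delta_0^\ast$, and one has the orthogonal discrete Hodge decomposition $C^1(K)=\operatorname{im}\delta_0\oplus\mathcal H^1_K\oplus\operatorname{im}\delta_1^\ast$. $P_{\mathrm p}:C^1(K)\to V_{\mathrm p}$ is the orthogonal projection onto $V_{\mathrm p}$ (with kernel $V_{\mathrm g}$), and $(P_{\mathrm p})_\#$ denotes pushforward of measures. Elements of $C^1(K)$ are written in Whitney-orthonormal coordinates as $a=(x,y)$ with $x\in V_{\mathrm p}$, $y\in V_{\mathrm g}$; $p=\dim V_{\mathrm p}$, $q=\dim V_{\mathrm g}$. Nondegenerate Gaussian means with positive definite covariance matrix. If $\mu$ has (Lebesgue) density $f(x,y)=f_{\mathrm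 p}(x)f_{\mathrm g|x}(y)$, where $f_{\mathrm p}$ is the density of $\mu_{\mathrm p}$, then $\mu_{\mathrm g|x}$ is the probability measure on $V_{\mathrm g}$ with density $f_{\mathrm g|x}=f(x,\cdot)/f_{\mathrm p}(x)$; similarly for $\nu$. For probability measures with densities $f,g$ the relative entropy is $D(f\|g)=\int f\log(f/g)$. *)

theory Defs
  imports
    "HOL-Analysis.Analysis"
    "HOL-Probability.Probability"
    "HOL-Combinatorics.Combinatorics"
    "Jordan_Normal_Form.Determinant"
begin

section \<open>Closed oriented Riemannian three-manifolds\<close>

text \<open>Continuous differentiability up to order \<open>k\<close> on an open set, through directional
  derivatives; this keeps the type of the iterated derivatives constant.\<close>

primrec Ck_on :: "nat \<Rightarrow> ('a::real_normed_vector \<Rightarrow> 'b::real_normed_vector) \<Rightarrow> 'a set \<Rightarrow> bool" where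
  "Ck_on 0 f S \<longleftrightarrow> continuous_on S f"
| "Ck_on (Suc k) f S \<longleftrightarrow>
     f differentiable_on S \<and> (\<forall>v. Ck_on k (\<lambda>x. frechet_derivative f (at x) v) S)"

definition smooth_on :: "('a::real_normed_vector \<Rightarrow> 'b::real_normed_vector) \<Rightarrow> 'a set \<Rightarrow> bool" where
  "smooth_on f S \<longleftrightarrow> (\<forall>k. Ck_on k f S)"

type_synonym 'm chart = "'m set \<times> ('m \<Rightarrow> real^3)"

text \<open>\<open>A\<close> is an oriented smooth atlas, and \<open>g c\<close> is the coordinate matrix of the Riemannian metric
  in the chart \<open>c\<close>.  Second countability follows from compactness.\<close>

locale closed_oriented_riemannian_3_manifold =
  fixes M :: "'m topology"
    and A :: "'m chart set"
    and g :: "'m chart \<Rightarrow> real^3 \<Rightarrow> real^3^3"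
  assumes compact: "compact_space M"
    and hausdorff: "Hausdorff_space M"
    and chart: "(U, \<phi>) \<in> A \<Longrightarrow> openin M U \<and> open (\<phi> ` U) \<and>
      homeomorphic_map (subtopology M U) (top_of_set (\<phi> ` U)) \<phi>"
    and cover: "(\<Union>(U, \<phi>)\<in>A. U) = topspace M"
    and transition_smooth: "(U, \<phi>) \<in> A \<Longrightarrow> (V, \<psi>) \<in> A \<Longrightarrow>
      smooth_on (\<psi> \<circ> inv_into U \<phi>) (\<phi> ` (U \<inter> V))"
    and transition_oriented: "(U, \<phi>) \<in> A \<Longrightarrow> (V, \<psi>) \<in> A \<Longrightarrow> x \<in> \<phi> ` (U \<inter> V) \<Longrightarrow>
      Determinants.det (jacobian (\<psi> \<circ> inv_into U \<phi>) (at x)) > 0"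
    and metric_smooth: "(U, \<phi>) \<in> A \<Longrightarrow> smooth_on (g (U, \<phi>)) (\<phi> ` U)"
    and metric_symmetric: "(U, \<phi>) \<in> A \<Longrightarrow> x \<in> \<phi> ` U \<Longrightarrow>
      transpose (g (U, \<phi>) x) = g (U, \<phi>) x"
    and metric_positive: "(U, \<phi>) \<in> A \<Longrightarrow> x \<in> \<phi> ` U \<Longrightarrow> w \<noteq> 0 \<Longrightarrow>
      inner w (g (U, \<phi>) x *v w) > 0"
    and metric_transform: "(U, \<phi>) \<in> A \<Longrightarrow> (V, \<psi>) \<in> A \<Longrightarrow> x \<in> \<phi> ` (U \<inter> V) \<Longrightarrow>
      g (U, \<phi>) x =
        transpose (jacobian (\<psi> \<circ> inv_into U \<phi>) (at x))
          ** g (V, \<psi>) ((\<psi> \<circ> inv_into U \<phi>) x)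
          ** jacobian (\<psi> \<circ> inv_into U \<phi>) (at x)"

section \<open>Finite smooth triangulations\<close>

definition finite_simplicial_complex :: "'v set set \<Rightarrow> bool" where
  "finite_simplicial_complex K \<longleftrightarrow>
     finite K \<and> (\<forall>\<sigma>\<in>K. finite \<sigma> \<and> \<sigma> \<noteq> {}) \<and> (\<forall>\<sigma>\<in>K. \<forall>\<tau>. \<tau> \<subseteq> \<sigma> \<and> \<tau> \<noteq> {} \<longrightarrow> \<tau> \<in> K)"

text \<open>Points of the geometric realization are given by their barycentric coordinates.\<close>

definition realization :: "'v set set \<Rightarrow> ('v \<Rightarrow> real) set" where
  "realization K = {b. (\<forall>v. 0 \<le> b v) \<and> {v. b v \<noteq> 0} \<in> K \<and> (\<Sum>v | b v \<noteq> 0. b v) = 1}"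

definition std_3_simplex :: "(real^3) set" where
  "std_3_simplex = {s. (\<forall>i. 0 \<le> s $ i) \<and> (\<Sum>i\<in>UNIV. s $ i) \<le> 1}"

text \<open>\<open>bary vs s v\<close> is the barycentric coordinate \<open>\<lambda>\<^sub>v\<close> of the point with parameter \<open>s\<close> in the simplex
  with ordered vertices \<open>vs\<close> (of length four); it is affine in \<open>s\<close>.\<close>

definition bary :: "'v list \<Rightarrow> real^3 \<Rightarrow> 'v \<Rightarrow> real" where
  "bary vs s v =
     (if v = vs ! 0 then 1 - s $ 1 - s $ 2 - s $ 3
      else if v = vs ! 1 then s $ 1
      else if v = vs ! 2 then s $ 2
      else if v = vs ! 3 then s $ 3
      else 0)"

definition ordered_simplices :: "'v set set \<Rightarrow> nat \<Rightarrow> 'v list set" where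
  "ordered_simplices K k = {xs. length xs = Suc k \<and> distinct xs \<and> set xs \<in> K}"

text \<open>The homeomorphism \<open>h\<close> is a smooth embedding on each closed 3-simplex: in charts it extends to a
  smooth map with invertible derivative near each point.  Purity of the complex is automatic for a
  triangulated 3-manifold and is recorded for convenience.\<close>

definition smooth_triangulation ::
  "'m topology \<Rightarrow> 'm chart set \<Rightarrow> 'v set set \<Rightarrow> (('v \<Rightarrow> real) \<Rightarrow> 'm) \<Rightarrow> bool" where
  "smooth_triangulation M A K h \<longleftrightarrow>
     finite_simplicial_complex K \<and>
     (\<forall>\<sigma>\<in>K. \<exists>\<tau>\<in>K. card \<tau> = 4 \<and> \<sigma> \<subseteq> \<tau>) \<and>
     homeomorphic_map (top_of_set (realization K)) M h \<and>
     (\<forall>vs\<in>ordered_simplices K 3. \<forall>s\<in>std_3_simplex. \<forall>(U, \<phi>)\<in>A. h (bary vs s) \<in> U \<longrightarrow>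
       (\<exists>N F. open N \<and> s \<in> N \<and> smooth_on F N \<and>
         (\<forall>t\<in>N. Determinants.det (jacobian F (at t)) \<noteq> 0) \<and>
         (\<forall>t\<in>N \<inter> std_3_simplex. h (bary vs t) \<in> U \<and> \<phi> (h (bary vs t)) = F t)))"

definition positively_oriented ::
  "'m chart set \<Rightarrow> (('v \<Rightarrow> real) \<Rightarrow> 'm) \<Rightarrow> 'v list \<Rightarrow> bool" where
  "positively_oriented A h vs \<longleftrightarrow>
     (\<forall>s\<in>interior std_3_simplex. \<forall>(U, \<phi>)\<in>A. h (bary vs s) \<in> U \<longrightarrow>
       Determinants.det (jacobian (\<lambda>t. \<phi> (h (bary vs t))) (at s)) > 0)"

text \<open>Coordinate matrix of the metric pulled back to an open 3-simplex.  By the transformation law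
  it does not depend on the chart.\<close>

definition pullback_metric ::
  "'m chart set \<Rightarrow> ('m chart \<Rightarrow> real^3 \<Rightarrow> real^3^3) \<Rightarrow> (('v \<Rightarrow> real) \<Rightarrow> 'm) \<Rightarrow> 'v list \<Rightarrow>
    real^3 \<Rightarrow> real^3^3" where
  "pullback_metric A g h vs s =
     (let c = (SOME c. c \<in> A \<and> h (bary vs s) \<in> fst c);
          F = (\<lambda>t. snd c (h (bary vs t)));
          J = jacobian F (at s)
      in transpose J ** g c (F s) ** J)"

section \<open>Exterior algebra of a three-dimensional space\<close>

text \<open>A \<open>k\<close>-form at a point is a function of a sequence of vectors of which only the first \<open>k\<close> entries
  matter.\<close>

type_synonym form3 = "(nat \<Rightarrow> real^3) \<Rightarrow> real"

definition wedge :: "nat \<Rightarrow> nat \<Rightarrow> form3 \<Rightarrow> form3 \<Rightarrow> form3" where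
  "wedge k l \<alpha> \<beta> X =
     (\<Sum>\<pi> | \<pi> permutes {..<k + l}.
        of_int (sign \<pi>) * \<alpha> (\<lambda>i. X (\<pi> i)) * \<beta> (\<lambda>i. X (\<pi> (k + i)))) / (fact k * fact l)"

primrec wedge_covectors :: "(real^3 \<Rightarrow> real) list \<Rightarrow> form3" where
  "wedge_covectors [] = (\<lambda>X. 1)"
| "wedge_covectors (\<theta> # \<theta>s) =
     wedge 1 (length \<theta>s) (\<lambda>X. \<theta> (X 0)) (wedge_covectors \<theta>s)"

definition volume_form :: "real^3^3 \<Rightarrow> form3" where
  "volume_form G X =
     sqrt (Determinants.det G) * Determinants.det (vector [X 0, X 1, X 2] :: real^3^3)"

text \<open>The coordinate formula
  \<open>(\<star>\<beta>)\<^sub>J = 1/k! \<Sum>\<^sub>I \<beta>\<^sup>I sqrt (det G) \<epsilon>\<^sub>I\<^sub>J\<close>; indices are raised by the inverse metric.\<close>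

definition hodge_star :: "real^3^3 \<Rightarrow> nat \<Rightarrow> form3 \<Rightarrow> form3" where
  "hodge_star G k \<beta> X =
     (\<Sum>I\<in>{..<k} \<rightarrow>\<^sub>E (UNIV :: 3 set).
        \<beta> (\<lambda>a. matrix_inv G *v axis (I a) 1) *
        volume_form G (\<lambda>a. if a < k then axis (I a) 1 else X (a - k))) / fact k"

section \<open>Cochains and the Whitney inner product\<close>

text \<open>A cochain is an alternating function of ordered simplices, extended by zero.\<close>

type_synonym 'v cochain = "'v list \<Rightarrow> real"

definition cochains :: "'v set set \<Rightarrow> nat \<Rightarrow> 'v cochain set" where
  "cochains K k = {u.
     (\<forall>xs. xs \<notin> ordered_simplices K k \<longrightarrow> u xs = 0) \<and>
     (\<forall>xs\<in>ordered_simplices K k. \<forall>\<pi>. \<pi> permutes {..<Suc k} \<longrightarrow>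
        u (permute_list \<pi> xs) = of_int (sign \<pi>) * u xs)}"

definition coboundary :: "'v set set \<Rightarrow> nat \<Rightarrow> 'v cochain \<Rightarrow> 'v cochain" where
  "coboundary K k u =
     (\<lambda>xs. if xs \<in> ordered_simplices K (Suc k)
           then \<Sum>i\<le>Suc k. (-1) ^ i * u (take i xs @ drop (Suc i) xs) else 0)"

text \<open>A piecewise smooth form is given by its pullbacks to the 3-simplices, parametrized by the
  standard simplex.\<close>

type_synonym 'v pw_form = "'v list \<Rightarrow> real^3 \<Rightarrow> form3"

definition dbary :: "'v list \<Rightarrow> real^3 \<Rightarrow> 'v \<Rightarrow> real^3 \<Rightarrow> real" where
  "dbary vs s v = frechet_derivative (\<lambda>t. bary vs t v) (at s)"

definition elementary_whitney_form :: "nat \<Rightarrow> 'v list \<Rightarrow> 'v pw_form" where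
  "elementary_whitney_form k xs vs s X =
     fact k * (\<Sum>i\<le>k. (-1) ^ i * bary vs s (xs ! i) *
       wedge_covectors (map (\<lambda>j. dbary vs s (xs ! j)) (filter (\<lambda>j. j \<noteq> i) [0..<Suc k])) X)"

text \<open>Each \<open>k\<close>-simplex occurs with all its \<open>(k + 1)!\<close> orderings, and all of them contribute the same
  form, whence the denominator.\<close>

definition whitney_map :: "'v set set \<Rightarrow> nat \<Rightarrow> 'v cochain \<Rightarrow> 'v pw_form" where
  "whitney_map K k u vs s X =
     (\<Sum>xs\<in>ordered_simplices K k. u xs * elementary_whitney_form k xs vs s X) / fact (Suc k)"

text \<open>The integral of a piecewise smooth 3-form over the oriented manifold.  The integral over a
  3-simplex is the same for each of its 12 positively oriented vertex orderings.\<close>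

definition integral_pw ::
  "'m chart set \<Rightarrow> 'v set set \<Rightarrow> (('v \<Rightarrow> real) \<Rightarrow> 'm) \<Rightarrow> 'v pw_form \<Rightarrow> real" where
  "integral_pw A K h \<omega> =
     (\<Sum>vs | vs \<in> ordered_simplices K 3 \<and> positively_oriented A h vs.
        LINT s:interior std_3_simplex|lborel.
          \<omega> vs s (\<lambda>i. [axis 1 1, axis 2 1, axis 3 1] ! i)) / 12"

definition whitney_inner ::
  "'m chart set \<Rightarrow> ('m chart \<Rightarrow> real^3 \<Rightarrow> real^3^3) \<Rightarrow> 'v set set \<Rightarrow> (('v \<Rightarrow> real) \<Rightarrow> 'm) \<Rightarrow>
    nat \<Rightarrow> 'v cochain \<Rightarrow> 'v cochain \<Rightarrow> real" where
  "whitney_inner A g K h k u w =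
     integral_pw A K h (\<lambda>vs s.
       wedge k (3 - k) (whitney_map K k u vs s)
         (hodge_star (pullback_metric A g h vs s) k (whitney_map K k w vs s)))"

section \<open>Physical and gauge sectors\<close>

text \<open>In what follows, \<open>ip k\<close> is the inner product on \<open>k\<close>-cochains.\<close>

definition coboundary_adjoint ::
  "'v set set \<Rightarrow> (nat \<Rightarrow> 'v cochain \<Rightarrow> 'v cochain \<Rightarrow> real) \<Rightarrow> nat \<Rightarrow> 'v cochain \<Rightarrow> 'v cochain" where
  "coboundary_adjoint K ip k w =
     (THE z. z \<in> cochains K k \<and>
        (\<forall>u\<in>cochains K k. ip (Suc k) (coboundary K k u) w = ip k u z))"

definition harmonic_space ::
  "'v set set \<Rightarrow> (nat \<Rightarrow> 'v cochain \<Rightarrow> 'v cochain \<Rightarrow> real) \<Rightarrow> 'v cochain set" where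
  "harmonic_space K ip =
     {a \<in> cochains K 1. coboundary K 1 a = (\<lambda>_. 0) \<and> coboundary_adjoint K ip 0 a = (\<lambda>_. 0)}"

definition physical_sector ::
  "'v set set \<Rightarrow> (nat \<Rightarrow> 'v cochain \<Rightarrow> 'v cochain \<Rightarrow> real) \<Rightarrow> 'v cochain set" where
  "physical_sector K ip =
     {(\<lambda>xs. a xs + b xs) |a b.
        a \<in> harmonic_space K ip \<and> b \<in> coboundary_adjoint K ip 1 ` cochains K 2}"

definition gauge_sector :: "'v set set \<Rightarrow> 'v cochain set" where
  "gauge_sector K = coboundary K 0 ` cochains K 0"

definition orth_projection ::
  "('v cochain \<Rightarrow> 'v cochain \<Rightarrow> real) \<Rightarrow> 'v cochain set \<Rightarrow> 'v cochain \<Rightarrow> 'v cochain" where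
  "orth_projection B V a = (THE x. x \<in> V \<and> (\<forall>y\<in>V. B (\<lambda>xs. a xs - x xs) y = 0))"

section \<open>Measures in orthonormal coordinates\<close>

definition lin_comb :: "'v cochain list \<Rightarrow> (nat \<Rightarrow> real) \<Rightarrow> 'v cochain" where
  "lin_comb es c = (\<lambda>xs. \<Sum>i<length es. c i * (es ! i) xs)"

definition orthonormal_basis ::
  "('v cochain \<Rightarrow> 'v cochain \<Rightarrow> real) \<Rightarrow> 'v cochain set \<Rightarrow> 'v cochain list \<Rightarrow> bool" where
  "orthonormal_basis B V es \<longleftrightarrow>
     V = range (lin_comb es) \<and>
     (\<forall>i<length es. \<forall>j<length es. B (es ! i) (es ! j) = (if i = j then 1 else 0))"

definition lebesgue_of :: "'v cochain set \<Rightarrow> 'v cochain list \<Rightarrow> 'v cochain measure" where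
  "lebesgue_of V es =
     distr (PiM {..<length es} (\<lambda>_. lborel)) (restrict_space borel V) (lin_comb es)"

definition has_density ::
  "'v cochain set \<Rightarrow> 'v cochain list \<Rightarrow> 'v cochain measure \<Rightarrow> ('v cochain \<Rightarrow> real) \<Rightarrow> bool" where
  "has_density V es \<mu> f \<longleftrightarrow>
     f \<in> borel_measurable (restrict_space borel V) \<and> (\<forall>a\<in>V. 0 \<le> f a) \<and>
     \<mu> = density (lebesgue_of V es) (\<lambda>a. ennreal (f a))"

text \<open>\<open>S\<close> is the covariance matrix in the coordinates given by the orthonormal basis \<open>es\<close> of \<open>V\<close>, and
  \<open>P\<close> is its inverse.\<close>

definition nondegenerate_gaussian ::
  "('v cochain \<Rightarrow> 'v cochain \<Rightarrow> real) \<Rightarrow> 'v cochain set \<Rightarrow> 'v cochain list \<Rightarrow> 'v cochain measure \<Rightarrow> bool"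
  where
  "nondegenerate_gaussian B V es \<mu> \<longleftrightarrow> prob_space \<mu> \<and>
     (\<exists>m S P. let n = length es; z = (\<lambda>a. Matrix.vec n (\<lambda>i. B a (es ! i))) in
        m \<in> carrier_vec n \<and> S \<in> carrier_mat n n \<and> P \<in> carrier_mat n n \<and>
        transpose_mat S = S \<and>
        (\<forall>w\<in>carrier_vec n. w \<noteq> 0\<^sub>v n \<longrightarrow> scalar_prod w (S *\<^sub>v w) > 0) \<and>
        inverts_mat S P \<and> inverts_mat P S \<and>
        has_density V es \<mu>
          (\<lambda>a. exp (- scalar_prod (z a - m) (P *\<^sub>v (z a - m)) / 2) /
               sqrt ((2 * pi) ^ n * Determinant.det S)))"

text \<open>The conditional distribution on \<open>V\<close> with density \<open>f(x, \<cdot>) / f\<^sub>p(x)\<close>; the point \<open>(x, y)\<close> of the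
  orthogonal sum is the cochain \<open>x + y\<close>.\<close>

definition conditional ::
  "'v cochain set \<Rightarrow> 'v cochain list \<Rightarrow> ('v cochain \<Rightarrow> real) \<Rightarrow> ('v cochain \<Rightarrow> real) \<Rightarrow>
    'v cochain \<Rightarrow> 'v cochain measure" where
  "conditional V es f fp x =
     density (lebesgue_of V es) (\<lambda>y. ennreal (f (\<lambda>xs. x xs + y xs) / fp x))"

text \<open>\<open>D(\<mu> \<parallel> \<nu>)\<close> with the natural logarithm.  The library function takes the reference measure
  first.\<close>

definition relative_entropy :: "'a measure \<Rightarrow> 'a measure \<Rightarrow> real" where
  "relative_entropy \<mu> \<nu> = KL_divergence (exp 1) \<nu> \<mu>"

definition gauge_information ::
  "'a measure \<Rightarrow> ('a \<Rightarrow> 'b measure) \<Rightarrow> ('a \<Rightarrow> 'b measure) \<Rightarrow> real" where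
  "gauge_information \<mu>p \<mu>g \<nu>g = (LINT x|\<mu>p. relative_entropy (\<mu>g x) (\<nu>g x))"

end

theory Submission
  imports Defs
begin

text \<open>Integrating \<open>f log (f / g)\<close> over the gauge variable first turns the logarithm of the quotient
  \<open>f / g\<close> into the sum of the marginal and the conditional logarithm; this is the chain rule.  It needs
  the integrability of \<open>f log (f / g)\<close>, which for nondegenerate Gaussians holds because the logarithm
  grows quadratically while \<open>f\<close> decays like the exponential of a negative definite quadratic form.
  The conditional entropies are nonnegative, and they vanish only for equal conditional measures, whence
  the inequalities and the equality case.

  Product coordinates are available because the two sectors are orthogonal.  This rests on the adjoints
  of the coboundaries, which exist because the Whitney inner product is definite on cochains of degree
  0 and 1: if the Whitney form of a cochain vanishes on the open 3-simplices, it vanishes by continuity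
  at their vertices, where its values on the edges are the coefficients of the cochain.\<close>

text \<open>Entropies are real-valued integrals with the value 0 where integrability fails, so
  splitting the joint entropy is meaningful only once both pieces are integrable. The marginal
  integrand is squeezed between a minorant coming from \<open>ln t \<le> t - 1\<close> and the fibre
  integral of the joint integrand; Gaussian estimates are thus made for the joint densities only.
  The adjoint of the coboundary on \<open>k\<close>-cochains is a Riesz representative in degree
  \<open>k\<close>, which makes positivity a matter of degrees 0 and 1, where the integrand has a
  simple closed form. The obstacle there is orientation: the integral runs over the positively
  oriented orderings of the 3-simplices, so every 3-simplex must be shown to have one. The sign of
  the Jacobian determinant is constant on the open simplex, which is connected, and exchanging two
  vertices reverses it. The metric on a simplex is known only through charts. Integrability up to
  the boundary comes from local continuous extensions and compactness.\<close>

no_notation Matrix.vec_index (infixl \<open>$\<close> 100)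

section \<open>The chain rule for densities on a product\<close>

text \<open>Relative to the probability measure \<open>density M f\<close> the other measure has
  density \<open>g / f\<close>, so the equality criterion over a probability space applies;
  \<open>ac\<close> is what makes this quotient a density of \<open>density M g\<close>.\<close>

lemma (in sigma_finite_measure) KL_density_density_eq_0_iff:
  fixes f g :: "'a \<Rightarrow> real"
  assumes "1 < b"
  assumes f: "f \<in> borel_measurable M" "AE x in M. 0 \<le> f x" "prob_space (density M f)"
  assumes g: "g \<in> borel_measurable M" "AE x in M. 0 \<le> g x" "prob_space (density M g)"
  assumes ac: "AE x in M. f x = 0 \<longrightarrow> g x = 0"
  assumes int: "integrable M (\<lambda>x. g x * log b (g x / f x))"
  shows "KL_divergence b (density M f) (density M g) = 0 \<longleftrightarrow> density M g = density M f"
proof -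
  interpret Mf: prob_space "density M f" by fact
  interpret Mf: information_space "density M f" b by standard fact
  have eq: "density (density M f) (\<lambda>x. g x / f x) = density M g" (is "?DD = _")
    using f g ac by (subst density_density_divide) simp_all
  have "KL_divergence b (density M f) ?DD = 0 \<longleftrightarrow> ?DD = density M f"
  proof (rule Mf.KL_eq_0_iff_eq)
    show "prob_space ?DD" unfolding eq by fact
    from f g show "(\<lambda>x. g x / f x) \<in> borel_measurable (density M f)"
      by auto
    show "AE x in density M f. 0 \<le> g x / f x"
      using f g by (auto simp: AE_density)
    show "integrable (density M f) (\<lambda>x. g x / f x * log b (g x / f x))"
      using \<open>1 < b\<close> f g ac
      by (subst integrable_density)
         (auto intro!: integrable_cong_AE[THEN iffD2, OF _ _ _ int] measurable_If)
  qed
  then show ?thesis unfolding eq .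
qed

text \<open>Without absolute continuity, \<open>RN_deriv\<close> is zero and \<open>log b 0 = 0\<close>, so that the divergence is zero
  instead of infinite.\<close>

lemma (in sigma_finite_measure) KL_density_density_cases:
  fixes f g :: "'a \<Rightarrow> real"
  assumes "1 < b"
  assumes f[measurable]: "f \<in> borel_measurable M" and f0: "AE x in M. 0 \<le> f x"
  assumes g[measurable]: "g \<in> borel_measurable M" and g0: "AE x in M. 0 \<le> g x"
  shows "KL_divergence b (density M f) (density M g) =
    (if AE x in M. f x = 0 \<longrightarrow> g x = 0 then \<integral>x. g x * log b (g x / f x) \<partial>M else 0)"
proof (cases "AE x in M. f x = 0 \<longrightarrow> g x = 0")
  case True
  then show ?thesis using KL_density_density[OF assms(1) f f0 g g0 True] by simp
next
  case False
  have "RN_deriv (density M f) (density M g) = (\<lambda>_. 0)"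
  proof -
    have "\<not> (\<exists>d. d \<in> borel_measurable (density M f) \<and> density (density M f) d = density M g)"
    proof safe
      fix d assume d: "d \<in> borel_measurable (density M f)" and e: "density (density M f) d = density M g"
      have d'[measurable]: "d \<in> borel_measurable M" using d by simp
      have "density (density M f) d = density M (\<lambda>x. ennreal (f x) * d x)"
        by (subst density_density_eq) auto
      with e have "density M (\<lambda>x. ennreal (f x) * d x) = density M (\<lambda>x. ennreal (g x))" by simp
      then have "AE x in M. ennreal (f x) * d x = ennreal (g x)"
        by (subst (asm) density_unique_iff) auto
      with g0 have "AE x in M. f x = 0 \<longrightarrow> g x = 0"
        by eventually_elim (auto simp: ennreal_eq_0_iff)
      with False show False by simp
    qed
    then show ?thesis unfolding RN_deriv_def by (simp only: if_False)
  qed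
  then have "KL_divergence b (density M f) (density M g) = (\<integral>x. log b 0 \<partial>density M g)"
    unfolding KL_divergence_def entropy_density_def by (simp add: comp_def)
  also have "\<dots> = 0" by (simp add: log_def)
  finally show ?thesis using False by simp
qed

context pair_sigma_finite
begin

text \<open>Written with Radon-Nikodym derivatives, the divergence involves a separate choice for
  every \<open>x\<close>, which says nothing about measurability in \<open>x\<close>. The case
  formula replaces it by a parametrized integral and an almost-everywhere condition, and the latter
  is encoded as the vanishing of the measurable function \<open>?N\<close>.\<close>

lemma borel_measurable_KL_sections:
  fixes f g :: "'a \<times> 'b \<Rightarrow> real"
  assumes "1 < b"
  assumes f[measurable]: "f \<in> borel_measurable (M1 \<Otimes>\<^sub>M M2)" and f0: "\<And>x. x \<in> space (M1 \<Otimes>\<^sub>M M2) \<Longrightarrow> 0 \<le> f x"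
  assumes g[measurable]: "g \<in> borel_measurable (M1 \<Otimes>\<^sub>M M2)" and g0: "\<And>x. x \<in> space (M1 \<Otimes>\<^sub>M M2) \<Longrightarrow> 0 \<le> g x"
  shows "(\<lambda>x. KL_divergence b (density M2 (\<lambda>y. f (x, y))) (density M2 (\<lambda>y. g (x, y)))) \<in> borel_measurable M1"
proof -
  let ?N = "\<lambda>x. \<integral>\<^sup>+y. indicator {z. f z = 0 \<and> g z \<noteq> 0} (x, y) \<partial>M2"
  have ae: "(AE y in M2. f (x, y) = 0 \<longrightarrow> g (x, y) = 0) \<longleftrightarrow> ?N x = 0" if [measurable]: "x \<in> space M1" for x
  proof -
    have "?N x = 0 \<longleftrightarrow> (AE y in M2. (indicator {z. f z = 0 \<and> g z \<noteq> 0} (x, y) :: ennreal) = 0)"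
      by (rule nn_integral_0_iff_AE) (auto simp: indicator_def)
    then show ?thesis by (auto simp: indicator_def)
  qed
  have "(\<lambda>x. if ?N x = 0 then \<integral>y. g (x, y) * log b (g (x, y) / f (x, y)) \<partial>M2 else 0) \<in> borel_measurable M1"
  proof -
    have m: "(\<lambda>z. indicator {z. f z = 0 \<and> g z \<noteq> 0} z :: ennreal) \<in> borel_measurable (M1 \<Otimes>\<^sub>M M2)"
      unfolding indicator_def by simp
    have [measurable]: "?N \<in> borel_measurable M1"
      using M2.borel_measurable_nn_integral_fst[OF m] .
    have [measurable]: "(\<lambda>x. \<integral>y. g (x, y) * log b (g (x, y) / f (x, y)) \<partial>M2) \<in> borel_measurable M1"
      by (rule M2.borel_measurable_lebesgue_integral) (simp add: case_prod_beta)
    show ?thesis by measurable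
  qed
  then show ?thesis
  proof (rule measurable_cong[THEN iffD1, rotated])
    fix x assume x[measurable]: "x \<in> space M1"
    have "AE y in M2. 0 \<le> f (x, y)" "AE y in M2. 0 \<le> g (x, y)"
      using x by (auto intro!: AE_I2 f0 g0 simp: space_pair_measure)
    then have "KL_divergence b (density M2 (\<lambda>y. f (x, y))) (density M2 (\<lambda>y. g (x, y))) =
      (if AE y in M2. f (x, y) = 0 \<longrightarrow> g (x, y) = 0 then \<integral>y. g (x, y) * log b (g (x, y) / f (x, y)) \<partial>M2 else 0)"
      using \<open>1 < b\<close> by (intro M2.KL_density_density_cases) auto
    then show "(if ?N x = 0 then \<integral>y. g (x, y) * log b (g (x, y) / f (x, y)) \<partial>M2 else 0) =
       KL_divergence b (density M2 (\<lambda>y. f (x, y))) (density M2 (\<lambda>y. g (x, y)))"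
      using ae[OF x] by simp
  qed
qed

text \<open>\<open>f1\<close> and \<open>g1\<close> are any versions of the marginal densities, so
  the argument runs on almost every fibre. Where \<open>f1 x = 0\<close> the conditional
  \<open>c f f1 x\<close> is the zero measure, as division by zero gives 0; the measure
  \<open>density M1 f1\<close> does not charge these points.\<close>

theorem KL_chain_rule:
  fixes f g :: "'a \<times> 'b \<Rightarrow> real" and f1 g1 :: "'a \<Rightarrow> real"
  assumes b: "1 < b"
  assumes f[measurable]: "f \<in> borel_measurable (M1 \<Otimes>\<^sub>M M2)" and f0: "\<And>z. z \<in> space (M1 \<Otimes>\<^sub>M M2) \<Longrightarrow> 0 \<le> f z"
    and g[measurable]: "g \<in> borel_measurable (M1 \<Otimes>\<^sub>M M2)" and g0: "\<And>z. z \<in> space (M1 \<Otimes>\<^sub>M M2) \<Longrightarrow> 0 \<le> g z"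
    and pf: "prob_space (density (M1 \<Otimes>\<^sub>M M2) f)" and pg: "prob_space (density (M1 \<Otimes>\<^sub>M M2) g)"
    and f1[measurable]: "f1 \<in> borel_measurable M1" and f10: "\<And>x. x \<in> space M1 \<Longrightarrow> 0 \<le> f1 x"
    and g1[measurable]: "g1 \<in> borel_measurable M1" and g10: "\<And>x. x \<in> space M1 \<Longrightarrow> 0 \<le> g1 x"
    and mf: "density M1 f1 = density M1 (\<lambda>x. \<integral>\<^sup>+y. f (x, y) \<partial>M2)"
    and mg: "density M1 g1 = density M1 (\<lambda>x. \<integral>\<^sup>+y. g (x, y) \<partial>M2)"
    and ac: "AE z in M1 \<Otimes>\<^sub>M M2. g z = 0 \<longrightarrow> f z = 0"
    and int: "integrable (M1 \<Otimes>\<^sub>M M2) (\<lambda>z. f z * log b (f z / g z))"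
  defines "c \<equiv> \<lambda>h h1 x. density M2 (\<lambda>y. ennreal (h (x, y) / h1 x))"
  defines "D \<equiv> \<lambda>x. KL_divergence b (c g g1 x) (c f f1 x)"
  shows "KL_divergence b (density (M1 \<Otimes>\<^sub>M M2) g) (density (M1 \<Otimes>\<^sub>M M2) f) =
      KL_divergence b (density M1 g1) (density M1 f1) + (\<integral>x. D x \<partial>density M1 f1)" (is ?chain)
    and "0 \<le> (\<integral>x. D x \<partial>density M1 f1)" (is ?nonneg)
    and "(\<integral>x. D x \<partial>density M1 f1) = 0 \<longleftrightarrow> (AE x in density M1 f1. c f f1 x = c g g1 x)" (is ?eq)
proof -
  let ?H = "\<lambda>x. \<integral>y. f (x, y) * log b (f (x, y) / g (x, y)) \<partial>M2"
  let ?K = "\<lambda>x. f1 x * log b (f1 x / g1 x)"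
  have Df[measurable]: "D \<in> borel_measurable M1"
    unfolding D_def c_def
    using borel_measurable_KL_sections[OF b, of "\<lambda>z. g z / g1 (fst z)" "\<lambda>z. f z / f1 (fst z)"]
    by (auto simp: space_pair_measure f0 g0 f10 g10)
  have AEf: "AE x in M1. ennreal (f1 x) = (\<integral>\<^sup>+y. f (x, y) \<partial>M2)"
    using mf by (subst (asm) M1.density_unique_iff) auto
  have AEg: "AE x in M1. ennreal (g1 x) = (\<integral>\<^sup>+y. g (x, y) \<partial>M2)"
    using mg by (subst (asm) M1.density_unique_iff) auto
  have AEac: "AE x in M1. AE y in M2. g (x, y) = 0 \<longrightarrow> f (x, y) = 0"
    using AE_pair[OF ac] .
  have AEint: "AE x in M1. integrable M2 (\<lambda>y. f (x, y) * log b (f (x, y) / g (x, y)))"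
    using AE_integrable_fst'[OF int] by simp
  \<comment> \<open>The factor \<open>f1 x\<close> keeps the fibre identity valid where
    \<open>f1 x = 0\<close> and \<open>D x\<close> carries no information. The lower bound for
    \<open>?K x\<close> prepares integrability, the last conjunct the equality case.\<close>
  have key: "AE x in M1. f1 x * D x = ?H x - ?K x \<and> 0 \<le> f1 x * D x \<and> (f1 x - g1 x) / ln b \<le> ?K x \<and>
      (f1 x = 0 \<longrightarrow> ?K x = 0) \<and> (g1 x = 0 \<longrightarrow> f1 x = 0) \<and>
      (f1 x > 0 \<longrightarrow> (D x = 0 \<longleftrightarrow> c f f1 x = c g g1 x))"
    using AEf AEg AEac AEint AE_space
  proof eventually_elim
    case (elim x)
    note [measurable] = elim(5)
    have f0x: "\<And>y. y \<in> space M2 \<Longrightarrow> 0 \<le> f (x, y)" and g0x: "\<And>y. y \<in> space M2 \<Longrightarrow> 0 \<le> g (x, y)"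
      using elim(5) f0 g0 by (auto simp: space_pair_measure)
    have gf: "g1 x = 0 \<longrightarrow> f1 x = 0"
    proof
      assume "g1 x = 0"
      then have "(\<integral>\<^sup>+y. g (x, y) \<partial>M2) = 0" using elim(2) by simp
      then have "AE y in M2. ennreal (g (x, y)) = 0"
        by (subst (asm) nn_integral_0_iff_AE) auto
      then have "AE y in M2. ennreal (f (x, y)) = 0"
        using elim(3) AE_space
        by eventually_elim (use g0x in \<open>auto simp: ennreal_eq_0_iff intro: antisym\<close>)
      then have "(\<integral>\<^sup>+y. f (x, y) \<partial>M2) = 0"
        by (subst nn_integral_0_iff_AE) auto
      then show "f1 x = 0" using elim(1) f10[OF elim(5)] by simp
    qed
    show ?case
    proof (cases "f1 x = 0")
      case True
      then have "(\<integral>\<^sup>+y. f (x, y) \<partial>M2) = 0" using elim(1) by simp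
      then have "AE y in M2. ennreal (f (x, y)) = 0"
        by (subst (asm) nn_integral_0_iff_AE) auto
      then have "AE y in M2. f (x, y) = 0"
        using AE_space by eventually_elim (use f0x in \<open>auto simp: ennreal_eq_0_iff intro: antisym\<close>)
      then have "AE y in M2. f (x, y) * log b (f (x, y) / g (x, y)) = 0"
        by eventually_elim simp
      then have "?H x = 0" by (subst integral_cong_AE[where g="\<lambda>_. 0"]) auto
      then show ?thesis using True gf g10[OF elim(5)] b by simp
    next
      case False
      then have fpos: "0 < f1 x" using f10[OF elim(5)] by simp
      have gpos: "0 < g1 x" using gf False g10[OF elim(5)] by (metis less_le)
      have intf: "integrable M2 (\<lambda>y. f (x, y))" and If: "(\<integral>y. f (x, y) \<partial>M2) = f1 x"
        using elim(1) fpos f0x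
        by (auto intro!: integrableI_nonneg nn_integral_eq_integral AE_I2 integral_eq_nn_integral[THEN trans] simp: elim(1)[symmetric])
      have one: "prob_space (density M2 (\<lambda>y. ennreal (h (x, y) / h1 x)))"
        if "ennreal (h1 x) = (\<integral>\<^sup>+y. h (x, y) \<partial>M2)" "0 < h1 x" and [measurable]: "h \<in> borel_measurable (M1 \<Otimes>\<^sub>M M2)"
          and "\<And>y. y \<in> space M2 \<Longrightarrow> 0 \<le> h (x, y)"
        for h :: "'a \<times> 'b \<Rightarrow> real" and h1
      proof
        have "emeasure (density M2 (\<lambda>y. ennreal (h (x, y) / h1 x))) (space (density M2 (\<lambda>y. ennreal (h (x, y) / h1 x))))
           = (\<integral>\<^sup>+y. ennreal (1 / h1 x) * ennreal (h (x, y)) \<partial>M2)"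
          using that by (subst emeasure_density) (auto intro!: nn_integral_cong simp: ennreal_mult'[symmetric])
        also have "\<dots> = ennreal (1 / h1 x) * ennreal (h1 x)"
          using that by (subst nn_integral_cmult) auto
        also have "\<dots> = 1" using that(2) by (simp add: ennreal_mult'[symmetric])
        finally show "emeasure (density M2 (\<lambda>y. ennreal (h (x, y) / h1 x))) (space (density M2 (\<lambda>y. ennreal (h (x, y) / h1 x)))) = 1" .
      qed
      note pfx = one[of f1 f, OF elim(1) fpos f f0x] and pgx = one[of g1 g, OF elim(2) gpos g g0x]
      let ?F = "\<lambda>y. f (x, y) / f1 x" and ?G = "\<lambda>y. g (x, y) / g1 x"
      have acx: "AE y in M2. ?G y = 0 \<longrightarrow> ?F y = 0"
        using elim(3) by eventually_elim (use gpos in auto)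
      have log_eq: "AE y in M2. ?F y * log b (?F y / ?G y) =
          (f (x, y) * log b (f (x, y) / g (x, y)) - f (x, y) * log b (f1 x / g1 x)) / f1 x"
        using elim(3) AE_space
      proof eventually_elim
        case (elim y)
        show ?case
        proof (cases "f (x, y) = 0")
          case False
          then have "0 < f (x, y)" "0 < g (x, y)" using elim f0x[of y] g0x[of y] by (auto simp: less_le)
          then have "log b (?F y / ?G y) = log b (f (x, y) / g (x, y)) - log b (f1 x / g1 x)"
            using fpos gpos b by (simp add: log_divide_pos log_mult_pos)
          then show ?thesis by (simp only: right_diff_distrib diff_divide_distrib times_divide_eq_left)
        qed simp
      qed
      have intR: "integrable M2 (\<lambda>y. (f (x, y) * log b (f (x, y) / g (x, y)) - f (x, y) * log b (f1 x / g1 x)) / f1 x)"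
        using elim(4) intf by simp
      have intF: "integrable M2 (\<lambda>y. ?F y * log b (?F y / ?G y))"
        by (rule integrable_cong_AE[THEN iffD2, OF _ _ log_eq intR]) auto
      have D: "D x = (\<integral>y. ?F y * log b (?F y / ?G y) \<partial>M2)"
        unfolding D_def c_def using b fpos gpos f0x g0x acx
        by (intro M2.KL_density_density) (auto intro!: AE_I2)
      also have "\<dots> = (\<integral>y. (f (x, y) * log b (f (x, y) / g (x, y)) - f (x, y) * log b (f1 x / g1 x)) / f1 x \<partial>M2)"
        by (rule integral_cong_AE[OF _ _ log_eq]) auto
      also have "\<dots> = (?H x - ?K x) / f1 x"
        using elim(4) intf If by simp
      finally have DH: "f1 x * D x = ?H x - ?K x" using fpos by simp
      have Dnn: "0 \<le> D x"
        unfolding D_def c_def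
        by (rule M2.KL_density_density_nonneg[OF b _ _ pgx _ _ pfx acx intF])
           (use fpos gpos f0x g0x in \<open>auto intro!: AE_I2\<close>)
      have Deq: "D x = 0 \<longleftrightarrow> c f f1 x = c g g1 x"
        unfolding D_def c_def
        by (rule M2.KL_density_density_eq_0_iff[OF b _ _ pgx _ _ pfx acx intF])
           (use fpos gpos f0x g0x in \<open>auto intro!: AE_I2\<close>)
      \<comment> \<open>Taken at \<open>t = g1 x / f1 x\<close>, the bound
        \<open>ln t \<le> t - 1\<close> yields a minorant of \<open>?K x\<close> built from the two
        marginal densities alone.\<close>
      have "ln (g1 x / f1 x) \<le> g1 x / f1 x - 1" using fpos gpos by (intro ln_le_minus_one) auto
      then have "f1 x * ln (g1 x / f1 x) \<le> f1 x * (g1 x / f1 x - 1)" using fpos by (intro mult_left_mono) auto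
      then have "f1 x - g1 x \<le> f1 x * ln (f1 x / g1 x)"
        using fpos gpos by (simp add: ln_div algebra_simps)
      then have "(f1 x - g1 x) / ln b \<le> ?K x" using b by (simp add: log_def divide_right_mono)
      moreover have "0 \<le> f1 x * D x" using fpos Dnn by simp
      ultimately show ?thesis using DH Deq fpos gf by simp
    qed
  qed
  have integrable1: "integrable M1 h1" if h1: "density M1 h1 = density M1 (\<lambda>x. \<integral>\<^sup>+y. h (x, y) \<partial>M2)"
      and [measurable]: "h1 \<in> borel_measurable M1" "h \<in> borel_measurable (M1 \<Otimes>\<^sub>M M2)"
      and p: "prob_space (density (M1 \<Otimes>\<^sub>M M2) h)" and "\<And>x. x \<in> space M1 \<Longrightarrow> 0 \<le> h1 x" for h :: "'a \<times> 'b \<Rightarrow> real" and h1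
  proof (rule integrableI_nonneg)
    have "(\<integral>\<^sup>+x. h1 x \<partial>M1) = emeasure (density M1 h1) (space M1)"
      by (auto simp: emeasure_density intro!: nn_integral_cong)
    also have "\<dots> = (\<integral>\<^sup>+x. \<integral>\<^sup>+y. h (x, y) \<partial>M2 \<partial>M1)"
      unfolding h1 by (auto simp: emeasure_density intro!: nn_integral_cong)
    also have "\<dots> = (\<integral>\<^sup>+z. h z \<partial>(M1 \<Otimes>\<^sub>M M2))"
      using M2.nn_integral_fst[of "\<lambda>z. ennreal (h z)"] by simp
    also have "\<dots> = emeasure (density (M1 \<Otimes>\<^sub>M M2) h) (space (density (M1 \<Otimes>\<^sub>M M2) h))"
      by (subst emeasure_density) (auto intro!: nn_integral_cong)
    also have "\<dots> = 1" using prob_space.emeasure_space_1[OF p] .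
    finally show "(\<integral>\<^sup>+x. h1 x \<partial>M1) < \<infinity>" by simp
  qed (use that in \<open>auto intro!: AE_I2\<close>)
  have int1: "integrable M1 f1" "integrable M1 g1"
    using integrable1[OF mf f1 f pf f10] integrable1[OF mg g1 g pg g10] by auto
  have intH: "integrable M1 ?H" using integrable_fst'[OF int] by simp
  \<comment> \<open>Almost everywhere \<open>?K \<le> ?H\<close>, because
    \<open>f1 * D = ?H - ?K\<close> is nonnegative; together with the minorant
    \<open>(f1 - g1) / ln b\<close> this bounds the absolute value by an integrable
    function.\<close>
  have intK: "integrable M1 ?K"
  proof (rule Bochner_Integration.integrable_bound)
    show "integrable M1 (\<lambda>x. \<bar>?H x\<bar> + (\<bar>f1 x\<bar> + \<bar>g1 x\<bar>) / ln b)" using intH int1 by simp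
    show "AE x in M1. norm (?K x) \<le> norm (\<bar>?H x\<bar> + (\<bar>f1 x\<bar> + \<bar>g1 x\<bar>) / ln b)"
      using key
    proof eventually_elim
      case (elim x)
      have lb: "0 < ln b" using b by simp
      have "- ((\<bar>f1 x\<bar> + \<bar>g1 x\<bar>) / ln b) \<le> (f1 x - g1 x) / ln b"
        using lb by (auto simp: divide_simps)
      moreover have "0 \<le> (\<bar>f1 x\<bar> + \<bar>g1 x\<bar>) / ln b" using lb by simp
      ultimately have "\<bar>?K x\<bar> \<le> \<bar>?H x\<bar> + (\<bar>f1 x\<bar> + \<bar>g1 x\<bar>) / ln b"
        using elim by linarith
      then show ?case by simp
    qed
  qed simp
  have intD: "(\<integral>x. D x \<partial>density M1 f1) = (\<integral>x. f1 x * D x \<partial>M1)"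
    using f10 by (subst integral_density) (auto intro!: AE_I2)
  have AED: "AE x in M1. f1 x * D x = ?H x - ?K x" using key by eventually_elim simp
  have iD: "integrable M1 (\<lambda>x. f1 x * D x)"
    by (rule integrable_cong_AE[THEN iffD2, OF _ _ AED Bochner_Integration.integrable_diff[OF intH intK]]) measurable
  have "(\<integral>x. f1 x * D x \<partial>M1) = (\<integral>x. ?H x - ?K x \<partial>M1)"
    by (rule integral_cong_AE[OF _ _ AED]) auto
  also have "\<dots> = (\<integral>x. ?H x \<partial>M1) - (\<integral>x. ?K x \<partial>M1)" using intH intK by simp
  finally have split: "(\<integral>x. f1 x * D x \<partial>M1) = (\<integral>x. ?H x \<partial>M1) - (\<integral>x. ?K x \<partial>M1)" .
  interpret P: sigma_finite_measure "M1 \<Otimes>\<^sub>M M2" by (rule sigma_finite_pair_measure[OF M1.sigma_finite_measure_axioms M2.sigma_finite_measure_axioms])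
  have "KL_divergence b (density (M1 \<Otimes>\<^sub>M M2) g) (density (M1 \<Otimes>\<^sub>M M2) f) = (\<integral>z. f z * log b (f z / g z) \<partial>(M1 \<Otimes>\<^sub>M M2))"
    using b ac f0 g0 by (intro P.KL_density_density) (auto intro!: AE_I2)
  also have "\<dots> = (\<integral>x. ?H x \<partial>M1)" using integral_fst'[OF int] by simp
  finally have KL: "KL_divergence b (density (M1 \<Otimes>\<^sub>M M2) g) (density (M1 \<Otimes>\<^sub>M M2) f) = (\<integral>x. ?H x \<partial>M1)" .
  have "AE x in M1. g1 x = 0 \<longrightarrow> f1 x = 0" using key by eventually_elim simp
  then have KL1: "KL_divergence b (density M1 g1) (density M1 f1) = (\<integral>x. ?K x \<partial>M1)"
    using b f10 g10 by (intro M1.KL_density_density) (auto intro!: AE_I2)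
  show ?chain unfolding KL KL1 intD split by simp
  have AEnn: "AE x in M1. 0 \<le> f1 x * D x" using key by eventually_elim simp
  then show ?nonneg unfolding intD by (rule integral_nonneg_AE)
  have "(\<integral>x. D x \<partial>density M1 f1) = 0 \<longleftrightarrow> (AE x in M1. f1 x * D x = 0)"
    unfolding intD by (rule integral_nonneg_eq_0_iff_AE[OF iD AEnn])
  also have "\<dots> \<longleftrightarrow> (AE x in M1. 0 < f1 x \<longrightarrow> c f f1 x = c g g1 x)" (is "?A \<longleftrightarrow> ?B")
  proof
    show ?B if ?A using that key by eventually_elim auto
    show ?A if ?B using that key AE_space
      by eventually_elim (use f10 in \<open>auto simp: less_le\<close>)
  qed
  also have "\<dots> \<longleftrightarrow> (AE x in density M1 f1. c f f1 x = c g g1 x)"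
    by (subst AE_density) auto
  finally show ?eq .
qed

end

section \<open>Orthonormal coordinates on spaces of cochains\<close>

text \<open>\<open>restrict\<close> makes the result extensional, hence a point of the product space
  over \<open>{..<p + q}\<close>.\<close>

definition concat_coords :: "nat \<Rightarrow> nat \<Rightarrow> (nat \<Rightarrow> 'a) \<Rightarrow> (nat \<Rightarrow> 'a) \<Rightarrow> nat \<Rightarrow> 'a" where
  "concat_coords p q c d = (\<lambda>i\<in>{..<p + q}. if i < p then c i else d (i - p))"

lemma measurable_concat_coords [measurable]:
  "(\<lambda>z. concat_coords p q (fst z) (snd z)) \<in>
     measurable (PiM {..<p} (\<lambda>_. N) \<Otimes>\<^sub>M PiM {..<q} (\<lambda>_. N)) (PiM {..<p + q} (\<lambda>_. N))"
  unfolding concat_coords_def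
proof (rule measurable_restrict)
  fix i assume i: "i \<in> {..<p + q}"
  show "(\<lambda>z. if i < p then fst z i else snd z (i - p)) \<in> measurable (PiM {..<p} (\<lambda>_. N) \<Otimes>\<^sub>M PiM {..<q} (\<lambda>_. N)) N"
  proof (cases "i < p")
    case True
    have "(\<lambda>z. fst z i) \<in> measurable (PiM {..<p} (\<lambda>_. N) \<Otimes>\<^sub>M PiM {..<q} (\<lambda>_. N)) N"
      by (rule measurable_compose[OF measurable_fst measurable_component_singleton]) (use True in auto)
    then show ?thesis using True by simp
  next
    case False
    have "(\<lambda>z. snd z (i - p)) \<in> measurable (PiM {..<p} (\<lambda>_. N) \<Otimes>\<^sub>M PiM {..<q} (\<lambda>_. N)) N"
      by (rule measurable_compose[OF measurable_snd measurable_component_singleton]) (use False i in auto)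
    then show ?thesis using False by simp
  qed
qed

lemma prod_lessThan_add:
  fixes f :: "nat \<Rightarrow> 'a::comm_monoid_mult"
  shows "prod f {..<p + q} = prod f {..<p} * (\<Prod>i<q. f (p + i))"
  by (induction q) (simp_all add: mult.assoc)

lemma sum_lessThan_add:
  fixes f :: "nat \<Rightarrow> 'a::comm_monoid_add"
  shows "sum f {..<p + q} = sum f {..<p} + (\<Sum>i<q. f (p + i))"
  by (induction q) (simp_all add: add.assoc)

text \<open>Boxes determine a finite product measure, and the preimage of a box under concatenation
  is a product of two boxes.\<close>

lemma distr_concat_coords:
  fixes N :: "'a measure"
  assumes "sigma_finite_measure N"
  shows "distr (PiM {..<p} (\<lambda>_. N) \<Otimes>\<^sub>M PiM {..<q} (\<lambda>_. N)) (PiM {..<p + q} (\<lambda>_. N))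
    (\<lambda>z. concat_coords p q (fst z) (snd z)) = PiM {..<p + q} (\<lambda>_. N)"
proof -
  interpret N: sigma_finite_measure N by fact
  interpret product_sigma_finite "\<lambda>_::nat. N" by standard
  interpret finite_product_sigma_finite "\<lambda>_::nat. N" "{..<q}" by standard simp
  show ?thesis
  proof (rule PiM_eqI)
    fix A assume A: "\<And>i. i \<in> {..<p + q} \<Longrightarrow> A i \<in> sets N"
    have sub: "\<And>i x. i < p + q \<Longrightarrow> x \<in> A i \<Longrightarrow> x \<in> space N"
      using A sets.sets_into_space by blast
    have "(\<lambda>z. concat_coords p q (fst z) (snd z)) -` PiE {..<p + q} A \<inter> space (PiM {..<p} (\<lambda>_. N) \<Otimes>\<^sub>M PiM {..<q} (\<lambda>_. N))
      = PiE {..<p} A \<times> PiE {..<q} (\<lambda>i. A (p + i))" (is "?L = ?R")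
    proof (intro equalityI subsetI)
      fix z assume z: "z \<in> ?L"
      have 1: "(if i < p then fst z i else snd z (i - p)) \<in> A i" if "i < p + q" for i
        using z that by (auto simp: concat_coords_def PiE_iff)
      have "fst z i \<in> A i" if "i < p" for i using 1[of i] that by simp
      moreover have "snd z i \<in> A (p + i)" if "i < q" for i using 1[of "p + i"] that by simp
      ultimately show "z \<in> ?R" using z by (auto simp: space_pair_measure space_PiM PiE_iff)
    next
      fix z assume z: "z \<in> ?R"
      have "snd z (i - p) \<in> A i" if "\<not> i < p" "i < p + q" for i
      proof -
        have "snd z (i - p) \<in> A (p + (i - p))" using z that by (intro PiE_mem[of "snd z" "{..<q}" "\<lambda>i. A (p + i)"]) auto
        then show ?thesis using that by simp
      qed
      moreover have "fst z i \<in> space N" if "i < p" for i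
        using z that sub[of i "fst z i"] by (auto simp: PiE_iff)
      moreover have "snd z i \<in> space N" if "i < q" for i
        using z that sub[of "p + i" "snd z i"] by (auto simp: PiE_iff)
      ultimately show "z \<in> ?L" using z
        by (auto simp: concat_coords_def space_pair_measure space_PiM PiE_iff extensional_def)
    qed
    then have "emeasure (distr (PiM {..<p} (\<lambda>_. N) \<Otimes>\<^sub>M PiM {..<q} (\<lambda>_. N)) (PiM {..<p + q} (\<lambda>_. N))
       (\<lambda>z. concat_coords p q (fst z) (snd z))) (PiE {..<p + q} A) =
       emeasure (PiM {..<p} (\<lambda>_. N) \<Otimes>\<^sub>M PiM {..<q} (\<lambda>_. N)) (PiE {..<p} A \<times> PiE {..<q} (\<lambda>i. A (p + i)))"
      using A by (subst emeasure_distr) (auto intro!: sets_PiM_I_finite)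
    also have "\<dots> = emeasure (PiM {..<p} (\<lambda>_. N)) (PiE {..<p} A) * emeasure (PiM {..<q} (\<lambda>_. N)) (PiE {..<q} (\<lambda>i. A (p + i)))"
      using A by (intro emeasure_pair_measure_Times) (auto intro!: sets_PiM_I_finite)
    also have "emeasure (PiM {..<p} (\<lambda>_. N)) (PiE {..<p} A) = (\<Prod>i<p. emeasure N (A i))"
      by (rule emeasure_PiM) (auto intro: A)
    also have "emeasure (PiM {..<q} (\<lambda>_. N)) (PiE {..<q} (\<lambda>i. A (p + i))) = (\<Prod>i<q. emeasure N (A (p + i)))"
      by (rule emeasure_PiM) (auto intro: A)
    finally show "emeasure (distr (PiM {..<p} (\<lambda>_. N) \<Otimes>\<^sub>M PiM {..<q} (\<lambda>_. N)) (PiM {..<p + q} (\<lambda>_. N))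
       (\<lambda>z. concat_coords p q (fst z) (snd z))) (PiE {..<p + q} A) = (\<Prod>i\<in>{..<p + q}. emeasure N (A i))"
      by (simp add: prod_lessThan_add)
  qed simp_all
qed

lemma lin_comb_restrict: "lin_comb es (restrict c {..<length es}) = lin_comb es c"
  by (auto simp: lin_comb_def intro!: ext sum.cong)

lemma lin_comb_append:
  "lin_comb (ep @ eg) (concat_coords (length ep) (length eg) c d) = (\<lambda>xs. lin_comb ep c xs + lin_comb eg d xs)"
  by (auto simp: lin_comb_def sum_lessThan_add concat_coords_def nth_append intro!: ext arg_cong2[where f="(+)"] sum.cong)

lemma measurable_lin_comb:
  assumes "range (lin_comb es) \<subseteq> V"
  shows "lin_comb es \<in> measurable (PiM {..<length es} (\<lambda>_. lborel)) (restrict_space borel V)"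
proof (rule measurable_restrict_space2)
  \<comment> \<open>Continuity refers to the product topology on all functions, whereas points of
    \<open>PiM\<close> are \<open>undefined\<close> beyond the index set. Extension by zero, in
    \<open>r\<close> below, links the two.\<close>
  have c: "continuous_on UNIV (lin_comb es)"
    unfolding lin_comb_def by (intro continuous_intros continuous_on_product_then_coordinatewise[OF continuous_on_id])
  have r: "(\<lambda>c i. if i < length es then c i else 0) \<in> borel_measurable (PiM {..<length es} (\<lambda>_. lborel :: real measure))"
  proof (rule measurable_coordinatewise_then_product)
    fix i
    show "(\<lambda>c. if i < length es then c i else 0) \<in> borel_measurable (PiM {..<length es} (\<lambda>_. lborel :: real measure))"
    proof (cases "i < length es")
      case True
      then show ?thesis using measurable_component_singleton[of i "{..<length es}" "\<lambda>_. lborel :: real measure"]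
        by simp
    qed simp
  qed
  have "lin_comb es = (\<lambda>c. lin_comb es (\<lambda>i. if i < length es then c i else 0))"
    by (auto simp: lin_comb_def intro!: ext sum.cong)
  also have "\<dots> \<in> borel_measurable (PiM {..<length es} (\<lambda>_. lborel))"
    using measurable_compose[OF r borel_measurable_continuous_onI[OF c]] .
  finally show "lin_comb es \<in> borel_measurable (PiM {..<length es} (\<lambda>_. lborel))" .
qed (use assms in auto)

lemma space_lborel_PiM_restrict: "c \<in> space (PiM {..<n} (\<lambda>_. lborel)) \<Longrightarrow> restrict c {..<n::nat} = c"
  by (auto simp: space_PiM PiE_iff extensional_restrict)

text \<open>Cochains are functions on all lists, an infinite-dimensional space. Through
  \<open>local\<close> and the finite set \<open>S\<close> the form is, in its left argument, a
  finite combination of point evaluations, hence continuous and Borel measurable. Symmetry and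
  definiteness are left out so that the Whitney form is an instance in every degree.\<close>

locale cochain_form =
  fixes B :: "'v cochain \<Rightarrow> 'v cochain \<Rightarrow> real" and S :: "'v list set"
  assumes finite_support: "finite S"
    and linear_left: "B (\<lambda>xs. s * u xs + t * v xs) w = s * B u w + t * B v w"
    and local: "(\<And>xs. xs \<in> S \<Longrightarrow> u xs = v xs) \<Longrightarrow> B u w = B v w"
begin

lemma add_left: "B (\<lambda>xs. u xs + v xs) w = B u w + B v w"
  using linear_left[of 1 u 1 v w] by simp

lemma diff_left: "B (\<lambda>xs. u xs - v xs) w = B u w - B v w"
  using linear_left[of 1 u "-1" v w] by simp

lemma scale_left: "B (\<lambda>xs. s * u xs) w = s * B u w"
  using linear_left[of s u 0 u w] by simp

lemma zero_left: "B (\<lambda>xs. 0) w = 0"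
  using scale_left[of 0 "\<lambda>_. 0" w] by simp

lemma sum_left: "B (\<lambda>xs. \<Sum>i\<in>I. c i * u i xs) w = (\<Sum>i\<in>I. c i * B (u i) w)"
proof (induction I rule: infinite_finite_induct)
  case (insert i I)
  have "B (\<lambda>xs. \<Sum>i\<in>insert i I. c i * u i xs) w = B (\<lambda>xs. c i * u i xs + 1 * (\<Sum>i\<in>I. c i * u i xs)) w"
    using insert by simp
  also have "\<dots> = c i * B (u i) w + 1 * B (\<lambda>xs. \<Sum>i\<in>I. c i * u i xs) w"
    by (rule linear_left)
  finally show ?case using insert by simp
qed (simp_all add: zero_left)

lemma expansion: "B a w = (\<Sum>xs\<in>S. a xs * B (indicator {xs}) w)"
proof -
  have "B a w = B (\<lambda>ys. \<Sum>xs\<in>S. a xs * indicator {xs} ys) w"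
  proof (rule local)
    fix ys assume "ys \<in> S"
    then have "(\<Sum>xs\<in>S. a xs * indicator {xs} ys) = (\<Sum>xs\<in>S. if xs = ys then a xs else 0)"
      by (intro sum.cong) (auto simp: indicator_def)
    then show "a ys = (\<Sum>xs\<in>S. a xs * indicator {xs} ys)" using \<open>ys \<in> S\<close> finite_support by simp
  qed
  then show ?thesis by (simp only: sum_left)
qed

lemma borel_measurable_left: "(\<lambda>a. B a w) \<in> borel_measurable borel"
proof -
  have "continuous_on UNIV (\<lambda>a. \<Sum>xs\<in>S. a xs * B (indicator {xs}) w)"
    by (intro continuous_intros continuous_on_product_then_coordinatewise[OF continuous_on_id])
  then have "(\<lambda>a. \<Sum>xs\<in>S. a xs * B (indicator {xs}) w) \<in> borel_measurable borel"
    by (rule borel_measurable_continuous_onI)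
  then show ?thesis by (subst expansion)
qed

definition coords :: "'v cochain list \<Rightarrow> 'v cochain \<Rightarrow> nat \<Rightarrow> real" where
  "coords es a = (\<lambda>i\<in>{..<length es}. B a (es ! i))"

lemma measurable_coords: "coords es \<in> measurable (restrict_space borel W) (PiM {..<length es} (\<lambda>_. lborel))"
  unfolding coords_def
  using borel_measurable_left
  by (intro measurable_restrict measurable_restrict_space1) (simp cong: measurable_cong_sets)

definition orthonormal :: "'v cochain list \<Rightarrow> bool" where
  "orthonormal es \<longleftrightarrow> (\<forall>i<length es. \<forall>j<length es. B (es ! i) (es ! j) = (if i = j then 1 else 0))"

lemma lin_comb_left:
  assumes "orthonormal es" "i < length es"
  shows "B (lin_comb es c) (es ! i) = c i"
proof -
  have "B (lin_comb es c) (es ! i) = (\<Sum>j<length es. c j * (if j = i then 1 else 0))"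
    unfolding lin_comb_def sum_left using assms by (intro sum.cong) (auto simp: orthonormal_def)
  also have "\<dots> = (\<Sum>j<length es. if j = i then c j else 0)" by (intro sum.cong) auto
  finally show ?thesis using assms(2) by simp
qed

lemma coords_lin_comb: "orthonormal es \<Longrightarrow> coords es (lin_comb es c) = restrict c {..<length es}"
  unfolding coords_def by (auto simp: lin_comb_left)

lemma lin_comb_coords: "orthonormal es \<Longrightarrow> a \<in> range (lin_comb es) \<Longrightarrow> lin_comb es (coords es a) = a"
  by (auto simp: coords_lin_comb lin_comb_restrict)

lemma sets_lebesgue_of [measurable_cong, simp]: "sets (lebesgue_of V es) = sets (restrict_space borel V)"
  by (simp add: lebesgue_of_def)

lemma space_lebesgue_of [simp]: "space (lebesgue_of V es) = V"
  by (simp add: lebesgue_of_def space_restrict_space)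

text \<open>An image measure can lose sigma-finiteness, so the argument goes backwards: the image
  under \<open>coords es\<close> is the product Lebesgue measure again, and a measure with a
  sigma-finite image is sigma-finite.\<close>

lemma sigma_finite_lebesgue_of:
  assumes "orthonormal es" "range (lin_comb es) \<subseteq> V"
  shows "sigma_finite_measure (lebesgue_of V es)"
proof (rule sigma_finite_measure_distr)
  let ?L = "PiM {..<length es} (\<lambda>_. lborel :: real measure)"
  show c: "coords es \<in> measurable (lebesgue_of V es) ?L"
    using measurable_coords unfolding lebesgue_of_def by simp
  interpret product_sigma_finite "\<lambda>_::nat. lborel :: real measure" by standard
  interpret finite_product_sigma_finite "\<lambda>_::nat. lborel :: real measure" "{..<length es}" by standard simp
  have "distr (lebesgue_of V es) ?L (coords es) = distr ?L ?L (\<lambda>c. coords es (lin_comb es c))"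
    unfolding lebesgue_of_def
    by (subst distr_distr[OF measurable_coords measurable_lin_comb[OF assms(2)]]) (simp add: comp_def)
  also have "\<dots> = distr ?L ?L (\<lambda>c. c)"
    by (rule distr_cong) (auto simp: coords_lin_comb[OF assms(1)] space_lborel_PiM_restrict)
  also have "\<dots> = ?L" by (rule distr_id)
  finally show "sigma_finite_measure (distr (lebesgue_of V es) ?L (coords es))"
    by (simp add: sigma_finite_measure_axioms)
qed

end

locale orthogonal_sectors = cochain_form +
  fixes V Vp Vg :: "'a cochain set" and ep eg :: "'a cochain list"
  assumes basis_p: "orthonormal_basis B Vp ep" and basis_g: "orthonormal_basis B Vg eg"
    and orth_pg: "x \<in> Vp \<Longrightarrow> y \<in> Vg \<Longrightarrow> B x y = 0"
    and symmetric: "B u v = B v u"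
    and sum_sub: "x \<in> Vp \<Longrightarrow> y \<in> Vg \<Longrightarrow> (\<lambda>xs. x xs + y xs) \<in> V"
begin

abbreviation "RV \<equiv> restrict_space borel V"
abbreviation "Lp \<equiv> lebesgue_of Vp ep"
abbreviation "Lg \<equiv> lebesgue_of Vg eg"
abbreviation "L \<equiv> lebesgue_of V (ep @ eg)"

lemma orth_gp: "x \<in> Vp \<Longrightarrow> y \<in> Vg \<Longrightarrow> B y x = 0"
  using orth_pg symmetric by metis

definition plus :: "'a cochain \<times> 'a cochain \<Rightarrow> 'a cochain" where
  "plus z = (\<lambda>xs. fst z xs + snd z xs)"

lemma range_p: "range (lin_comb ep) = Vp" and range_g: "range (lin_comb eg) = Vg"
  using basis_p basis_g by (auto simp: orthonormal_basis_def)

lemma orthonormal_p: "orthonormal ep" and orthonormal_g: "orthonormal eg"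
  using basis_p basis_g by (auto simp: orthonormal_basis_def orthonormal_def)

lemma nth_lin_comb: "i < length es \<Longrightarrow> es ! i \<in> range (lin_comb es)"
proof (rule image_eqI)
  assume "i < length es"
  then show "es ! i = lin_comb es (\<lambda>j. if j = i then 1 else 0)"
    by (auto simp: lin_comb_def if_distrib[of "\<lambda>x. x * _"] cong: if_cong)
qed simp

lemma nth_p: "i < length ep \<Longrightarrow> ep ! i \<in> Vp" and nth_g: "i < length eg \<Longrightarrow> eg ! i \<in> Vg"
  using nth_lin_comb range_p range_g by blast+

lemma orthonormal_append: "orthonormal (ep @ eg)"
  unfolding orthonormal_def
proof safe
  fix i j assume "i < length (ep @ eg)" "j < length (ep @ eg)"
  then show "B ((ep @ eg) ! i) ((ep @ eg) ! j) = (if i = j then 1 else 0)"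
    using orthonormal_p orthonormal_g nth_p nth_g orth_pg orth_gp
    by (auto simp: nth_append orthonormal_def)
qed

lemma lin_comb_append_split:
  "lin_comb (ep @ eg) c = plus (lin_comb ep c, lin_comb eg (\<lambda>i. c (length ep + i)))"
  by (auto simp: plus_def lin_comb_def sum_lessThan_add nth_append intro!: ext)

lemma range_append: "range (lin_comb (ep @ eg)) \<subseteq> V"
  using sum_sub range_p range_g unfolding lin_comb_append_split plus_def by fastforce

sublocale p: sigma_finite_measure Lp
  using sigma_finite_lebesgue_of[OF orthonormal_p] range_p by simp

sublocale g: sigma_finite_measure Lg
  using sigma_finite_lebesgue_of[OF orthonormal_g] range_g by simp

sublocale L: sigma_finite_measure L
  using sigma_finite_lebesgue_of[OF orthonormal_append range_append] .

sublocale pair_sigma_finite Lp Lg ..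

text \<open>The index type of cochains may be uncountable, and then the Borel sets of a product need
  not be generated by rectangles. The sum is therefore factored through the finitely many basis
  coordinates.\<close>

lemma measurable_plus [measurable]: "plus \<in> measurable (Lp \<Otimes>\<^sub>M Lg) RV"
proof -
  let ?k = "\<lambda>z. concat_coords (length ep) (length eg) (coords ep (fst z)) (coords eg (snd z))"
  have p: "coords ep \<in> measurable Lp (PiM {..<length ep} (\<lambda>_. lborel))"
    and g: "coords eg \<in> measurable Lg (PiM {..<length eg} (\<lambda>_. lborel))"
    using measurable_coords unfolding lebesgue_of_def by simp_all
  have "?k \<in> measurable (Lp \<Otimes>\<^sub>M Lg) (PiM {..<length (ep @ eg)} (\<lambda>_. lborel))"
    using measurable_compose[OF measurable_Pair[OF measurable_compose[OF measurable_fst p] measurable_compose[OF measurable_snd g]]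
        measurable_concat_coords[of "length ep" "length eg" lborel]] by simp
  then have "(\<lambda>z. lin_comb (ep @ eg) (?k z)) \<in> measurable (Lp \<Otimes>\<^sub>M Lg) RV"
    by (rule measurable_compose) (rule measurable_lin_comb[OF range_append])
  moreover have "lin_comb (ep @ eg) (?k z) = plus z" if "z \<in> space (Lp \<Otimes>\<^sub>M Lg)" for z
    using that lin_comb_coords[OF orthonormal_p, of "fst z"] lin_comb_coords[OF orthonormal_g, of "snd z"]
    unfolding lin_comb_append by (auto simp: space_pair_measure range_p range_g plus_def)
  ultimately show ?thesis by (simp cong: measurable_cong)
qed

text \<open>Both sides are images of Lebesgue measure on coordinate space, and concatenating
  coordinates turns \<open>lin_comb (ep @ eg)\<close> into the sum of the two combinations.\<close>

lemma lebesgue_of_append: "L = distr (Lp \<Otimes>\<^sub>M Lg) RV plus"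
proof -
  let ?Kp = "PiM {..<length ep} (\<lambda>_. lborel :: real measure)" and ?Kg = "PiM {..<length eg} (\<lambda>_. lborel :: real measure)"
  have mp: "lin_comb ep \<in> measurable ?Kp (restrict_space borel Vp)"
    and mg: "lin_comb eg \<in> measurable ?Kg (restrict_space borel Vg)"
    using measurable_lin_comb range_p range_g by blast+
  have "Lp \<Otimes>\<^sub>M Lg = distr (?Kp \<Otimes>\<^sub>M ?Kg) (restrict_space borel Vp \<Otimes>\<^sub>M restrict_space borel Vg) (\<lambda>(c, d). (lin_comb ep c, lin_comb eg d))"
    using pair_measure_distr[OF mp mg] g.sigma_finite_measure_axioms unfolding lebesgue_of_def by simp
  then have "distr (Lp \<Otimes>\<^sub>M Lg) RV plus = distr (distr (?Kp \<Otimes>\<^sub>M ?Kg) (restrict_space borel Vp \<Otimes>\<^sub>M restrict_space borel Vg) (\<lambda>(c, d). (lin_comb ep c, lin_comb eg d))) RV plus"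
    by simp
  also have "\<dots> = distr (?Kp \<Otimes>\<^sub>M ?Kg) RV (plus \<circ> (\<lambda>(c, d). (lin_comb ep c, lin_comb eg d)))"
  proof (rule distr_distr)
    have "sets (Lp \<Otimes>\<^sub>M Lg) = sets (restrict_space borel Vp \<Otimes>\<^sub>M restrict_space borel Vg)"
      by (rule sets_pair_measure_cong) simp_all
    then show "plus \<in> measurable (restrict_space borel Vp \<Otimes>\<^sub>M restrict_space borel Vg) RV"
      using measurable_plus measurable_cong_sets by blast
    show "(\<lambda>(c, d). (lin_comb ep c, lin_comb eg d)) \<in> measurable (?Kp \<Otimes>\<^sub>M ?Kg) (restrict_space borel Vp \<Otimes>\<^sub>M restrict_space borel Vg)"
      using mp mg by measurable
  qed
  also have "\<dots> = distr (?Kp \<Otimes>\<^sub>M ?Kg) RV (lin_comb (ep @ eg) \<circ> (\<lambda>z. concat_coords (length ep) (length eg) (fst z) (snd z)))"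
    by (rule distr_cong) (auto simp: plus_def lin_comb_append)
  also have "\<dots> = distr (distr (?Kp \<Otimes>\<^sub>M ?Kg) (PiM {..<length ep + length eg} (\<lambda>_. lborel)) (\<lambda>z. concat_coords (length ep) (length eg) (fst z) (snd z))) RV (lin_comb (ep @ eg))"
    using measurable_lin_comb[OF range_append] by (subst distr_distr) auto
  also have "\<dots> = L"
    by (subst distr_concat_coords) (auto simp: lebesgue_of_def lborel.sigma_finite_measure_axioms)
  finally show ?thesis by simp
qed

text \<open>A vector of \<open>Vp\<close> is determined by its products with the basis, so the
  \<open>THE\<close> of the definition is resolved by the Fourier coefficients.\<close>

lemma orth_projection_eq: "orth_projection B Vp a = lin_comb ep (coords ep a)"
  unfolding orth_projection_def
proof (rule the_equality)
  have "B (\<lambda>xs. a xs - lin_comb ep (coords ep a) xs) (ep ! i) = 0" if "i < length ep" for i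
    using that by (simp add: diff_left lin_comb_left[OF orthonormal_p]) (simp add: coords_def)
  then have "B (ep ! i) (\<lambda>xs. a xs - lin_comb ep (coords ep a) xs) = 0" if "i < length ep" for i
    using that symmetric[of "ep ! i"] by metis
  then have "B (lin_comb ep c) (\<lambda>xs. a xs - lin_comb ep (coords ep a) xs) = 0" for c
    unfolding lin_comb_def[of ep c] sum_left by (intro sum.neutral) simp
  then have "B (\<lambda>xs. a xs - lin_comb ep (coords ep a) xs) (lin_comb ep c) = 0" for c
    using symmetric[of _ "lin_comb ep c"] by metis
  then show "lin_comb ep (coords ep a) \<in> Vp \<and> (\<forall>y\<in>Vp. B (\<lambda>xs. a xs - lin_comb ep (coords ep a) xs) y = 0)"
    using range_p by blast
  fix z assume z: "z \<in> Vp \<and> (\<forall>w\<in>Vp. B (\<lambda>xs. a xs - z xs) w = 0)"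
  then have "B a (ep ! i) = B z (ep ! i)" if "i < length ep" for i
    using nth_p[OF that] diff_left[of a z "ep ! i"] by (metis eq_iff_diff_eq_0)
  then have "coords ep a = coords ep z" unfolding coords_def by (auto intro!: restrict_ext)
  then show "z = lin_comb ep (coords ep a)"
    using lin_comb_coords[OF orthonormal_p, of z] z range_p by auto
qed

lemma orth_projection_plus:
  assumes "z \<in> space (Lp \<Otimes>\<^sub>M Lg)"
  shows "orth_projection B Vp (plus z) = fst z"
proof -
  have z: "fst z \<in> Vp" "snd z \<in> Vg" using assms by (auto simp: space_pair_measure)
  have "B (plus z) (ep ! i) = B (fst z) (ep ! i)" if "i < length ep" for i
    using nth_p[OF that] z by (simp add: plus_def add_left orth_gp)
  then have "coords ep (plus z) = coords ep (fst z)" unfolding coords_def by (auto intro!: restrict_ext)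
  then show ?thesis
    using lin_comb_coords[OF orthonormal_p, of "fst z"] z range_p by (simp add: orth_projection_eq)
qed

lemma measurable_orth_projection: "orth_projection B Vp \<in> measurable (restrict_space borel W) (restrict_space borel Vp)"
proof -
  have "lin_comb ep \<in> measurable (PiM {..<length ep} (\<lambda>_. lborel)) (restrict_space borel Vp)"
    using measurable_lin_comb range_p by blast
  from measurable_compose[OF measurable_coords this] show ?thesis
    unfolding orth_projection_eq[abs_def] .
qed

text \<open>The density of a marginal is only determined almost everywhere, and the conditional measures are
  built from arbitrary versions of all densities.\<close>

theorem relative_entropy_chain_rule:
  assumes mu: "has_density V (ep @ eg) \<mu> f" and nu: "has_density V (ep @ eg) \<nu> g"
    and pmu: "prob_space \<mu>" and pnu: "prob_space \<nu>"
    and ac: "AE a in L. g a = 0 \<longrightarrow> f a = 0"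
    and int: "integrable L (\<lambda>a. f a * ln (f a / g a))"
    and mup: "\<mu>p = distr \<mu> (restrict_space borel Vp) (orth_projection B Vp)"
    and nup: "\<nu>p = distr \<nu> (restrict_space borel Vp) (orth_projection B Vp)"
    and dmup: "has_density Vp ep \<mu>p fp" and dnup: "has_density Vp ep \<nu>p gp"
    and I: "I = gauge_information \<mu>p (conditional Vg eg f fp) (conditional Vg eg g gp)"
  shows "relative_entropy \<mu> \<nu> = relative_entropy \<mu>p \<nu>p + I" and "0 \<le> I"
    and "I = 0 \<longleftrightarrow> (AE x in \<mu>p. conditional Vg eg f fp x = conditional Vg eg g gp x)"
proof -
  let ?P = "Lp \<Otimes>\<^sub>M Lg"
  have fg[measurable]: "f \<in> borel_measurable RV" "g \<in> borel_measurable RV"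
    and fg0: "\<And>a. a \<in> V \<Longrightarrow> 0 \<le> f a" "\<And>a. a \<in> V \<Longrightarrow> 0 \<le> g a"
    and \<mu>: "\<mu> = density L f" and \<nu>: "\<nu> = density L g"
    using mu nu by (auto simp: has_density_def)
  have fgp[measurable]: "fp \<in> borel_measurable Lp" "gp \<in> borel_measurable Lp"
    and fgp0: "\<And>a. a \<in> Vp \<Longrightarrow> 0 \<le> fp a" "\<And>a. a \<in> Vp \<Longrightarrow> 0 \<le> gp a"
    and \<mu>p: "\<mu>p = density Lp fp" and \<nu>p: "\<nu>p = density Lp gp"
    using dmup dnup by (auto simp: has_density_def cong: measurable_cong_sets)
  have plus_V: "plus z \<in> V" if "z \<in> space ?P" for z
    using that sum_sub by (auto simp: plus_def space_pair_measure)
  have dens: "density L h = distr (density ?P (\<lambda>z. h (plus z))) RV plus"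
    if [measurable]: "h \<in> borel_measurable RV" for h :: "'a cochain \<Rightarrow> ennreal"
    unfolding lebesgue_of_append by (rule density_distr) auto
  have prob: "prob_space (density ?P (\<lambda>z. ennreal (h (plus z))))"
    if [measurable]: "h \<in> borel_measurable RV" and p: "prob_space (density L h)" for h :: "'a cochain \<Rightarrow> real"
    using p by (subst (asm) dens) (auto intro: prob_space_distrD[rotated])
  \<comment> \<open>Pulled back along \<open>plus\<close>, the projection becomes
    \<open>fst\<close>; Tonelli's theorem then integrates out the gauge variable.\<close>
  have marginal: "distr (density L h) (restrict_space borel Vp) (orth_projection B Vp) =
      density Lp (\<lambda>x. \<integral>\<^sup>+y. h (plus (x, y)) \<partial>Lg)"
    if [measurable]: "h \<in> borel_measurable RV" for h :: "'a cochain \<Rightarrow> real"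
  proof -
    let ?Q = "density ?P (\<lambda>z. ennreal (h (plus z)))"
    have "distr (density L h) (restrict_space borel Vp) (orth_projection B Vp) =
        distr ?Q (restrict_space borel Vp) (orth_projection B Vp \<circ> plus)"
      by (subst dens) (auto intro!: distr_distr measurable_orth_projection)
    also have "\<dots> = distr ?Q (restrict_space borel Vp) fst"
      by (rule distr_cong) (auto simp: orth_projection_plus)
    also have "\<dots> = density Lp (\<lambda>x. \<integral>\<^sup>+y. h (plus (x, y)) \<partial>Lg)"
    proof (rule measure_eqI)
      fix A assume "A \<in> sets (distr ?Q (restrict_space borel Vp) fst)"
      then have A: "A \<in> sets Lp" by simp
      then have [measurable]: "A \<in> sets (restrict_space borel Vp)" by simp
      have [measurable]: "fst \<in> measurable ?P (restrict_space borel Vp)"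
        using measurable_fst[of Lp Lg] by (simp cong: measurable_cong_sets)
      have B: "fst -` A \<inter> space ?P \<in> sets ?P" by (rule measurable_sets[OF measurable_fst A])
      have "emeasure (distr ?Q (restrict_space borel Vp) fst) A = emeasure ?Q (fst -` A \<inter> space ?P)"
        by (subst emeasure_distr) auto
      also have "\<dots> = (\<integral>\<^sup>+z. ennreal (h (plus z)) * indicator (fst -` A \<inter> space ?P) z \<partial>?P)"
        using B by (subst emeasure_density) auto
      also have "\<dots> = (\<integral>\<^sup>+z. ennreal (h (plus z)) * indicator A (fst z) \<partial>?P)"
        by (intro nn_integral_cong) (auto split: split_indicator)
      also have "\<dots> = (\<integral>\<^sup>+x. \<integral>\<^sup>+y. ennreal (h (plus (x, y))) * indicator A x \<partial>Lg \<partial>Lp)"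
        using A by (subst g.nn_integral_fst[symmetric]) auto
      also have "\<dots> = (\<integral>\<^sup>+x. (\<integral>\<^sup>+y. h (plus (x, y)) \<partial>Lg) * indicator A x \<partial>Lp)"
        by (intro nn_integral_cong nn_integral_multc) measurable
      also have "\<dots> = emeasure (density Lp (\<lambda>x. \<integral>\<^sup>+y. h (plus (x, y)) \<partial>Lg)) A"
        using A by (subst emeasure_density) auto
      finally show "emeasure (distr ?Q (restrict_space borel Vp) fst) A = emeasure (density Lp (\<lambda>x. \<integral>\<^sup>+y. h (plus (x, y)) \<partial>Lg)) A" .
    qed simp
    finally show ?thesis .
  qed
  have e: "(1::real) < exp 1" by simp
  have ac': "AE z in ?P. g (plus z) = 0 \<longrightarrow> f (plus z) = 0"
    using ac unfolding lebesgue_of_append by (subst (asm) AE_distr_iff) auto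
  have int': "integrable ?P (\<lambda>z. f (plus z) * log (exp 1) (f (plus z) / g (plus z)))"
    using int unfolding lebesgue_of_append by (subst (asm) integrable_distr_eq) (auto simp: log_def)
  have mf: "density Lp fp = density Lp (\<lambda>x. \<integral>\<^sup>+y. f (plus (x, y)) \<partial>Lg)"
    using marginal[OF fg(1)] mup \<mu>p \<mu> by simp
  have mg: "density Lp gp = density Lp (\<lambda>x. \<integral>\<^sup>+y. g (plus (x, y)) \<partial>Lg)"
    using marginal[OF fg(2)] nup \<nu>p \<nu> by simp
  have cond: "conditional Vg eg h hp x = density Lg (\<lambda>y. ennreal (h (plus (x, y)) / hp x))" for h hp x
    by (simp add: conditional_def plus_def)
  note chain = KL_chain_rule[OF e _ _ _ _ prob[OF fg(1)] prob[OF fg(2)] fgp(1) _ fgp(2) _ mf mg ac' int']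
  have KL: "KL_divergence (exp 1) (density L g) (density L f) =
      KL_divergence (exp 1) (density ?P (\<lambda>z. g (plus z))) (density ?P (\<lambda>z. f (plus z)))"
  proof -
    interpret P: sigma_finite_measure ?P by (rule sigma_finite_pair_measure[OF p.sigma_finite_measure_axioms g.sigma_finite_measure_axioms])
    have "KL_divergence (exp 1) (density L g) (density L f) = (\<integral>a. f a * log (exp 1) (f a / g a) \<partial>L)"
      using fg0 ac by (intro L.KL_density_density) (auto intro!: AE_I2)
    also have "\<dots> = (\<integral>z. f (plus z) * log (exp 1) (f (plus z) / g (plus z)) \<partial>?P)"
      unfolding lebesgue_of_append by (subst integral_distr) auto
    also have "\<dots> = KL_divergence (exp 1) (density ?P (\<lambda>z. g (plus z))) (density ?P (\<lambda>z. f (plus z)))"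
      using fg0 plus_V ac' by (intro P.KL_density_density[symmetric]) (auto intro!: AE_I2)
    finally show ?thesis .
  qed
  show "relative_entropy \<mu> \<nu> = relative_entropy \<mu>p \<nu>p + I" "0 \<le> I"
    "I = 0 \<longleftrightarrow> (AE x in \<mu>p. conditional Vg eg f fp x = conditional Vg eg g gp x)"
    using chain fg0 fgp0 plus_V pmu pnu
    unfolding I relative_entropy_def gauge_information_def cond \<mu>p \<nu>p \<mu> \<nu> KL by auto
qed

end

section \<open>Gaussian densities\<close>

definition quad :: "nat \<Rightarrow> (nat \<Rightarrow> nat \<Rightarrow> real) \<Rightarrow> (nat \<Rightarrow> real) \<Rightarrow> (nat \<Rightarrow> real) \<Rightarrow> real" where
  "quad n S u v = (\<Sum>i<n. \<Sum>j<n. u i * S i j * v j)"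

lemma quad_add: "quad n S (\<lambda>i. t * u i + v i) (\<lambda>i. t * u i + v i) =
    t\<^sup>2 * quad n S u u + t * (quad n S u v + quad n S v u) + quad n S v v"
  by (simp add: quad_def sum.distrib sum_distrib_left algebra_simps power2_eq_square)

text \<open>Cauchy--Schwarz for the covariance form, applied to a coordinate vector and to \<open>P d\<close>, bounds
  the precision form from below.\<close>

lemma quad_inverse_coercive:
  fixes S P :: "nat \<Rightarrow> nat \<Rightarrow> real"
  assumes sym: "\<And>i j. i < n \<Longrightarrow> j < n \<Longrightarrow> S i j = S j i"
    and pos: "\<And>w k. k < n \<Longrightarrow> w k \<noteq> 0 \<Longrightarrow> 0 < quad n S w w"
    and inv: "\<And>i k. i < n \<Longrightarrow> k < n \<Longrightarrow> (\<Sum>j<n. S i j * P j k) = (if i = k then 1 else 0)"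
  shows "(\<Sum>i<n. (d i)\<^sup>2) \<le> (1 + (\<Sum>i<n. S i i)) * quad n P d d" and "0 \<le> (\<Sum>i<n. S i i)"
proof -
  define y where "y j = (\<Sum>k<n. P j k * d k)" for j
  have nn: "0 \<le> quad n S w w" for w
  proof (cases "\<exists>k<n. w k \<noteq> 0")
    case False
    then show ?thesis by (simp add: quad_def)
  qed (use pos less_imp_le in blast)
  have swap: "quad n S u v = quad n S v u" for u v
    unfolding quad_def by (subst sum.swap) (auto intro!: sum.cong simp: sym mult_ac)
  have Sy: "(\<Sum>j<n. S i j * y j) = d i" if i: "i < n" for i
  proof -
    have "(\<Sum>j<n. S i j * y j) = (\<Sum>j<n. \<Sum>k<n. S i j * P j k * d k)"
      by (simp add: y_def sum_distrib_left mult_ac)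
    also have "\<dots> = (\<Sum>k<n. (\<Sum>j<n. S i j * P j k) * d k)"
      by (subst sum.swap) (simp add: sum_distrib_right)
    also have "\<dots> = (\<Sum>k<n. if i = k then d k else 0)"
      using i by (intro sum.cong) (auto simp: inv)
    finally show ?thesis using i by simp
  qed
  have uy: "quad n S u y = (\<Sum>i<n. u i * d i)" for u
  proof -
    have "quad n S u y = (\<Sum>i<n. u i * (\<Sum>j<n. S i j * y j))"
      by (simp add: quad_def sum_distrib_left mult_ac)
    then show ?thesis using Sy by simp
  qed
  have yy: "quad n S y y = quad n P d d"
    unfolding uy by (simp add: y_def quad_def sum_distrib_left sum_distrib_right mult_ac)
  define e where "e i = (\<lambda>j. if j = i then 1 else 0 :: real)" for i :: nat
  have ey: "quad n S (e i) y = d i" if "i < n" for i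
    unfolding uy using that by (simp add: e_def if_distrib[of "\<lambda>x. x * _"] cong: if_cong)
  have ee: "quad n S (e i) (e i) = S i i" if "i < n" for i
  proof -
    have "quad n S (e i) (e i) = (\<Sum>a<n. if a = i then \<Sum>b<n. if b = i then S a b else 0 else 0)"
      unfolding quad_def e_def by (intro sum.cong) (auto simp: if_distrib[of "(*) _"] cong: if_cong)
    then show ?thesis using that by simp
  qed
  have Sp: "0 < S i i" if "i < n" for i
    using pos[OF that, of "e i"] ee[OF that] by (simp add: e_def)
  have di: "(d i)\<^sup>2 \<le> S i i * quad n P d d" if i: "i < n" for i
  proof -
    \<comment> \<open>The minimizer of the quadratic polynomial in \<open>t\<close> given by the
      covariance form at \<open>t * e i + y\<close>; its value there being nonnegative is
      Cauchy--Schwarz.\<close>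
    let ?t = "- d i / S i i"
    have "0 \<le> ?t\<^sup>2 * S i i + ?t * (d i + d i) + quad n P d d"
      using nn[of "\<lambda>j. ?t * e i j + y j"] unfolding quad_add swap[of y "e i"] ey[OF i] ee[OF i] yy .
    then have "0 \<le> quad n P d d - (d i)\<^sup>2 / S i i"
      using Sp[OF i] by (simp add: power2_eq_square field_simps)
    then show ?thesis using Sp[OF i] by (simp add: field_simps)
  qed
  have "(\<Sum>i<n. (d i)\<^sup>2) \<le> (\<Sum>i<n. S i i * quad n P d d)" using di by (intro sum_mono) auto
  \<comment> \<open>The summand 1 keeps the factor positive also for \<open>n = 0\<close>, so that
    it can be inverted later.\<close>
  also have "\<dots> \<le> (1 + (\<Sum>i<n. S i i)) * quad n P d d"
    using nn[of y] unfolding yy by (simp add: sum_distrib_right[symmetric] distrib_right)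
  finally show "(\<Sum>i<n. (d i)\<^sup>2) \<le> (1 + (\<Sum>i<n. S i i)) * quad n P d d" .
  show "0 \<le> (\<Sum>i<n. S i i)" using Sp by (intro sum_nonneg) (auto intro: less_imp_le)
qed

lemma abs_quad_le: "\<bar>quad n P d d\<bar> \<le> (\<Sum>i<n. \<Sum>j<n. \<bar>P i j\<bar>) * (\<Sum>i<n. (d i)\<^sup>2)"
proof -
  have "\<bar>d i\<bar> * \<bar>d j\<bar> \<le> (\<Sum>i<n. (d i)\<^sup>2)" if "i < n" "j < n" for i j
  proof -
    have "(d i)\<^sup>2 \<le> (\<Sum>i<n. (d i)\<^sup>2)" "(d j)\<^sup>2 \<le> (\<Sum>i<n. (d i)\<^sup>2)"
      using that by (auto intro!: member_le_sum)
    moreover have "2 * (\<bar>d i\<bar> * \<bar>d j\<bar>) \<le> (d i)\<^sup>2 + (d j)\<^sup>2"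
      using sum_squares_bound[of "\<bar>d i\<bar>" "\<bar>d j\<bar>"] by (simp add: mult_ac)
    ultimately show ?thesis by linarith
  qed
  then have "\<bar>d i * P i j * d j\<bar> \<le> \<bar>P i j\<bar> * (\<Sum>i<n. (d i)\<^sup>2)" if "i < n" "j < n" for i j
    using mult_left_mono[of "\<bar>d i\<bar> * \<bar>d j\<bar>" "\<Sum>i<n. (d i)\<^sup>2" "\<bar>P i j\<bar>"] that by (simp add: abs_mult mult_ac)
  then have "\<bar>quad n P d d\<bar> \<le> (\<Sum>i<n. \<Sum>j<n. \<bar>P i j\<bar> * (\<Sum>i<n. (d i)\<^sup>2))"
    unfolding quad_def by (intro order_trans[OF sum_abs] sum_mono) auto
  then show ?thesis by (simp add: sum_distrib_right)
qed

lemma integrable_exp_square: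
  fixes a m :: real
  assumes "0 < a"
  shows "integrable lborel (\<lambda>x. exp (- a * (x - m)\<^sup>2))"
proof -
  define \<sigma> where "\<sigma> = sqrt (1 / (2 * a))"
  have \<sigma>: "\<sigma>\<^sup>2 = 1 / (2 * a)" "0 < \<sigma>" using assms by (simp_all add: \<sigma>_def)
  have "(\<lambda>x. exp (- a * (x - m)\<^sup>2)) = (\<lambda>x. sqrt (2 * pi * \<sigma>\<^sup>2) * normal_density m \<sigma> x)"
    using assms \<sigma> by (auto simp: normal_density_def fun_eq_iff)
  then show ?thesis using \<sigma>(2) by simp
qed

context cochain_form
begin

text \<open>Condenses a Gaussian to what the estimates use: a positive normalization and a coercive
  exponent. The constant \<open>\<kappa>\<close> obtained is the inverse of 1 plus the trace of the
  covariance matrix.\<close>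

lemma nondegenerate_gaussian_density:
  assumes "nondegenerate_gaussian B V es \<mu>"
  obtains m P Z \<kappa> where "0 < Z" "0 < \<kappa>"
    "\<forall>d. \<kappa> * (\<Sum>i<length es. (d i)\<^sup>2) \<le> quad (length es) P d d"
    "has_density V es \<mu> (\<lambda>a. exp (- quad (length es) P (\<lambda>i. B a (es ! i) - m i) (\<lambda>i. B a (es ! i) - m i) / 2) / Z)"
proof -
  let ?n = "length es"
  obtain m S P where prob: "prob_space \<mu>" and m: "m \<in> carrier_vec ?n" and S: "S \<in> carrier_mat ?n ?n" and P: "P \<in> carrier_mat ?n ?n"
    and sym: "transpose_mat S = S" and pos: "\<forall>w\<in>carrier_vec ?n. w \<noteq> 0\<^sub>v ?n \<longrightarrow> scalar_prod w (S *\<^sub>v w) > 0"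
    and inv: "inverts_mat S P"
    and dens: "has_density V es \<mu>
          (\<lambda>a. exp (- scalar_prod (Matrix.vec ?n (\<lambda>i. B a (es ! i)) - m) (P *\<^sub>v (Matrix.vec ?n (\<lambda>i. B a (es ! i)) - m)) / 2) /
               sqrt ((2 * pi) ^ ?n * Determinant.det S))"
    using assms unfolding nondegenerate_gaussian_def Let_def by blast
  define Z where "Z = sqrt ((2 * pi) ^ ?n * Determinant.det S)"
  define \<sigma> where "\<sigma> i j = S $$ (i, j)" for i j
  define \<rho> where "\<rho> i j = P $$ (i, j)" for i j
  have quadP: "scalar_prod (Matrix.vec ?n (\<lambda>i. B a (es ! i)) - m) (P *\<^sub>v (Matrix.vec ?n (\<lambda>i. B a (es ! i)) - m)) =
      quad ?n \<rho> (\<lambda>i. B a (es ! i) - Matrix.vec_index m i) (\<lambda>i. B a (es ! i) - Matrix.vec_index m i)" for a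
    using m P by (simp add: scalar_prod_def quad_def \<rho>_def sum_distrib_left lessThan_atLeast0 mult.assoc)
  have symS: "\<sigma> i j = \<sigma> j i" if "i < ?n" "j < ?n" for i j
    using arg_cong[OF sym, of "\<lambda>A. A $$ (j, i)"] S that by (simp add: \<sigma>_def)
  have posS: "0 < quad ?n \<sigma> w w" if k: "k < ?n" "w k \<noteq> 0" for w k
  proof -
    let ?w = "Matrix.vec ?n w"
    have "?w \<noteq> 0\<^sub>v ?n"
    proof
      assume "?w = 0\<^sub>v ?n"
      then have "Matrix.vec_index ?w k = 0" using k by simp
      then show False using k by simp
    qed
    then have "0 < scalar_prod ?w (S *\<^sub>v ?w)" using pos by simp
    also have "\<dots> = quad ?n \<sigma> w w"
      using S by (simp add: scalar_prod_def quad_def \<sigma>_def sum_distrib_left lessThan_atLeast0 mult.assoc)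
    finally show ?thesis .
  qed
  have invS: "(\<Sum>j<?n. \<sigma> i j * \<rho> j k) = (if i = k then 1 else 0)" if "i < ?n" "k < ?n" for i k
  proof -
    have "(S * P) $$ (i, k) = (1\<^sub>m ?n) $$ (i, k)" using inv S by (simp add: inverts_mat_def)
    then show ?thesis using S P that by (simp add: scalar_prod_def \<sigma>_def \<rho>_def lessThan_atLeast0)
  qed
  note coercive = quad_inverse_coercive[of ?n \<sigma> \<rho>, OF symS posS invS]
  define c where "c = 1 + (\<Sum>i<?n. \<sigma> i i)"
  have c: "0 < c" "(\<Sum>i<?n. (d i)\<^sup>2) \<le> c * quad ?n \<rho> d d" for d
    using coercive unfolding c_def by fastforce+
  have dens': "has_density V es \<mu> (\<lambda>a. exp (- quad ?n \<rho> (\<lambda>i. B a (es ! i) - Matrix.vec_index m i) (\<lambda>i. B a (es ! i) - Matrix.vec_index m i) / 2) / Z)"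
    using dens unfolding quadP Z_def .
  \<comment> \<open>Read off from the total mass: nonnegativity of the density leaves only
    \<open>Z = 0\<close> as an alternative, and then division by zero would make the density
    vanish.\<close>
  have "0 < Z"
  proof (rule ccontr)
    assume "\<not> 0 < Z"
    moreover have "V \<noteq> {}"
    proof
      assume "V = {}"
      then have "space \<mu> = {}" using dens' by (simp add: has_density_def)
      then show False using prob_space.not_empty[OF prob] by simp
    qed
    ultimately have "Z = 0"
      using dens' unfolding has_density_def by (fastforce simp: zero_le_divide_iff not_less)
    then have "\<mu> = density (lebesgue_of V es) (\<lambda>_. 0)" using dens' by (simp add: has_density_def)
    then have "emeasure \<mu> (space \<mu>) = 0"
      using emeasure_density[of "\<lambda>_. 0" "lebesgue_of V es", OF _ sets.top] by simp
    then show False using prob_space.emeasure_space_1[OF prob] by simp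
  qed
  moreover have "1 / c * (\<Sum>i<?n. (d i)\<^sup>2) \<le> quad ?n \<rho> d d" for d
    using c(2)[of d] c(1) by (simp add: field_simps)
  ultimately show ?thesis using that[of Z "1 / c" \<rho> "\<lambda>i. Matrix.vec_index m i"] dens' c(1) by simp
qed

lemma has_density_unique:
  assumes "sigma_finite_measure (lebesgue_of V es)" "has_density V es \<mu> f" "has_density V es \<mu> f'"
  shows "AE a in lebesgue_of V es. f a = f' a"
proof -
  interpret sigma_finite_measure "lebesgue_of V es" by fact
  have [measurable]: "f \<in> borel_measurable (restrict_space borel V)" "f' \<in> borel_measurable (restrict_space borel V)"
    using assms by (auto simp: has_density_def)
  have "AE a in lebesgue_of V es. ennreal (f a) = ennreal (f' a)"
    using assms(2,3) by (subst density_unique_iff[symmetric]) (auto simp: has_density_def)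
  then show ?thesis
    using AE_space by eventually_elim (use assms(2,3) in \<open>auto simp: has_density_def\<close>)
qed

text \<open>In orthonormal coordinates the function is a product of one-dimensional
  Gaussians.\<close>

lemma integrable_gaussian_coords:
  assumes es: "orthonormal es" "range (lin_comb es) \<subseteq> V" and \<kappa>: "0 < \<kappa>"
  shows "integrable (lebesgue_of V es) (\<lambda>a. exp (- \<kappa> * (\<Sum>i<length es. (B a (es ! i) - m i)\<^sup>2)))"
proof -
  interpret product_sigma_finite "\<lambda>_::nat. lborel :: real measure" by standard
  have meas: "(\<lambda>a. exp (- \<kappa> * (\<Sum>i<length es. (B a (es ! i) - m i)\<^sup>2))) \<in> borel_measurable (restrict_space borel V)"
  proof (rule measurable_restrict_space1)
    have [measurable]: "(\<lambda>a. B a w) \<in> borel_measurable borel" for w by (rule borel_measurable_left)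
    show "(\<lambda>a. exp (- \<kappa> * (\<Sum>i<length es. (B a (es ! i) - m i)\<^sup>2))) \<in> borel_measurable borel"
      by measurable
  qed
  have "integrable (PiM {..<length es} (\<lambda>_. lborel)) (\<lambda>c. \<Prod>i<length es. exp (- \<kappa> * (c i - m i)\<^sup>2))"
    by (rule product_integrable_prod) (auto intro!: integrable_exp_square[OF \<kappa>, simplified])
  also have "(\<lambda>c. \<Prod>i<length es. exp (- \<kappa> * (c i - m i)\<^sup>2)) =
      (\<lambda>c. exp (- \<kappa> * (\<Sum>i<length es. (B (lin_comb es c) (es ! i) - m i)\<^sup>2)))"
    by (simp add: exp_sum sum_distrib_left lin_comb_left[OF es(1)])
  finally show ?thesis
    unfolding lebesgue_of_def
    by (subst integrable_distr_eq[OF measurable_lin_comb[OF es(2)] meas])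
qed

text \<open>The given versions agree almost everywhere with the explicit formulas. The exponent of
  \<open>f\<close> supplies exponential decay in the squared distance \<open>T\<close> from the
  mean, while the two exponents together make the logarithm grow at most affinely in
  \<open>T\<close>.\<close>

lemma gaussian_log_ratio:
  assumes es: "orthonormal es" "range (lin_comb es) \<subseteq> V"
    and gauss: "nondegenerate_gaussian B V es \<mu>" "nondegenerate_gaussian B V es \<nu>"
    and f: "has_density V es \<mu> f" and g: "has_density V es \<nu> g"
  shows "AE a in lebesgue_of V es. 0 < g a"
    and "integrable (lebesgue_of V es) (\<lambda>a. f a * ln (f a / g a))"
proof -
  let ?n = "length es" and ?L = "lebesgue_of V es"
  obtain m P Z \<kappa> where 1: "0 < Z" "0 < \<kappa>" "\<forall>d. \<kappa> * (\<Sum>i<?n. (d i)\<^sup>2) \<le> quad ?n P d d"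
    "has_density V es \<mu> (\<lambda>a. exp (- quad ?n P (\<lambda>i. B a (es ! i) - m i) (\<lambda>i. B a (es ! i) - m i) / 2) / Z)"
    by (rule nondegenerate_gaussian_density[OF gauss(1)])
  obtain m' P' Z' \<kappa>' where 2: "0 < Z'" "0 < \<kappa>'" "\<forall>d. \<kappa>' * (\<Sum>i<?n. (d i)\<^sup>2) \<le> quad ?n P' d d"
    "has_density V es \<nu> (\<lambda>a. exp (- quad ?n P' (\<lambda>i. B a (es ! i) - m' i) (\<lambda>i. B a (es ! i) - m' i) / 2) / Z')"
    by (rule nondegenerate_gaussian_density[OF gauss(2)])
  note sf = sigma_finite_lebesgue_of[OF es]
  note fe = has_density_unique[OF sf f 1(4)] and ge = has_density_unique[OF sf g 2(4)]
  show "AE a in ?L. 0 < g a" using ge by eventually_elim (use 2(1) in simp)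
  \<comment> \<open>\<open>T\<close> is centred at the mean of \<open>\<mu>\<close> because the
    decay has to come from \<open>f\<close>; \<open>E\<close> accounts for the shift to the mean of
    \<open>\<nu>\<close>.\<close>
  define T where "T a = (\<Sum>i<?n. (B a (es ! i) - m i)\<^sup>2)" for a
  define E where "E = (\<Sum>i<?n. (m i - m' i)\<^sup>2)"
  define c where "c = (\<Sum>i<?n. \<Sum>j<?n. \<bar>P i j\<bar>)"
  define c' where "c' = (\<Sum>i<?n. \<Sum>j<?n. \<bar>P' i j\<bar>)"
  \<comment> \<open>\<open>\<alpha> + \<beta> * T a\<close> will bound the logarithm: half of each
    quadratic form, where the squared distance to \<open>m'\<close> is at most
    \<open>2 * T a + 2 * E\<close>.\<close>
  define \<alpha> where "\<alpha> = c' * E + \<bar>ln (Z' / Z)\<bar>"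
  define \<beta> where "\<beta> = c / 2 + c'"
  have nn: "0 \<le> T a" "0 \<le> E" "0 \<le> c" "0 \<le> c'" for a
    by (auto simp: T_def E_def c_def c'_def intro!: sum_nonneg)
  have [measurable]: "f \<in> borel_measurable (restrict_space borel V)" "g \<in> borel_measurable (restrict_space borel V)"
    using f g by (auto simp: has_density_def)
  show "integrable ?L (\<lambda>a. f a * ln (f a / g a))"
  proof (rule Bochner_Integration.integrable_bound)
    show "integrable ?L (\<lambda>a. (\<alpha> + \<beta> * 4 / \<kappa>) / Z * exp (- (\<kappa> / 4) * T a))"
      unfolding T_def using 1(2) by (intro integrable_mult_right integrable_gaussian_coords[OF es]) simp
    show "(\<lambda>a. f a * ln (f a / g a)) \<in> borel_measurable ?L" by measurable
    show "AE a in ?L. norm (f a * ln (f a / g a)) \<le> norm ((\<alpha> + \<beta> * 4 / \<kappa>) / Z * exp (- (\<kappa> / 4) * T a))"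
      using fe ge
    proof eventually_elim
      case (elim a)
      let ?q = "quad ?n P (\<lambda>i. B a (es ! i) - m i) (\<lambda>i. B a (es ! i) - m i)"
      let ?q' = "quad ?n P' (\<lambda>i. B a (es ! i) - m' i) (\<lambda>i. B a (es ! i) - m' i)"
      have "\<bar>?q\<bar> \<le> c * T a" unfolding c_def T_def by (rule abs_quad_le)
      moreover have "\<bar>?q'\<bar> \<le> c' * (2 * T a + 2 * E)"
      proof -
        have "(\<Sum>i<?n. (B a (es ! i) - m' i)\<^sup>2) \<le> (\<Sum>i<?n. 2 * (B a (es ! i) - m i)\<^sup>2 + 2 * (m i - m' i)\<^sup>2)"
        proof (rule sum_mono)
          fix i
          have "0 \<le> ((B a (es ! i) - m i) - (m i - m' i))\<^sup>2" by simp
          then show "(B a (es ! i) - m' i)\<^sup>2 \<le> 2 * (B a (es ! i) - m i)\<^sup>2 + 2 * (m i - m' i)\<^sup>2"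
            by (simp add: power2_eq_square algebra_simps)
        qed
        also have "\<dots> = 2 * T a + 2 * E" by (simp add: T_def E_def sum.distrib sum_distrib_left)
        finally have "c' * (\<Sum>i<?n. (B a (es ! i) - m' i)\<^sup>2) \<le> c' * (2 * T a + 2 * E)"
          using nn(4) by (rule mult_left_mono)
        then show ?thesis
          using abs_quad_le[of ?n P' "\<lambda>i. B a (es ! i) - m' i"] unfolding c'_def by (rule order_trans[rotated])
      qed
      moreover have "ln (f a / g a) = - ?q / 2 + ?q' / 2 + ln (Z' / Z)"
      proof -
        have "f a / g a = exp (- ?q / 2) / exp (- ?q' / 2) * (Z' / Z)"
          unfolding elim by simp
        also have "\<dots> = exp (- ?q / 2 + ?q' / 2) * (Z' / Z)"
          by (simp add: exp_diff[symmetric])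
        finally have "f a / g a = exp (- ?q / 2 + ?q' / 2) * (Z' / Z)" .
        then have "ln (f a / g a) = ln (exp (- ?q / 2 + ?q' / 2) * (Z' / Z))" by (rule arg_cong)
        also have "\<dots> = ln (exp (- ?q / 2 + ?q' / 2)) + ln (Z' / Z)"
          using 1(1) 2(1) by (intro ln_mult_pos) auto
        finally show ?thesis by simp
      qed
      ultimately have "\<bar>ln (f a / g a)\<bar> \<le> c * T a / 2 + c' * (2 * T a + 2 * E) / 2 + \<bar>ln (Z' / Z)\<bar>"
        by linarith
      also have "\<dots> = \<alpha> + \<beta> * T a"
        unfolding \<alpha>_def \<beta>_def by (simp add: algebra_simps)
      \<comment> \<open>By \<open>x \<le> exp x\<close> at \<open>x = \<kappa> / 4 * T a\<close>,
        affine growth costs half of the decay \<open>exp (- \<kappa> / 2 * T a)\<close> of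
        \<open>f\<close>; the other half remains in the majorant.\<close>
      also have "\<dots> \<le> \<alpha> * exp (\<kappa> / 4 * T a) + \<beta> * (4 / \<kappa> * exp (\<kappa> / 4 * T a))"
      proof (intro add_mono)
        have "0 \<le> \<kappa> / 4 * T a" using 1(2) nn(1) by simp
        then have "1 \<le> exp (\<kappa> / 4 * T a)" by simp
        moreover have "0 \<le> \<alpha>" using nn(2,4) unfolding \<alpha>_def by simp
        ultimately show "\<alpha> \<le> \<alpha> * exp (\<kappa> / 4 * T a)"
          using mult_left_mono[of 1 "exp (\<kappa> / 4 * T a)" \<alpha>] by simp
        have "\<kappa> / 4 * T a \<le> exp (\<kappa> / 4 * T a)" using exp_ge_add_one_self[of "\<kappa> / 4 * T a"] by linarith
        then have "T a \<le> 4 / \<kappa> * exp (\<kappa> / 4 * T a)" using 1(2) by (simp add: field_simps)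
        then show "\<beta> * T a \<le> \<beta> * (4 / \<kappa> * exp (\<kappa> / 4 * T a))" using nn(3,4) unfolding \<beta>_def by (intro mult_left_mono) auto
      qed
      also have "\<dots> = (\<alpha> + \<beta> * 4 / \<kappa>) * exp (\<kappa> / 4 * T a)" by (simp add: algebra_simps)
      finally have ln_le: "\<bar>ln (f a / g a)\<bar> \<le> (\<alpha> + \<beta> * 4 / \<kappa>) * exp (\<kappa> / 4 * T a)" .
      have "f a \<le> exp (- \<kappa> / 2 * T a) / Z"
        using elim 1(1) 1(3)[rule_format, of "\<lambda>i. B a (es ! i) - m i"] unfolding T_def by (simp add: divide_right_mono)
      moreover have "0 \<le> f a" using elim 1(1) by simp
      ultimately have "\<bar>f a * ln (f a / g a)\<bar> \<le> exp (- \<kappa> / 2 * T a) / Z * ((\<alpha> + \<beta> * 4 / \<kappa>) * exp (\<kappa> / 4 * T a))"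
        unfolding abs_mult using ln_le by (intro mult_mono) auto
      also have "\<dots> = (\<alpha> + \<beta> * 4 / \<kappa>) / Z * (exp (- \<kappa> / 2 * T a) * exp (\<kappa> / 4 * T a))" by simp
      also have "exp (- \<kappa> / 2 * T a) * exp (\<kappa> / 4 * T a) = exp (- (\<kappa> / 4) * T a)"
        by (simp add: exp_add[symmetric] algebra_simps)
      also have "(\<alpha> + \<beta> * 4 / \<kappa>) / Z * exp (- (\<kappa> / 4) * T a) \<le> norm ((\<alpha> + \<beta> * 4 / \<kappa>) / Z * exp (- (\<kappa> / 4) * T a))"
        by (metis abs_ge_self real_norm_def)
      finally show ?case unfolding real_norm_def .
    qed
  qed
qed

end

section \<open>The Whitney inner product\<close>

lemma sum_permutes_3:
  fixes f :: "(nat \<Rightarrow> nat) \<Rightarrow> 'a::comm_monoid_add"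
  shows "(\<Sum>\<pi> | \<pi> permutes {..<3}. f \<pi>) =
    f id + f (Transposition.transpose 1 2) + (f (Transposition.transpose 0 1) + f (Transposition.transpose 0 1 \<circ> Transposition.transpose 1 2))
    + (f (Transposition.transpose 0 2) + f (Transposition.transpose 0 2 \<circ> Transposition.transpose 1 2))"
proof -
  have f012: "finite {1::nat, 2}" "0 \<notin> {1::nat, 2}" and f12: "finite {2::nat}" "1 \<notin> {2::nat}"
    by auto
  have 3: "{..<3::nat} = {0, 1, 2}" by auto
  show ?thesis
    unfolding 3 sum_over_permutations_insert[OF f012] sum_over_permutations_insert[OF f12] permutes_sing
    by (simp add: add.assoc)
qed

lemma det_vector_3:
  fixes x y z :: "real^3"
  shows "Determinants.det (vector [x, y, z] :: real^3^3) =
    x$1 * y$2 * z$3 + x$2 * y$3 * z$1 + x$3 * y$1 * z$2 - x$1 * y$3 * z$2 - x$2 * y$1 * z$3 - x$3 * y$2 * z$1"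
  by (simp add: det_3 vector_3)

text \<open>The integrand of the Whitney inner product at one point, as the coefficient of a 3-form
  on the standard frame of the parameter space.\<close>

definition pairing :: "nat \<Rightarrow> real^3^3 \<Rightarrow> form3 \<Rightarrow> form3 \<Rightarrow> real" where
  "pairing k G \<alpha> \<beta> = wedge k (3 - k) \<alpha> (hodge_star G k \<beta>) (\<lambda>i. [axis 1 1, axis 2 1, axis 3 1] ! i)"

lemma pairing_0: "pairing 0 G (\<lambda>X. a) (\<lambda>X. b) = a * b * sqrt (Determinants.det G)"
  unfolding pairing_def wedge_def hodge_star_def volume_form_def
  by (simp add: sum_permutes_3 det_vector_3 sign_compose sign_swap_id permutation_swap_id sign_id axis_def
      Transposition.transpose_def fact_numeral)

lemma sum_PiE_lessThan_1: "(\<Sum>I\<in>{..<Suc 0} \<rightarrow>\<^sub>E UNIV. f I) = (\<Sum>i\<in>UNIV. f (\<lambda>_\<in>{..<Suc 0}. i))"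
  by (rule sum.reindex_bij_witness[where i="\<lambda>i. \<lambda>_\<in>{..<Suc 0}. i" and j="\<lambda>I. I 0"])
     (auto simp: PiE_iff extensional_def intro!: ext arg_cong[of _ _ f])

lemma axis_nth_if: "axis i c $ j = (if j = i then c else 0)"
  by (simp add: axis_def)

lemma hodge_star_1:
  "hodge_star G 1 (\<lambda>X. b (X 0)) Y = sqrt (Determinants.det G) *
     (\<Sum>i\<in>UNIV. b (matrix_inv G *v axis i 1) * Determinants.det (vector [axis i 1, Y 0, Y 1] :: real^3^3))"
  unfolding hodge_star_def volume_form_def
  by (simp add: sum_PiE_lessThan_1 sum_distrib_left mult_ac)

lemma wedge_1_2:
  "wedge 1 2 (\<lambda>X. a (X 0)) \<gamma> X =
    (a (X 0) * (\<gamma> (\<lambda>i. X (1 + i)) - \<gamma> (\<lambda>i. X (Transposition.transpose 1 2 (1 + i))))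
    - a (X 1) * (\<gamma> (\<lambda>i. X (Transposition.transpose 0 1 (1 + i))) - \<gamma> (\<lambda>i. X ((Transposition.transpose 0 1 \<circ> Transposition.transpose 1 2) (1 + i))))
    - a (X 2) * (\<gamma> (\<lambda>i. X (Transposition.transpose 0 2 (1 + i))) - \<gamma> (\<lambda>i. X ((Transposition.transpose 0 2 \<circ> Transposition.transpose 1 2) (1 + i))))) / 2"
proof -
  have 3: "fact 2 = (2::real)" "{..<1 + 2} = {..<3::nat}" by (auto simp: fact_numeral)
  show ?thesis
    unfolding wedge_def 3 sum_permutes_3
    by (simp add: sign_compose sign_swap_id permutation_swap_id sign_id right_diff_distrib)
qed

text \<open>The wedge of a 1-form with the star of another is their metric product times the volume
  form; the inverse metric raises the index of the second factor.\<close>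

lemma pairing_1:
  "pairing 1 G (\<lambda>X. a (X 0)) (\<lambda>X. b (X 0)) =
     sqrt (Determinants.det G) * (\<Sum>i\<in>UNIV. a (axis i 1) * b (matrix_inv G *v axis i 1))"
proof -
  have 2: "3 - 1 = (2::nat)" by simp
  show ?thesis
    unfolding pairing_def 2 wedge_1_2 hodge_star_1 UNIV_3
    by (simp add: det_vector_3 axis_nth_if Transposition.transpose_def del: One_nat_def)
      (simp add: algebra_simps)
qed

section \<open>Linearity, and Whitney forms in degrees 0 and 1\<close>

lemma wedge_add_left: "wedge k l (\<lambda>X. s * \<alpha> X + t * \<alpha>' X) \<beta> X = s * wedge k l \<alpha> \<beta> X + t * wedge k l \<alpha>' \<beta> X"
  unfolding wedge_def by (simp add: sum.distrib sum_distrib_left algebra_simps add_divide_distrib)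

lemma pairing_linear_left:
  "pairing k G (\<lambda>X. s * \<alpha> X + t * \<alpha>' X) \<beta> = s * pairing k G \<alpha> \<beta> + t * pairing k G \<alpha>' \<beta>"
  unfolding pairing_def wedge_add_left ..

lemma whitney_map_linear:
  "whitney_map K k (\<lambda>xs. s * u xs + t * v xs) vs p X = s * whitney_map K k u vs p X + t * whitney_map K k v vs p X"
  unfolding whitney_map_def by (simp add: sum.distrib sum_distrib_left algebra_simps add_divide_distrib)

text \<open>\<open>bary vs\<close> is affine in the parameter, so its linear part is the derivative
  at every point and frees \<open>dbary\<close> from \<open>s\<close>.\<close>

definition blin :: "'v list \<Rightarrow> 'v \<Rightarrow> real^3 \<Rightarrow> real" where
  "blin vs v X = bary vs X v - bary vs 0 v"

lemma blin_eq: "blin vs v X = (if v = vs ! 0 then - X $ 1 - X $ 2 - X $ 3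
      else if v = vs ! 1 then X $ 1 else if v = vs ! 2 then X $ 2 else if v = vs ! 3 then X $ 3 else 0)"
  by (simp add: blin_def bary_def)

lemma linear_blin: "linear (blin vs v)"
  by (rule linearI) (auto simp: blin_eq algebra_simps)

lemma dbary_eq: "dbary vs s v = blin vs v"
proof -
  have "((\<lambda>t. bary vs 0 v + blin vs v t) has_derivative blin vs v) (at s)"
    by (auto intro!: derivative_eq_intros linear_imp_has_derivative linear_blin)
  then have "((\<lambda>t. bary vs t v) has_derivative blin vs v) (at s)" by (simp add: blin_def)
  then show ?thesis unfolding dbary_def by (rule frechet_derivative_at[symmetric])
qed

lemma whitney_map_0: "whitney_map K 0 u vs s X = (\<Sum>xs\<in>ordered_simplices K 0. u xs * bary vs s (xs ! 0))"
  by (simp add: whitney_map_def elementary_whitney_form_def)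

lemma wedge_covectors_single: "wedge_covectors [\<theta>] X = \<theta> (X 0)"
proof -
  have 1: "{..<1 + 0} = {0::nat}" by auto
  show ?thesis unfolding wedge_covectors.simps wedge_def list.size 1 permutes_sing by (simp add: sign_id)
qed

lemma whitney_map_1: "whitney_map K 1 u vs s X =
   (\<Sum>xs\<in>ordered_simplices K 1. u xs * (bary vs s (xs ! 0) * blin vs (xs ! 1) (X 0) - bary vs s (xs ! 1) * blin vs (xs ! 0) (X 0))) / 2"
  by (simp add: whitney_map_def elementary_whitney_form_def wedge_covectors_single dbary_eq fact_numeral
      del: wedge_covectors.simps)

text \<open>The test vectors may move with the base point, because the Hodge star inserts vectors
  raised by the inverse metric, which varies. Continuity along continuous vector fields is stable
  under wedge and star and avoids a topology on \<open>form3\<close>.\<close>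

definition continuous_form_on :: "'a::topological_space set \<Rightarrow> ('a \<Rightarrow> form3) \<Rightarrow> bool" where
  "continuous_form_on N \<omega> \<longleftrightarrow>
     (\<forall>X. (\<forall>i. continuous_on N (\<lambda>s. X s i)) \<longrightarrow> continuous_on N (\<lambda>s. \<omega> s (X s)))"

lemma continuous_form_onD: "continuous_form_on N \<omega> \<Longrightarrow> (\<And>i. continuous_on N (\<lambda>s. X s i)) \<Longrightarrow> continuous_on N (\<lambda>s. \<omega> s (X s))"
  by (auto simp: continuous_form_on_def)

lemma continuous_form_on_wedge:
  assumes "continuous_form_on N \<alpha>" "continuous_form_on N \<beta>"
  shows "continuous_form_on N (\<lambda>s. wedge k l (\<alpha> s) (\<beta> s))"
  unfolding continuous_form_on_def wedge_def
proof safe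
  fix X :: "'a \<Rightarrow> nat \<Rightarrow> real^3" assume X: "\<forall>i. continuous_on N (\<lambda>s. X s i)"
  show "continuous_on N (\<lambda>s. (\<Sum>\<pi> | \<pi> permutes {..<k + l}.
        of_int (sign \<pi>) * \<alpha> s (\<lambda>i. X s (\<pi> i)) * \<beta> s (\<lambda>i. X s (\<pi> (k + i)))) / (fact k * fact l))"
    using X by (intro continuous_intros continuous_form_onD[OF assms(1)] continuous_form_onD[OF assms(2)]) auto
qed

lemma continuous_form_on_wedge_covectors:
  assumes "\<And>\<theta>. \<theta> \<in> set \<theta>s \<Longrightarrow> linear \<theta>"
  shows "continuous_form_on N (\<lambda>s. wedge_covectors \<theta>s)"
  using assms
proof (induction \<theta>s)
  case Nil
  then show ?case by (simp add: continuous_form_on_def)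
next
  case (Cons \<theta> \<theta>s)
  have "linear \<theta>" using Cons.prems by simp
  then have "continuous_form_on N (\<lambda>s X. \<theta> (X 0))"
    unfolding continuous_form_on_def
    by (auto simp: linear_conv_bounded_linear intro: bounded_linear.continuous_on)
  then show ?case using Cons by (auto intro!: continuous_form_on_wedge)
qed

lemma continuous_on_bary: "continuous_on N (\<lambda>s. bary vs s v)"
proof -
  have "continuous_on N (\<lambda>s. blin vs v s)"
    by (intro linear_continuous_on) (simp add: linear_conv_bounded_linear[symmetric] linear_blin)
  then have "continuous_on N (\<lambda>s. bary vs 0 v + blin vs v s)" by (intro continuous_intros)
  then show ?thesis by (simp add: blin_def)
qed

lemma continuous_form_on_whitney_map: "continuous_form_on N (whitney_map K k u vs)"
  unfolding continuous_form_on_def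
proof safe
  fix X :: "real^3 \<Rightarrow> nat \<Rightarrow> real^3" assume X: "\<forall>i. continuous_on N (\<lambda>s. X s i)"
  have "continuous_on N (\<lambda>s. wedge_covectors (map (\<lambda>j. blin vs (xs ! j)) js) (X s))" for xs js
    by (rule continuous_form_onD[OF continuous_form_on_wedge_covectors]) (use X linear_blin in auto)
  note wc = this
  show "continuous_on N (\<lambda>s. whitney_map K k u vs s (X s))"
    unfolding whitney_map_def elementary_whitney_form_def dbary_eq
    by (intro continuous_on_divide continuous_on_sum continuous_on_mult continuous_on_const continuous_on_bary wc)
       simp
qed

lemma continuous_on_det:
  fixes G :: "'a::topological_space \<Rightarrow> real^'n^'n"
  assumes "continuous_on N G"
  shows "continuous_on N (\<lambda>s. Determinants.det (G s))"
  unfolding Determinants.det_def using assms by (intro continuous_intros) auto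

lemma matrix_inv_right:
  assumes "invertible A"
  shows "A ** matrix_inv A = Finite_Cartesian_Product.mat 1"
  using assms unfolding invertible_def matrix_inv_def by (rule someI2_ex) simp

text \<open>\<open>matrix_inv\<close> is specified by a choice. Cramer's rule turns it into
  quotients of determinants, from which continuity in a parameter can be read off.\<close>

lemma matrix_inv_mult_vector:
  fixes G :: "real^'n^'n"
  assumes "Determinants.det G \<noteq> 0"
  shows "matrix_inv G *v w = (\<chi> k. Determinants.det (\<chi> i j. if j = k then w $ i else G $ i $ j) / Determinants.det G)"
proof -
  have "G *v (matrix_inv G *v w) = w"
    using assms by (simp add: matrix_vector_mul_assoc matrix_inv_right invertible_det_nz)
  then show ?thesis using cramer[OF assms] by blast
qed

lemma continuous_on_matrix_inv_vector:
  fixes G :: "'a::topological_space \<Rightarrow> real^'n^'n"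
  assumes G: "continuous_on N G" and nz: "\<And>s. s \<in> N \<Longrightarrow> Determinants.det (G s) \<noteq> 0"
  shows "continuous_on N (\<lambda>s. matrix_inv (G s) *v w)"
proof -
  have "continuous_on N (\<lambda>s. (\<chi> i j. if j = k then w $ i else G s $ i $ j) :: real^'n^'n)" for k
  proof (intro continuous_on_vec_lambda)
    fix i j
    show "continuous_on N (\<lambda>s. if j = k then w $ i else G s $ i $ j)"
      using G by (cases "j = k") (auto intro!: continuous_intros)
  qed
  note c = this
  have "continuous_on N (\<lambda>s. \<chi> k. Determinants.det (\<chi> i j. if j = k then w $ i else G s $ i $ j) / Determinants.det (G s))"
    using nz by (intro continuous_on_vec_lambda continuous_on_divide continuous_on_det[OF c] continuous_on_det[OF G]) auto
  then show ?thesis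
    by (rule continuous_on_cong[THEN iffD1, rotated -1]) (auto simp: matrix_inv_mult_vector nz)
qed

lemma continuous_form_on_hodge_star:
  assumes G: "continuous_on N G" and nz: "\<And>s. s \<in> N \<Longrightarrow> Determinants.det (G s) \<noteq> 0"
    and \<beta>: "continuous_form_on N \<beta>"
  shows "continuous_form_on N (\<lambda>s. hodge_star (G s) k (\<beta> s))"
  unfolding continuous_form_on_def
proof safe
  fix X :: "'a \<Rightarrow> nat \<Rightarrow> real^3" assume X: "\<forall>i. continuous_on N (\<lambda>s. X s i)"
  have vol: "continuous_on N (\<lambda>s. volume_form (G s) (Y s))" if Y: "\<And>i. continuous_on N (\<lambda>s. Y s i)" for Y
    unfolding volume_form_def det_vector_3
    using G Y by (intro continuous_intros continuous_on_det) auto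
  show "continuous_on N (\<lambda>s. hodge_star (G s) k (\<beta> s) (X s))"
    unfolding hodge_star_def
  proof (intro continuous_on_divide continuous_on_sum continuous_on_mult continuous_on_const)
    fix I :: "nat \<Rightarrow> 3"
    show "continuous_on N (\<lambda>s. \<beta> s (\<lambda>a. matrix_inv (G s) *v axis (I a) 1))"
      by (rule continuous_form_onD[OF \<beta>]) (rule continuous_on_matrix_inv_vector[OF G nz])
    show "continuous_on N (\<lambda>s. volume_form (G s) (\<lambda>a. if a < k then axis (I a) 1 else X s (a - k)))"
    proof (rule vol)
      fix a show "continuous_on N (\<lambda>s. if a < k then axis (I a) 1 else X s (a - k))"
        using X by (cases "a < k") auto
    qed
  qed auto
qed

lemma continuous_on_pairing:
  assumes G: "continuous_on N G" and nz: "\<And>s. s \<in> N \<Longrightarrow> Determinants.det (G s) \<noteq> 0"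
  shows "continuous_on N (\<lambda>s. pairing k (G s) (whitney_map K k u vs s) (whitney_map K k w vs s))"
  unfolding pairing_def
  by (rule continuous_form_onD[OF continuous_form_on_wedge[OF continuous_form_on_whitney_map
        continuous_form_on_hodge_star[OF G nz continuous_form_on_whitney_map]]])
     auto

section \<open>Positive definite matrices\<close>

definition pos_def_matrix :: "real^'n^'n \<Rightarrow> bool" where
  "pos_def_matrix G \<longleftrightarrow> Finite_Cartesian_Product.transpose G = G \<and> (\<forall>w. w \<noteq> 0 \<longrightarrow> inner w (G *v w) > 0)"

lemma pos_def_matrix_det_nz:
  fixes G :: "real^'n^'n"
  assumes "\<And>w. w \<noteq> 0 \<Longrightarrow> inner w (G *v w) > 0"
  shows "Determinants.det G \<noteq> 0"
proof -
  have "\<forall>x. G *v x = 0 \<longrightarrow> x = 0" using assms by (metis inner_zero_right less_irrefl)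
  then show ?thesis
    using matrix_left_invertible_ker[of G] by (metis invertible_det_nz invertible_left_inverse)
qed

text \<open>The segment from the identity to \<open>G\<close> consists of matrices with positive
  quadratic form, so the determinant has no zero on it and keeps the sign it has at the
  identity.\<close>

lemma pos_def_matrix_det_pos:
  fixes G :: "real^'n^'n"
  assumes "pos_def_matrix G"
  shows "Determinants.det G > 0"
proof (rule ccontr)
  define P where "P t = (1 - t) *\<^sub>R Finite_Cartesian_Product.mat 1 + t *\<^sub>R G" for t :: real
  assume "\<not> ?thesis"
  then have "Determinants.det (P 1) \<le> 0" "0 \<le> Determinants.det (P 0)" by (simp_all add: P_def)
  moreover have "continuous_on {0..1} (\<lambda>t. Determinants.det (P t))"
    unfolding P_def by (intro continuous_on_det continuous_intros)
  ultimately obtain t where t: "0 \<le> t" "t \<le> 1" "Determinants.det (P t) = 0"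
    using IVT2'[of "\<lambda>t. Determinants.det (P t)" 1 0 0] by auto
  have "inner w (P t *v w) > 0" if w: "w \<noteq> 0" for w
  proof -
    have "inner w (P t *v w) = (1 - t) * inner w w + t * inner w (G *v w)"
      by (simp add: P_def matrix_vector_mult_add_rdistrib scaleR_matrix_vector_assoc[symmetric] inner_add_right)
    moreover have "inner w w > 0" "inner w (G *v w) > 0" using w assms by (auto simp: pos_def_matrix_def)
    ultimately show ?thesis using t by (cases "t = 1") (auto intro!: add_pos_nonneg)
  qed
  then show False using pos_def_matrix_det_nz t(3) by blast
qed

lemma linear_eq_inner:
  fixes a :: "real^'n \<Rightarrow> real"
  assumes "linear a"
  shows "a x = inner (\<chi> i. a (axis i 1)) x"
proof -
  have "a x = a (\<Sum>i\<in>UNIV. x $ i *\<^sub>R axis i 1)"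
    using basis_expansion[of x] by (simp add: scalar_mult_eq_scaleR)
  also have "\<dots> = (\<Sum>i\<in>UNIV. x $ i * a (axis i 1))"
    using assms by (simp add: linear_sum linear_scale)
  finally show ?thesis by (simp add: inner_vec_def mult.commute)
qed

lemma pairing_1_linear:
  assumes "linear a" "linear b"
  shows "pairing 1 G (\<lambda>X. a (X 0)) (\<lambda>X. b (X 0)) =
    sqrt (Determinants.det G) * inner (\<chi> i. b (axis i 1)) (matrix_inv G *v (\<chi> i. a (axis i 1)))"
proof -
  have "(\<Sum>i\<in>UNIV. a (axis i 1) * b (matrix_inv G *v axis i 1)) = b (matrix_inv G *v (\<Sum>i\<in>UNIV. a (axis i 1) *\<^sub>R axis i 1))"
    using assms(2) by (simp add: linear_sum linear_scale linear_sum[OF matrix_vector_mul_linear] matrix_vector_mult_scaleR)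
  also have "(\<Sum>i\<in>UNIV. a (axis i 1) *\<^sub>R axis i 1) = (\<chi> i. a (axis i 1))"
    using basis_expansion[of "\<chi> i. a (axis i 1)"] by (simp add: scalar_mult_eq_scaleR)
  finally show ?thesis unfolding pairing_1 using linear_eq_inner[OF assms(2)] by metis
qed

text \<open>Substituting \<open>x = G *v x'\<close> turns statements about the inverse into the same
  statements about \<open>G\<close>.\<close>

lemma pos_def_matrix_inv:
  fixes G :: "real^'n^'n"
  assumes G: "pos_def_matrix G"
  shows "inner x (matrix_inv G *v y) = inner y (matrix_inv G *v x)"
    and "x \<noteq> 0 \<Longrightarrow> 0 < inner x (matrix_inv G *v x)"
proof -
  have inv: "invertible G" using pos_def_matrix_det_pos[OF G] by (simp add: invertible_det_nz)
  have r: "G *v (matrix_inv G *v z) = z" for z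
    using inv by (simp add: matrix_vector_mul_assoc matrix_inv_right)
  have "inner x (matrix_inv G *v y) = inner (G *v (matrix_inv G *v x)) (matrix_inv G *v y)" by (simp add: r)
  also have "\<dots> = inner (matrix_inv G *v x) (G *v (matrix_inv G *v y))"
    using G by (metis dot_lmul_matrix pos_def_matrix_def vector_transpose_matrix)
  finally show "inner x (matrix_inv G *v y) = inner y (matrix_inv G *v x)" by (simp add: r inner_commute)
  assume "x \<noteq> 0"
  then have "matrix_inv G *v x \<noteq> 0" using r[of x] by auto
  then have "0 < inner (matrix_inv G *v x) (G *v (matrix_inv G *v x))" using G by (auto simp: pos_def_matrix_def)
  then show "0 < inner x (matrix_inv G *v x)" by (simp add: r inner_commute)
qed

text \<open>Each point of the compact set \<open>C\<close> has its own continuous extension of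
  \<open>f\<close>, and different extensions need not agree outside \<open>S\<close>. Each gives a
  local bound on \<open>S\<close>, and a finite subcover makes \<open>f\<close> bounded on a set of
  finite measure.\<close>

lemma set_integrable_locally_continuous:
  fixes f :: "'a::euclidean_space \<Rightarrow> real"
  assumes S: "open S" "S \<subseteq> C" "compact C"
    and loc: "\<And>s. s \<in> C \<Longrightarrow> \<exists>N F. open N \<and> s \<in> N \<and> continuous_on N F \<and> (\<forall>t\<in>N \<inter> S. f t = F t)"
  shows "set_integrable lborel S f" and "continuous_on S f"
proof -
  show cont: "continuous_on S f"
  proof (rule continuous_at_imp_continuous_on, rule ballI)
    fix s assume s: "s \<in> S"
    then obtain N F where N: "open N" "s \<in> N" "continuous_on N F" "\<forall>t\<in>N \<inter> S. f t = F t"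
      using loc S by blast
    have "continuous_on (N \<inter> S) f"
      using N by (auto intro: continuous_on_cong[THEN iffD2] continuous_on_subset)
    then show "isCont f s" using N S s by (auto simp: continuous_on_eq_continuous_at open_Int)
  qed
  have "\<exists>N b. open N \<and> s \<in> N \<and> (\<forall>t\<in>N \<inter> S. \<bar>f t\<bar> \<le> b)" if s: "s \<in> C" for s
  proof -
    obtain N F where N: "open N" "s \<in> N" "continuous_on N F" "\<forall>t\<in>N \<inter> S. f t = F t"
      using loc s by blast
    let ?N = "N \<inter> F -` {F s - 1 <..< F s + 1}"
    have "open ?N" using N by (intro continuous_open_preimage) auto
    moreover have "\<forall>t\<in>?N \<inter> S. \<bar>f t\<bar> \<le> \<bar>F s\<bar> + 1" using N by auto
    ultimately show ?thesis using N(2) by (intro exI[of _ ?N] exI[of _ "\<bar>F s\<bar> + 1"]) auto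
  qed
  then obtain N b where N: "\<And>s. s \<in> C \<Longrightarrow> open (N s) \<and> s \<in> N s \<and> (\<forall>t\<in>N s \<inter> S. \<bar>f t\<bar> \<le> b s)"
    by metis
  obtain D where D: "D \<subseteq> C" "finite D" "C \<subseteq> (\<Union>s\<in>D. N s)"
    using compactE_image[OF S(3), of C N] N by blast
  have bound: "\<bar>f t\<bar> \<le> (\<Sum>s\<in>D. \<bar>b s\<bar>)" if t: "t \<in> S" for t
  proof -
    obtain s where s: "s \<in> D" "t \<in> N s" using D t S by blast
    then have "\<bar>f t\<bar> \<le> b s" using N[of s] D t by blast
    then have "\<bar>f t\<bar> \<le> \<bar>b s\<bar>" by simp
    also have "\<dots> \<le> (\<Sum>s\<in>D. \<bar>b s\<bar>)" using s D by (intro member_le_sum) auto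
    finally show ?thesis .
  qed
  have bdd: "bounded S" using S compact_imp_bounded bounded_subset by blast
  have fin: "emeasure lborel S < \<infinity>" using emeasure_bounded_finite[OF bdd] by simp
  show "set_integrable lborel S f"
    unfolding set_integrable_def
  proof (rule integrableI_bounded_set[where A=S and B="\<Sum>s\<in>D. \<bar>b s\<bar>"])
    have "f \<in> borel_measurable (restrict_space borel S)"
      by (rule borel_measurable_continuous_on_restrict[OF cont])
    then show "(\<lambda>x. indicator S x *\<^sub>R f x) \<in> borel_measurable lborel"
      using S by (subst (asm) borel_measurable_restrict_space_iff) (auto simp: mult.commute)
    show "AE x in lborel. x \<in> S \<longrightarrow> norm (indicator S x *\<^sub>R f x) \<le> (\<Sum>s\<in>D. \<bar>b s\<bar>)"
      using bound by (intro AE_I2) auto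
  qed (use S fin in auto)
qed

text \<open>The part of \<open>S\<close> where \<open>f\<close> is positive is open and null, hence
  empty.\<close>

lemma set_integral_nonneg_eq_0_continuous:
  fixes f :: "'a::euclidean_space \<Rightarrow> real"
  assumes "open S" "continuous_on S f" "set_integrable lborel S f" and nn: "\<And>s. s \<in> S \<Longrightarrow> 0 \<le> f s"
    and 0: "(LINT s:S|lborel. f s) = 0" and s: "s \<in> S"
  shows "f s = 0"
proof (rule ccontr)
  assume "f s \<noteq> 0"
  then have pos: "0 < f s" using nn s by (simp add: less_le)
  have "AE x in lborel. indicator S x *\<^sub>R f x = 0"
    using 0 assms(3) nn unfolding set_lebesgue_integral_def set_integrable_def
    by (subst (asm) integral_nonneg_eq_0_iff_AE) (auto simp: indicator_def)
  then have ae: "AE x in lborel. x \<notin> S \<inter> f -` {0<..}" by eventually_elim (auto simp: indicator_def split: if_splits)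
  have op: "open (S \<inter> f -` {0<..})" using assms by (intro continuous_open_preimage) auto
  then have "S \<inter> f -` {0<..} \<in> null_sets lborel"
    using ae by (subst AE_iff_null_sets) auto
  then have "negligible (S \<inter> f -` {0<..})"
    by (simp add: negligible_iff_null_sets null_sets_completionI)
  then have "S \<inter> f -` {0<..} = {}" using op open_not_negligible by blast
  then show False using s pos by auto
qed

section \<open>Geometry of the standard simplex\<close>

lemma convex_std_3_simplex: "convex std_3_simplex"
proof (rule convexI)
  fix x y :: "real^3" and u v :: real
  assume xy: "x \<in> std_3_simplex" "y \<in> std_3_simplex" and uv: "0 \<le> u" "0 \<le> v" "u + v = 1"
  have "(\<Sum>i\<in>UNIV. (u *\<^sub>R x + v *\<^sub>R y) $ i) = u * (\<Sum>i\<in>UNIV. x $ i) + v * (\<Sum>i\<in>UNIV. y $ i)"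
    by (simp add: sum.distrib sum_distrib_left)
  also have "\<dots> \<le> u * 1 + v * 1"
    using xy uv unfolding std_3_simplex_def by (intro add_mono mult_left_mono) auto
  finally show "u *\<^sub>R x + v *\<^sub>R y \<in> std_3_simplex"
    using xy uv by (auto simp: std_3_simplex_def)
qed

lemma compact_std_3_simplex: "compact std_3_simplex"
proof -
  have "closed std_3_simplex"
    unfolding std_3_simplex_def
    by (intro closed_Collect_conj closed_Collect_all closed_Collect_le continuous_intros)
  moreover have "norm s \<le> 1" if "s \<in> std_3_simplex" for s
    using norm_le_l1_cart[of s] that by (auto simp: std_3_simplex_def)
  then have "bounded std_3_simplex" by (rule boundedI)
  ultimately show ?thesis by (simp add: compact_eq_bounded_closed)
qed

lemma interior_std_3_simplex_nonempty: "interior std_3_simplex \<noteq> {}"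
proof -
  let ?S = "{s::real^3. 0 < s $ 1 \<and> 0 < s $ 2 \<and> 0 < s $ 3 \<and> (\<Sum>i\<in>UNIV. s $ i) < 1}"
  have "open ?S"
    by (intro open_Collect_conj open_Collect_less continuous_intros)
  moreover have "?S \<subseteq> std_3_simplex" by (auto simp: std_3_simplex_def forall_3)
  moreover have "(\<chi> i. 1 / 4) \<in> ?S" by simp
  ultimately show ?thesis using interior_maximal by blast
qed

lemma std_3_simplex_closure: "std_3_simplex \<subseteq> closure (interior std_3_simplex)"
  using convex_closure_interior[OF convex_std_3_simplex interior_std_3_simplex_nonempty] closure_subset by blast

definition vertex_point :: "nat \<Rightarrow> real^3" where
  "vertex_point i = [0, axis 1 1, axis 2 1, axis 3 1] ! i"

lemma less_4_cases: "(i::nat) < 4 \<Longrightarrow> i = 0 \<or> i = 1 \<or> i = 2 \<or> i = 3"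
  by auto

lemma vertex_point_in_simplex: "i < 4 \<Longrightarrow> vertex_point i \<in> std_3_simplex"
  by (drule less_4_cases) (auto simp: vertex_point_def std_3_simplex_def axis_nth_if sum_3 numeral_eq_Suc)

lemma bary_vertex_point:
  assumes "length vs = 4" "distinct vs" "i < 4"
  shows "bary vs (vertex_point i) v = (if v = vs ! i then 1 else 0)"
proof -
  have ne: "vs ! i = vs ! j \<longleftrightarrow> i = j" if "i < 4" "j < 4" for i j
    using assms that by (simp add: nth_eq_iff_index_eq)
  show ?thesis
    using less_4_cases[OF assms(3)]
    by (elim disjE) (auto simp: bary_def vertex_point_def axis_nth_if ne numeral_eq_Suc)
qed

lemma blin_edge:
  assumes "length vs = 4" "distinct vs" "i < 4" "k < 4"
  shows "blin vs v (vertex_point k - vertex_point i) = (if v = vs ! k then 1 else 0) - (if v = vs ! i then 1 else 0)"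
proof -
  have "blin vs v (vertex_point k - vertex_point i) = blin vs v (vertex_point k) - blin vs v (vertex_point i)"
    using linear_blin by (rule linear_diff)
  then show ?thesis using assms by (simp add: blin_def bary_vertex_point)
qed

section \<open>Jacobians, smoothness and congruence of metrics\<close>

lemma jacobian_eqI:
  fixes f :: "real^'n \<Rightarrow> real^'m"
  assumes "(f has_derivative (\<lambda>v. J *v v)) (at x)"
  shows "jacobian f (at x) = J"
  unfolding jacobian_def frechet_derivative_at[OF assms, symmetric] by (rule matrix_of_matrix_vector_mul)

lemma jacobian_compose:
  fixes f :: "real^'n \<Rightarrow> real^'m" and \<psi> :: "real^'m \<Rightarrow> real^'k"
  assumes "f differentiable (at x)" "\<psi> differentiable (at (f x))"
  shows "jacobian (\<lambda>y. \<psi> (f y)) (at x) = jacobian \<psi> (at (f x)) ** jacobian f (at x)"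
proof (rule jacobian_eqI)
  have "(f has_derivative (\<lambda>v. jacobian f (at x) *v v)) (at x)"
    and "(\<psi> has_derivative (\<lambda>v. jacobian \<psi> (at (f x)) *v v)) (at (f x))"
    using assms jacobian_works by blast+
  from has_derivative_compose[OF this]
  show "((\<lambda>y. \<psi> (f y)) has_derivative (\<lambda>v. (jacobian \<psi> (at (f x)) ** jacobian f (at x)) *v v)) (at x)"
    by (simp add: matrix_vector_mul_assoc)
qed

lemma jacobian_cong_open:
  fixes f F :: "real^'n \<Rightarrow> real^'m"
  assumes "open W" "x \<in> W" "\<And>y. y \<in> W \<Longrightarrow> f y = F y" "F differentiable (at x)"
  shows "f differentiable (at x)" and "jacobian f (at x) = jacobian F (at x)"
proof -
  have "(F has_derivative (\<lambda>v. jacobian F (at x) *v v)) (at x)" using assms jacobian_works by blast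
  then have f: "(f has_derivative (\<lambda>v. jacobian F (at x) *v v)) (at x)"
    by (rule has_derivative_transform_within_open[OF _ assms(1,2)]) (simp add: assms(3))
  then show "f differentiable (at x)" by (auto simp: differentiable_def)
  show "jacobian f (at x) = jacobian F (at x)" using f by (rule jacobian_eqI)
qed

lemma smooth_on_differentiable:
  assumes "smooth_on F N" "open N" "t \<in> N"
  shows "F differentiable (at t)"
proof -
  have "Ck_on 1 F N" using assms(1) by (simp add: smooth_on_def)
  then have "F differentiable_on N" by simp
  then show ?thesis using assms by (metis at_within_open differentiable_on_def)
qed

lemma smooth_on_continuous:
  assumes "smooth_on F N"
  shows "continuous_on N F"
proof -
  have "Ck_on 0 F N" using assms by (metis smooth_on_def)
  then show ?thesis by simp
qed

lemma smooth_on_continuous_jacobian: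
  fixes F :: "real^'n \<Rightarrow> real^'m"
  assumes "smooth_on F N"
  shows "continuous_on N (\<lambda>t. jacobian F (at t))"
proof -
  have "Ck_on 1 F N" using assms by (simp add: smooth_on_def)
  then have "continuous_on N (\<lambda>t. frechet_derivative F (at t) v)" for v by simp
  then show ?thesis unfolding jacobian_def matrix_def by (intro continuous_on_vec_lambda continuous_on_component)
qed

lemma pos_def_matrix_congruence:
  fixes G J :: "real^'n^'n"
  assumes G: "pos_def_matrix G" and J: "Determinants.det J \<noteq> 0"
  shows "pos_def_matrix (Finite_Cartesian_Product.transpose J ** G ** J)"
  unfolding pos_def_matrix_def
proof safe
  show "Finite_Cartesian_Product.transpose (Finite_Cartesian_Product.transpose J ** G ** J) = Finite_Cartesian_Product.transpose J ** G ** J"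
    using G by (simp add: matrix_transpose_mul pos_def_matrix_def matrix_mul_assoc)
  fix w :: "real^'n" assume w: "w \<noteq> 0"
  have "J *v w \<noteq> 0"
    using w J by (metis invertible_det_nz invertible_left_inverse matrix_left_invertible_ker)
  then have "0 < inner (J *v w) (G *v (J *v w))" using G by (simp add: pos_def_matrix_def)
  also have "\<dots> = inner w (Finite_Cartesian_Product.transpose J *v (G *v (J *v w)))"
    unfolding transpose_matrix_vector
    by (subst (2) inner_commute, subst dot_lmul_matrix, rule inner_commute)
  finally show "0 < inner w (Finite_Cartesian_Product.transpose J ** G ** J *v w)"
    by (simp only: matrix_vector_mul_assoc matrix_mul_assoc)
qed

lemma continuous_on_matrix_mult:
  fixes P :: "'a::topological_space \<Rightarrow> real^'n^'m" and Q :: "'a \<Rightarrow> real^'k^'n"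
  assumes "continuous_on N P" "continuous_on N Q"
  shows "continuous_on N (\<lambda>s. P s ** Q s)"
  unfolding matrix_matrix_mult_def using assms
  by (intro continuous_on_vec_lambda continuous_intros) auto

lemma continuous_on_transpose:
  fixes P :: "'a::topological_space \<Rightarrow> real^'n^'m"
  assumes "continuous_on N P"
  shows "continuous_on N (\<lambda>s. Finite_Cartesian_Product.transpose (P s))"
  unfolding Finite_Cartesian_Product.transpose_def using assms
  by (intro continuous_on_vec_lambda continuous_intros) auto

section \<open>Simplices in charts and the pulled back metric\<close>

locale triangulated_3_manifold = closed_oriented_riemannian_3_manifold M A g
  for M :: "'m topology" and A :: "'m chart set" and g :: "'m chart \<Rightarrow> real^3 \<Rightarrow> real^3^3" +
  fixes K :: "'v set set" and h :: "('v \<Rightarrow> real) \<Rightarrow> 'm"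
  assumes triangulation: "smooth_triangulation M A K h"
begin

abbreviation simplex_interior ("\<Delta>") where "\<Delta> \<equiv> interior std_3_simplex"
abbreviation point :: "'v list \<Rightarrow> real^3 \<Rightarrow> 'm" where "point vs t \<equiv> h (bary vs t)"

lemma complex_K: "finite_simplicial_complex K"
  using triangulation unfolding smooth_triangulation_def by (elim conjE)

lemma finite_K: "finite K"
  using complex_K unfolding finite_simplicial_complex_def by (elim conjE)

lemma simplex: "\<sigma> \<in> K \<Longrightarrow> finite \<sigma> \<and> \<sigma> \<noteq> {}"
  using complex_K unfolding finite_simplicial_complex_def by (elim conjE) (rule bspec)

lemma face: "\<sigma> \<in> K \<Longrightarrow> \<tau> \<subseteq> \<sigma> \<Longrightarrow> \<tau> \<noteq> {} \<Longrightarrow> \<tau> \<in> K"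
proof -
  have "\<forall>\<sigma>\<in>K. \<forall>\<tau>. \<tau> \<subseteq> \<sigma> \<and> \<tau> \<noteq> {} \<longrightarrow> \<tau> \<in> K"
    using complex_K unfolding finite_simplicial_complex_def by (elim conjE)
  then show "\<sigma> \<in> K \<Longrightarrow> \<tau> \<subseteq> \<sigma> \<Longrightarrow> \<tau> \<noteq> {} \<Longrightarrow> \<tau> \<in> K" by simp
qed

lemma finite_ordered_simplices: "finite (ordered_simplices K k)"
proof (rule finite_subset)
  show "ordered_simplices K k \<subseteq> {xs. set xs \<subseteq> \<Union>K \<and> length xs = Suc k}"
    by (auto simp: ordered_simplices_def)
  show "finite {xs. set xs \<subseteq> \<Union>K \<and> length xs = Suc k}"
    using finite_K simplex by (intro finite_lists_length_eq) auto
qed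

lemma bary_in_realization:
  assumes vs: "vs \<in> ordered_simplices K 3" and s: "s \<in> std_3_simplex"
  shows "bary vs s \<in> realization K"
proof -
  have len: "length vs = 4" and dist: "distinct vs" and K: "set vs \<in> K"
    using vs by (auto simp: ordered_simplices_def)
  obtain a b c d where abcd: "vs = [a, b, c, d]"
    using len by (auto simp: numeral_eq_Suc length_Suc_conv)
  have s0: "0 \<le> s $ i" for i using s by (simp add: std_3_simplex_def)
  have s1: "s $ 1 + s $ 2 + s $ 3 \<le> 1" using s by (simp add: std_3_simplex_def sum_3)
  have nn: "0 \<le> bary vs s v" for v using s0 s1 by (auto simp: bary_def)
  have supp: "{v. bary vs s v \<noteq> 0} \<subseteq> set vs" by (auto simp: bary_def abcd)
  have "(\<Sum>v | bary vs s v \<noteq> 0. bary vs s v) = (\<Sum>v\<in>set vs. bary vs s v)"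
    using supp by (intro sum.mono_neutral_left) auto
  also have "\<dots> = 1" using dist by (simp add: abcd) (auto simp: bary_def)
  finally have one: "(\<Sum>v | bary vs s v \<noteq> 0. bary vs s v) = 1" .
  then have "{v. bary vs s v \<noteq> 0} \<noteq> {}" by (metis sum.empty zero_neq_one)
  then have "{v. bary vs s v \<noteq> 0} \<in> K" using face[OF K supp] by simp
  then show ?thesis using nn one by (simp add: realization_def)
qed

lemma chart_at:
  assumes vs: "vs \<in> ordered_simplices K 3" and s: "s \<in> std_3_simplex"
  obtains U \<phi> where "(U, \<phi>) \<in> A" "point vs s \<in> U"
proof -
  have "homeomorphic_map (top_of_set (realization K)) M h"
    using triangulation unfolding smooth_triangulation_def by (elim conjE)
  then have "h ` realization K = topspace M" using homeomorphic_imp_surjective_map by fastforce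
  then have "point vs s \<in> topspace M" using bary_in_realization[OF assms] by blast
  then show ?thesis using cover that by blast
qed

lemma smooth_extension:
  assumes "vs \<in> ordered_simplices K 3" "s \<in> std_3_simplex" "(U, \<phi>) \<in> A" "point vs s \<in> U"
  obtains N F where "open N" "s \<in> N" "smooth_on F N" "\<And>t. t \<in> N \<Longrightarrow> Determinants.det (jacobian F (at t)) \<noteq> 0"
    "\<And>t. t \<in> N \<inter> std_3_simplex \<Longrightarrow> point vs t \<in> U \<and> \<phi> (point vs t) = F t"
proof -
  have "\<forall>vs\<in>ordered_simplices K 3. \<forall>s\<in>std_3_simplex. \<forall>(U, \<phi>)\<in>A. h (bary vs s) \<in> U \<longrightarrow>
       (\<exists>N F. open N \<and> s \<in> N \<and> smooth_on F N \<and>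
         (\<forall>t\<in>N. Determinants.det (jacobian F (at t)) \<noteq> 0) \<and>
         (\<forall>t\<in>N \<inter> std_3_simplex. h (bary vs t) \<in> U \<and> \<phi> (h (bary vs t)) = F t))"
    using triangulation unfolding smooth_triangulation_def by (elim conjE)
  from this[rule_format, OF assms(1,2,3)] assms(4)
  have "\<exists>N F. open N \<and> s \<in> N \<and> smooth_on F N \<and>
         (\<forall>t\<in>N. Determinants.det (jacobian F (at t)) \<noteq> 0) \<and>
         (\<forall>t\<in>N \<inter> std_3_simplex. h (bary vs t) \<in> U \<and> \<phi> (h (bary vs t)) = F t)"
    by simp
  then show ?thesis using that by metis
qed

text \<open>Around a point of the open simplex the coordinate expression coincides with the smooth
  extension on a full neighbourhood, and so inherits its derivative.\<close>

lemma interior_chart: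
  assumes "vs \<in> ordered_simplices K 3" "t \<in> \<Delta>" "(U, \<phi>) \<in> A" "point vs t \<in> U"
  shows "(\<lambda>r. \<phi> (point vs r)) differentiable (at t)"
    and "Determinants.det (jacobian (\<lambda>r. \<phi> (point vs r)) (at t)) \<noteq> 0"
    and "\<exists>W. open W \<and> t \<in> W \<and> W \<subseteq> \<Delta> \<and> (\<forall>r\<in>W. point vs r \<in> U)"
proof -
  have t: "t \<in> std_3_simplex" using assms(2) interior_subset by blast
  obtain N F where N: "open N" "t \<in> N" "smooth_on F N" "\<And>t. t \<in> N \<Longrightarrow> Determinants.det (jacobian F (at t)) \<noteq> 0"
    "\<And>t. t \<in> N \<inter> std_3_simplex \<Longrightarrow> point vs t \<in> U \<and> \<phi> (point vs t) = F t"
    using smooth_extension[OF assms(1) t assms(3,4)] by blast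
  let ?W = "N \<inter> \<Delta>"
  have W: "open ?W" "t \<in> ?W" using N assms by auto
  have eq: "\<phi> (point vs r) = F r" if "r \<in> ?W" for r using N(5) that interior_subset by blast
  have F: "F differentiable (at t)" using smooth_on_differentiable N by blast
  show "(\<lambda>r. \<phi> (point vs r)) differentiable (at t)" by (rule jacobian_cong_open(1)[OF W eq F])
  show "Determinants.det (jacobian (\<lambda>r. \<phi> (point vs r)) (at t)) \<noteq> 0"
    using jacobian_cong_open(2)[OF W eq F] N by simp
  show "\<exists>W. open W \<and> t \<in> W \<and> W \<subseteq> \<Delta> \<and> (\<forall>r\<in>W. point vs r \<in> U)"
    using W N(5) interior_subset by (intro exI[of _ ?W]) blast
qed

lemma open_chart_overlap:
  assumes "(U, \<phi>) \<in> A" "(V, \<psi>) \<in> A"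
  shows "open (\<phi> ` (U \<inter> V))"
proof -
  have U: "openin M U" "open (\<phi> ` U)" "homeomorphic_map (subtopology M U) (top_of_set (\<phi> ` U)) \<phi>" and V: "openin M V"
    using chart assms by blast+
  have "openin (subtopology M U) (U \<inter> V)" using U V by (simp add: openin_subtopology_Int2 inf_commute)
  moreover have "U \<inter> V \<subseteq> topspace (subtopology M U)" using U V openin_subset by fastforce
  ultimately have "openin (top_of_set (\<phi> ` U)) (\<phi> ` (U \<inter> V))"
    using homeomorphic_map_openness[OF U(3)] by blast
  then show ?thesis using U(2) openin_open_eq by blast
qed

lemma inj_on_chart:
  assumes "(U, \<phi>) \<in> A"
  shows "inj_on \<phi> U"
proof -
  have U: "openin M U" "homeomorphic_map (subtopology M U) (top_of_set (\<phi> ` U)) \<phi>" using chart assms by blast+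
  have "topspace (subtopology M U) = U" using openin_subset[OF U(1)] by auto
  then show ?thesis using homeomorphic_imp_injective_map[OF U(2)] by simp
qed

lemma jacobian_chart_change:
  assumes vs: "vs \<in> ordered_simplices K 3" "t \<in> \<Delta>"
    and U: "(U, \<phi>) \<in> A" "point vs t \<in> U" and V: "(V, \<psi>) \<in> A" "point vs t \<in> V"
  shows "jacobian (\<lambda>r. \<psi> (point vs r)) (at t) =
    jacobian (\<psi> \<circ> inv_into U \<phi>) (at (\<phi> (point vs t))) ** jacobian (\<lambda>r. \<phi> (point vs r)) (at t)"
proof -
  obtain W where W: "open W" "t \<in> W" "\<And>r. r \<in> W \<Longrightarrow> point vs r \<in> U"
    using interior_chart(3)[OF vs U] by blast
  let ?\<tau> = "\<psi> \<circ> inv_into U \<phi>"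
  have eq: "\<psi> (point vs r) = ?\<tau> (\<phi> (point vs r))" if "r \<in> W" for r
    using W(3)[OF that] inj_on_chart[OF U(1)] by simp
  have d\<phi>: "(\<lambda>r. \<phi> (point vs r)) differentiable (at t)" by (rule interior_chart(1)[OF vs U])
  have d\<tau>: "?\<tau> differentiable (at (\<phi> (point vs t)))"
    by (rule smooth_on_differentiable[OF transition_smooth[OF U(1) V(1)] open_chart_overlap[OF U(1) V(1)]])
       (use U V in auto)
  have d: "(\<lambda>r. ?\<tau> (\<phi> (point vs r))) differentiable (at t)"
    using differentiable_chain_at[OF d\<phi> d\<tau>] by (simp add: comp_def)
  have "jacobian (\<lambda>r. \<psi> (point vs r)) (at t) = jacobian (\<lambda>r. ?\<tau> (\<phi> (point vs r))) (at t)"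
    using jacobian_cong_open(2)[OF W(1,2) eq d] by simp
  also have "\<dots> = jacobian ?\<tau> (at (\<phi> (point vs t))) ** jacobian (\<lambda>r. \<phi> (point vs r)) (at t)"
    by (rule jacobian_compose[OF d\<phi> d\<tau>])
  finally show ?thesis .
qed

text \<open>Lets any chart replace the one selected by \<open>SOME\<close>: the Jacobians of the two
  charts differ by the transition Jacobian, which the transformation law of the metric
  absorbs.\<close>

lemma pullback_metric_chart:
  assumes vs: "vs \<in> ordered_simplices K 3" "t \<in> \<Delta>" and U: "(U, \<phi>) \<in> A" "point vs t \<in> U"
  defines "J \<equiv> jacobian (\<lambda>r. \<phi> (point vs r)) (at t)"
  shows "pullback_metric A g h vs t = Finite_Cartesian_Product.transpose J ** g (U, \<phi>) (\<phi> (point vs t)) ** J"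
proof -
  define c where "c = (SOME c. c \<in> A \<and> h (bary vs t) \<in> fst c)"
  have "c \<in> A \<and> h (bary vs t) \<in> fst c"
    unfolding c_def by (rule someI[of _ "(U, \<phi>)"]) (use U in auto)
  then obtain V \<psi> where c: "c = (V, \<psi>)" and V: "(V, \<psi>) \<in> A" "point vs t \<in> V" by (cases c) auto
  let ?x = "\<phi> (point vs t)" and ?\<tau> = "\<psi> \<circ> inv_into U \<phi>"
  let ?T = "jacobian ?\<tau> (at ?x)"
  have x: "?x \<in> \<phi> ` (U \<inter> V)" using U V by blast
  have \<tau>: "?\<tau> ?x = \<psi> (point vs t)" using inj_on_chart[OF U(1)] U by simp
  have "pullback_metric A g h vs t = Finite_Cartesian_Product.transpose (?T ** J) ** g (V, \<psi>) (?\<tau> ?x) ** (?T ** J)"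
    unfolding pullback_metric_def c_def[symmetric] Let_def c snd_conv jacobian_chart_change[OF vs U V] \<tau> J_def ..
  also have "\<dots> = Finite_Cartesian_Product.transpose J ** (Finite_Cartesian_Product.transpose ?T ** g (V, \<psi>) (?\<tau> ?x) ** ?T) ** J"
    by (simp add: matrix_transpose_mul matrix_mul_assoc)
  also have "Finite_Cartesian_Product.transpose ?T ** g (V, \<psi>) (?\<tau> ?x) ** ?T = g (U, \<phi>) ?x"
    using metric_transform[OF U(1) V(1) x] by simp
  finally show ?thesis .
qed

lemma pos_def_metric:
  assumes "(U, \<phi>) \<in> A" "x \<in> \<phi> ` U"
  shows "pos_def_matrix (g (U, \<phi>) x)"
  using metric_symmetric[OF assms] metric_positive[OF assms] by (simp add: pos_def_matrix_def)

lemma pos_def_pullback_metric: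
  assumes vs: "vs \<in> ordered_simplices K 3" "t \<in> \<Delta>"
  shows "pos_def_matrix (pullback_metric A g h vs t)"
proof -
  obtain U \<phi> where U: "(U, \<phi>) \<in> A" "point vs t \<in> U" using chart_at vs interior_subset by blast
  show ?thesis
    unfolding pullback_metric_chart[OF vs U]
    by (rule pos_def_matrix_congruence[OF pos_def_metric[OF U(1)] interior_chart(2)[OF vs U]]) (use U in blast)
qed

text \<open>The smooth extension \<open>F\<close> lives on a full neighbourhood even of a boundary
  point. Pulling the metric back along \<open>F\<close> therefore continues the pulled back metric
  past the boundary, and invertibility of the Jacobian keeps it nondegenerate.\<close>

lemma pullback_metric_extension:
  assumes vs: "vs \<in> ordered_simplices K 3" and s: "s \<in> std_3_simplex"
  shows "\<exists>N H. open N \<and> s \<in> N \<and> continuous_on N H \<and> (\<forall>t\<in>N. Determinants.det (H t) \<noteq> 0) \<and>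
    (\<forall>t\<in>N \<inter> \<Delta>. pullback_metric A g h vs t = H t)"
proof -
  obtain U \<phi> where U: "(U, \<phi>) \<in> A" "point vs s \<in> U" using chart_at assms by blast
  obtain N F where N: "open N" "s \<in> N" "smooth_on F N" "\<And>t. t \<in> N \<Longrightarrow> Determinants.det (jacobian F (at t)) \<noteq> 0"
    "\<And>t. t \<in> N \<inter> std_3_simplex \<Longrightarrow> point vs t \<in> U \<and> \<phi> (point vs t) = F t"
    using smooth_extension[OF vs s U] by blast
  \<comment> \<open>Outside the simplex \<open>F\<close> may leave the chart image, beyond which
    nothing is known about \<open>g\<close>.\<close>
  let ?N = "N \<inter> F -` (\<phi> ` U)"
  let ?H = "\<lambda>t. Finite_Cartesian_Product.transpose (jacobian F (at t)) ** g (U, \<phi>) (F t) ** jacobian F (at t)"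
  have op: "open ?N" using chart[OF U(1)] smooth_on_continuous[OF N(3)] N(1) by (intro continuous_open_preimage) auto
  have "\<phi> (point vs s) = F s" using N(2) N(5)[of s] s by blast
  then have "F s \<in> \<phi> ` U" using U(2) by (metis imageI)
  then have sN: "s \<in> ?N" using N(2) by simp
  have cJ: "continuous_on ?N (\<lambda>t. jacobian F (at t))"
    using smooth_on_continuous_jacobian[OF N(3)] continuous_on_subset by blast
  have "continuous_on ?N F" using smooth_on_continuous[OF N(3)] continuous_on_subset by blast
  then have "continuous_on ?N (\<lambda>t. g (U, \<phi>) (F t))"
    by (rule continuous_on_compose2[OF smooth_on_continuous[OF metric_smooth[OF U(1)]]]) auto
  then have cH: "continuous_on ?N ?H" using cJ by (intro continuous_on_matrix_mult continuous_on_transpose)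
  have "Determinants.det (?H t) \<noteq> 0" if "t \<in> ?N" for t
    using pos_def_matrix_det_pos[OF pos_def_matrix_congruence[OF pos_def_metric[OF U(1)] N(4)], of "F t" t] that by auto
  moreover have "pullback_metric A g h vs t = ?H t" if t: "t \<in> ?N \<inter> \<Delta>" for t
  proof -
    have t': "t \<in> \<Delta>" "t \<in> N \<inter> \<Delta>" "t \<in> N \<inter> std_3_simplex" using t interior_subset by auto
    have "jacobian (\<lambda>r. \<phi> (point vs r)) (at t) = jacobian F (at t)"
      by (rule jacobian_cong_open(2)[of "N \<inter> \<Delta>"])
         (use N t' interior_subset smooth_on_differentiable in \<open>blast+\<close>)
    then show ?thesis using pullback_metric_chart[OF vs t'(1) U(1)] N(5)[OF t'(3)] by simp
  qed
  ultimately show ?thesis using op sN cH by blast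
qed

definition density_pairing :: "nat \<Rightarrow> 'v cochain \<Rightarrow> 'v cochain \<Rightarrow> 'v list \<Rightarrow> real^3 \<Rightarrow> real" where
  "density_pairing k u w vs s = pairing k (pullback_metric A g h vs s) (whitney_map K k u vs s) (whitney_map K k w vs s)"

lemma density_pairing_regular:
  assumes vs: "vs \<in> ordered_simplices K 3"
  shows "set_integrable lborel \<Delta> (density_pairing k u w vs)" and "continuous_on \<Delta> (density_pairing k u w vs)"
proof -
  have loc: "\<exists>N F. open N \<and> s \<in> N \<and> continuous_on N F \<and> (\<forall>t\<in>N \<inter> \<Delta>. density_pairing k u w vs t = F t)"
    if s: "s \<in> std_3_simplex" for s
  proof -
    obtain N H where N: "open N" "s \<in> N" "continuous_on N H" "\<And>t. t \<in> N \<Longrightarrow> Determinants.det (H t) \<noteq> 0"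
      "\<And>t. t \<in> N \<inter> \<Delta> \<Longrightarrow> pullback_metric A g h vs t = H t"
      using pullback_metric_extension[OF vs s] by blast
    let ?F = "\<lambda>t. pairing k (H t) (whitney_map K k u vs t) (whitney_map K k w vs t)"
    have "continuous_on N ?F" using continuous_on_pairing[OF N(3,4)] .
    moreover have "\<forall>t\<in>N \<inter> \<Delta>. density_pairing k u w vs t = ?F t" using N(5) by (simp add: density_pairing_def)
    ultimately show ?thesis using N(1,2) by blast
  qed
  show "set_integrable lborel \<Delta> (density_pairing k u w vs)" "continuous_on \<Delta> (density_pairing k u w vs)"
    using set_integrable_locally_continuous[OF open_interior interior_subset compact_std_3_simplex loc] by blast+
qed

section \<open>The Whitney inner product: symmetry and positivity\<close>

abbreviation "ip \<equiv> whitney_inner A g K h"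
abbreviation "positive_simplices \<equiv> {vs. vs \<in> ordered_simplices K 3 \<and> positively_oriented A h vs}"

lemma finite_positive_simplices: "finite positive_simplices"
  by (rule finite_subset[OF _ finite_ordered_simplices[of 3]]) auto

lemma ip_eq: "ip k u w = (\<Sum>vs\<in>positive_simplices. LINT s:\<Delta>|lborel. density_pairing k u w vs s) / 12"
  unfolding whitney_inner_def integral_pw_def density_pairing_def pairing_def ..

text \<open>Additivity of the integrals rests on \<open>density_pairing_regular\<close>, which
  covers every degree. Linearity thus holds on 2-cochains too, as the adjoint of
  \<open>coboundary K 1\<close> requires.\<close>

lemma ip_linear_left: "ip k (\<lambda>xs. s * u xs + t * v xs) w = s * ip k u w + t * ip k v w"
proof -
  have "(LINT p:\<Delta>|lborel. density_pairing k (\<lambda>xs. s * u xs + t * v xs) w vs p) =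
      s * (LINT p:\<Delta>|lborel. density_pairing k u w vs p) + t * (LINT p:\<Delta>|lborel. density_pairing k v w vs p)"
    if vs: "vs \<in> ordered_simplices K 3" for vs
  proof -
    have "density_pairing k (\<lambda>xs. s * u xs + t * v xs) w vs p = s * density_pairing k u w vs p + t * density_pairing k v w vs p" for p
      unfolding density_pairing_def whitney_map_linear[abs_def] pairing_linear_left ..
    then show ?thesis using density_pairing_regular(1)[OF vs] by (simp add: set_integral_add set_integral_mult_right)
  qed
  then have "(\<Sum>vs\<in>positive_simplices. LINT p:\<Delta>|lborel. density_pairing k (\<lambda>xs. s * u xs + t * v xs) w vs p)
     = (\<Sum>vs\<in>positive_simplices. s * (LINT p:\<Delta>|lborel. density_pairing k u w vs p) + t * (LINT p:\<Delta>|lborel. density_pairing k v w vs p))"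
    by (intro sum.cong) auto
  then show ?thesis unfolding ip_eq by (simp add: sum.distrib sum_distrib_left add_divide_distrib)
qed

lemma ip_local: "(\<And>xs. xs \<in> ordered_simplices K k \<Longrightarrow> u xs = v xs) \<Longrightarrow> ip k u w = ip k v w"
proof -
  assume "\<And>xs. xs \<in> ordered_simplices K k \<Longrightarrow> u xs = v xs"
  then have "whitney_map K k u = whitney_map K k v" unfolding whitney_map_def by (intro ext) simp
  then show ?thesis unfolding whitney_inner_def by simp
qed

lemma density_pairing_0:
  "density_pairing 0 u w vs s = whitney_map K 0 u vs s (\<lambda>_. 0) * whitney_map K 0 w vs s (\<lambda>_. 0) *
    sqrt (Determinants.det (pullback_metric A g h vs s))"
proof -
  have "whitney_map K 0 v vs s = (\<lambda>X. whitney_map K 0 v vs s (\<lambda>_. 0))" for v by (simp add: whitney_map_0 fun_eq_iff)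
  then show ?thesis unfolding density_pairing_def using pairing_0 by metis
qed

text \<open>The Whitney 1-form at a point as a vector, through the Euclidean product of the
  parameter space; the integrand becomes a form in the inverse metric.\<close>

definition covector :: "'v cochain \<Rightarrow> 'v list \<Rightarrow> real^3 \<Rightarrow> real^3" where
  "covector u vs s = (\<chi> i. whitney_map K 1 u vs s (\<lambda>_. axis i 1))"

lemma whitney_map_1_linear: "linear (\<lambda>x. whitney_map K 1 u vs s (\<lambda>_. x))"
  unfolding whitney_map_1
  by (rule linearI)
     (simp_all add: linear_add[OF linear_blin] linear_scale[OF linear_blin]
       sum.distrib[symmetric] sum_distrib_left algebra_simps flip: add_divide_distrib)

lemma whitney_map_1_covector: "whitney_map K 1 u vs s X = inner (covector u vs s) (X 0)"
proof -
  have "whitney_map K 1 u vs s X = whitney_map K 1 u vs s (\<lambda>_. X 0)" unfolding whitney_map_1 ..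
  then show ?thesis
    unfolding covector_def by (rule trans[OF _ linear_eq_inner[OF whitney_map_1_linear]])
qed

lemma density_pairing_1:
  "density_pairing 1 u w vs s = sqrt (Determinants.det (pullback_metric A g h vs s)) *
    inner (covector w vs s) (matrix_inv (pullback_metric A g h vs s) *v covector u vs s)"
proof -
  have "whitney_map K 1 v vs s = (\<lambda>X. (\<lambda>x. whitney_map K 1 v vs s (\<lambda>_. x)) (X 0))" for v
    unfolding whitney_map_1[abs_def] ..
  then have "density_pairing 1 u w vs s = pairing 1 (pullback_metric A g h vs s)
     (\<lambda>X. (\<lambda>x. whitney_map K 1 u vs s (\<lambda>_. x)) (X 0)) (\<lambda>X. (\<lambda>x. whitney_map K 1 w vs s (\<lambda>_. x)) (X 0))"
    unfolding density_pairing_def by metis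
  then show ?thesis unfolding covector_def
    by (simp only: pairing_1_linear[OF whitney_map_1_linear whitney_map_1_linear])
qed

lemma ip_symmetric:
  assumes "k = 0 \<or> k = 1"
  shows "ip k u w = ip k w u"
proof -
  have "(LINT s:\<Delta>|lborel. density_pairing k u w vs s) = (LINT s:\<Delta>|lborel. density_pairing k w u vs s)"
    if vs: "vs \<in> ordered_simplices K 3" for vs
  proof (rule set_lebesgue_integral_cong)
    show "\<forall>s. s \<in> \<Delta> \<longrightarrow> density_pairing k u w vs s = density_pairing k w u vs s"
      using assms pos_def_matrix_inv(1)[OF pos_def_pullback_metric[OF vs]]
      by (auto simp: density_pairing_0 density_pairing_1[unfolded One_nat_def])
  qed simp
  then show ?thesis unfolding ip_eq by (intro arg_cong2[where f="(/)"] sum.cong) auto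
qed

lemma density_pairing_nonneg:
  assumes "k = 0 \<or> k = 1" and vs: "vs \<in> ordered_simplices K 3" "s \<in> \<Delta>"
  shows "0 \<le> density_pairing k u u vs s"
    and "density_pairing k u u vs s = 0 \<Longrightarrow> whitney_map K k u vs s X = 0"
proof -
  note G = pos_def_pullback_metric[OF vs]
  have det: "0 < sqrt (Determinants.det (pullback_metric A g h vs s))" using pos_def_matrix_det_pos[OF G] by simp
  have "0 \<le> inner x (matrix_inv (pullback_metric A g h vs s) *v x)" for x
    using pos_def_matrix_inv(2)[OF G, of x] by (cases "x = 0") auto
  then show "0 \<le> density_pairing k u u vs s"
    using assms(1) det unfolding density_pairing_0 density_pairing_1 by (auto simp: density_pairing_0 density_pairing_1[unfolded One_nat_def])
  assume 0: "density_pairing k u u vs s = 0"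
  show "whitney_map K k u vs s X = 0"
    using assms(1)
  proof
    assume k: "k = 0"
    then have "whitney_map K 0 u vs s (\<lambda>_. 0) = 0" using 0 det by (simp add: density_pairing_0)
    then show ?thesis using k by (simp add: whitney_map_0)
  next
    assume k: "k = 1"
    then have "inner (covector u vs s) (matrix_inv (pullback_metric A g h vs s) *v covector u vs s) = 0"
      using 0 det by (simp add: density_pairing_1[unfolded One_nat_def])
    then have "covector u vs s = 0" using pos_def_matrix_inv(2)[OF G] by fastforce
    then show ?thesis using k whitney_map_1_covector by simp
  qed
qed

lemma ip_eq_0_whitney_map:
  assumes k: "k = 0 \<or> k = 1" and 0: "ip k u u = 0" and vs: "vs \<in> positive_simplices" and s: "s \<in> std_3_simplex"
  shows "whitney_map K k u vs s (\<lambda>_. x) = 0"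
proof -
  have nn: "0 \<le> (LINT s:\<Delta>|lborel. density_pairing k u u vs s)" if "vs \<in> positive_simplices" for vs
    unfolding set_lebesgue_integral_def using density_pairing_nonneg(1)[OF k] that
    by (intro integral_nonneg_AE AE_I2) (auto simp: indicator_def)
  have "(\<Sum>vs\<in>positive_simplices. LINT s:\<Delta>|lborel. density_pairing k u u vs s) = 0" using 0 unfolding ip_eq by simp
  then have "\<forall>vs\<in>positive_simplices. (LINT s:\<Delta>|lborel. density_pairing k u u vs s) = 0"
    by (subst (asm) sum_nonneg_eq_0_iff[OF finite_positive_simplices nn])
  then have "(LINT s:\<Delta>|lborel. density_pairing k u u vs s) = 0" using vs by (rule bspec)
  then have "density_pairing k u u vs t = 0" if "t \<in> \<Delta>" for t
    using vs that density_pairing_nonneg(1)[OF k] density_pairing_regular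
    by (intro set_integral_nonneg_eq_0_continuous[of \<Delta> "density_pairing k u u vs"]) auto
  then have z: "whitney_map K k u vs t (\<lambda>_. x) = 0" if "t \<in> \<Delta>" for t
    using density_pairing_nonneg(2)[OF k] vs that by blast
  \<comment> \<open>Positivity of the metric is available on the open simplex only. The Whitney form
    itself is free of the metric and continuous everywhere, so its vanishing reaches the
    boundary.\<close>
  have "continuous_on (closure \<Delta>) (\<lambda>t. whitney_map K k u vs t (\<lambda>_. x))"
    by (rule continuous_form_onD[OF continuous_form_on_whitney_map]) simp
  then show ?thesis
    using continuous_constant_on_closure[of \<Delta> "\<lambda>t. whitney_map K k u vs t (\<lambda>_. x)" 0 s] z s std_3_simplex_closure by auto
qed

end

text \<open>Exchanging the middle two vertices of a 3-simplex amounts to composing its parametrization with this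
  reflection.  Hence one of the two orderings is positively oriented.\<close>

definition swap_matrix :: "real^3^3" where
  "swap_matrix = vector [axis 2 1, axis 1 1, axis 3 1]"

lemma swap_matrix_nth:
  "(swap_matrix *v s) $ 1 = s $ 2" "(swap_matrix *v s) $ 2 = s $ 1" "(swap_matrix *v s) $ 3 = s $ 3"
  by (simp_all add: swap_matrix_def matrix_vector_mult_def sum_3 vector_3 axis_nth_if)

lemma det_swap_matrix: "Determinants.det swap_matrix = -1"
  by (simp add: swap_matrix_def det_vector_3 axis_nth_if)

lemma swap_matrix_involution: "swap_matrix *v (swap_matrix *v s) = s"
  by (simp add: Finite_Cartesian_Product.vec_eq_iff forall_3 swap_matrix_nth)

lemma bary_swap:
  assumes "distinct [a, b, c, d]"
  shows "bary [a, c, b, d] s = bary [a, b, c, d] (swap_matrix *v s)"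
  using assms by (auto simp: bary_def fun_eq_iff swap_matrix_nth)

lemma swap_matrix_simplex: "s \<in> std_3_simplex \<Longrightarrow> swap_matrix *v s \<in> std_3_simplex"
  by (simp add: std_3_simplex_def forall_3 sum_3 swap_matrix_nth add_ac)

lemma swap_matrix_interior:
  assumes "s \<in> interior std_3_simplex"
  shows "swap_matrix *v s \<in> interior std_3_simplex"
proof -
  let ?S = "(\<lambda>s. swap_matrix *v s) -` interior std_3_simplex"
  have "open ?S"
    by (rule open_vimage) (auto intro: matrix_vector_mult_linear_continuous_on)
  moreover have "?S \<subseteq> std_3_simplex"
  proof
    fix s assume "s \<in> ?S"
    then have "swap_matrix *v s \<in> std_3_simplex" using interior_subset by blast
    then show "s \<in> std_3_simplex" using swap_matrix_simplex swap_matrix_involution by metis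
  qed
  ultimately have "?S \<subseteq> interior std_3_simplex" by (rule interior_maximal[rotated])
  moreover have "swap_matrix *v s \<in> ?S" using assms by (simp add: swap_matrix_involution)
  ultimately show ?thesis by blast
qed

section \<open>Orientation of simplices\<close>

context triangulated_3_manifold
begin

text \<open>The orientation condition at a single point, where it can be compared between charts and
  from point to point.\<close>

definition positive_at :: "'v list \<Rightarrow> real^3 \<Rightarrow> bool" where
  "positive_at vs s \<longleftrightarrow> (\<forall>(U, \<phi>)\<in>A. point vs s \<in> U \<longrightarrow> Determinants.det (jacobian (\<lambda>t. \<phi> (point vs t)) (at s)) > 0)"

lemma positively_oriented_eq: "positively_oriented A h vs \<longleftrightarrow> (\<forall>s\<in>\<Delta>. positive_at vs s)"
  unfolding positively_oriented_def positive_at_def ..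

text \<open>One chart decides, because transition maps have positive Jacobian determinant.\<close>

lemma positive_at_chart:
  assumes vs: "vs \<in> ordered_simplices K 3" "s \<in> \<Delta>" and U: "(U, \<phi>) \<in> A" "point vs s \<in> U"
  shows "positive_at vs s \<longleftrightarrow> Determinants.det (jacobian (\<lambda>t. \<phi> (point vs t)) (at s)) > 0"
proof
  assume "positive_at vs s"
  then show "Determinants.det (jacobian (\<lambda>t. \<phi> (point vs t)) (at s)) > 0"
    using U unfolding positive_at_def by blast
next
  assume pos: "Determinants.det (jacobian (\<lambda>t. \<phi> (point vs t)) (at s)) > 0"
  have "Determinants.det (jacobian (\<lambda>t. \<psi> (point vs t)) (at s)) > 0" if V: "(V, \<psi>) \<in> A" "point vs s \<in> V" for V \<psi>
  proof -
    have "\<phi> (point vs s) \<in> \<phi> ` (U \<inter> V)" using U V by (intro imageI IntI)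
    then have "Determinants.det (jacobian (\<psi> \<circ> inv_into U \<phi>) (at (\<phi> (point vs s)))) > 0"
      by (rule transition_oriented[OF U(1) V(1)])
    then show ?thesis using pos unfolding jacobian_chart_change[OF vs U V] by (simp add: det_mul)
  qed
  then show "positive_at vs s" unfolding positive_at_def by (intro ballI) (auto split: prod.split)
qed

text \<open>Near \<open>s\<close> the sign is that of the Jacobian determinant of the smooth
  extension, a continuous function without zeros.\<close>

lemma positive_at_locally_constant:
  assumes vs: "vs \<in> ordered_simplices K 3" "s \<in> \<Delta>"
  shows "\<exists>W. open W \<and> s \<in> W \<and> (\<forall>t\<in>W \<inter> \<Delta>. positive_at vs s = positive_at vs t)"
proof -
  have s: "s \<in> std_3_simplex" using vs(2) interior_subset by (rule subsetD[rotated])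
  obtain U \<phi> where U: "(U, \<phi>) \<in> A" "point vs s \<in> U" by (rule chart_at[OF vs(1) s])
  obtain N F where N: "open N" "s \<in> N" "smooth_on F N" "\<And>t. t \<in> N \<Longrightarrow> Determinants.det (jacobian F (at t)) \<noteq> 0"
    "\<And>t. t \<in> N \<inter> std_3_simplex \<Longrightarrow> point vs t \<in> U \<and> \<phi> (point vs t) = F t"
    using smooth_extension[OF vs(1) s U] by blast
  let ?d = "\<lambda>t. Determinants.det (jacobian F (at t))"
  have cd: "continuous_on N ?d" by (rule continuous_on_det[OF smooth_on_continuous_jacobian[OF N(3)]])
  have pos: "positive_at vs t \<longleftrightarrow> ?d t > 0" if t: "t \<in> N \<inter> \<Delta>" for t
  proof -
    have t': "t \<in> N" "t \<in> \<Delta>" "t \<in> N \<inter> std_3_simplex" using t interior_subset[of std_3_simplex] by auto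
    have op: "open (N \<inter> \<Delta>)" using N(1) by (intro open_Int open_interior)
    have eq: "\<phi> (point vs r) = F r" if "r \<in> N \<inter> \<Delta>" for r
      using N(5)[of r] that interior_subset[of std_3_simplex] by blast
    have "jacobian (\<lambda>r. \<phi> (point vs r)) (at t) = jacobian F (at t)"
      by (rule jacobian_cong_open(2)[OF op t eq smooth_on_differentiable[OF N(3,1) t'(1)]])
    then show ?thesis using positive_at_chart[OF vs(1) t'(2) U(1)] N(5)[OF t'(3)] by simp
  qed
  have sN: "s \<in> N \<inter> \<Delta>" using N(2) vs(2) by (rule IntI)
  show ?thesis
  proof (cases "?d s > 0")
    case True
    let ?W = "N \<inter> ?d -` {0<..}"
    have "open ?W" using cd N(1) by (intro continuous_open_preimage) auto
    then show ?thesis using True sN pos by (intro exI[of _ ?W]) auto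
  next
    case False
    let ?W = "N \<inter> ?d -` {..<0}"
    have "open ?W" using cd N(1) by (intro continuous_open_preimage) auto
    then show ?thesis using False N(4)[of s] sN pos by (intro exI[of _ ?W]) (auto simp: not_less less_le)
  qed
qed

lemma positive_at_constant:
  assumes vs: "vs \<in> ordered_simplices K 3" "s \<in> \<Delta>" "t \<in> \<Delta>"
  shows "positive_at vs s = positive_at vs t"
proof (rule connected_local_const[where A="\<Delta>"])
  show "connected \<Delta>" by (intro convex_connected convex_interior convex_std_3_simplex)
  show "\<forall>a\<in>\<Delta>. eventually (\<lambda>b. positive_at vs a = positive_at vs b) (at a within \<Delta>)"
  proof
    fix a assume a: "a \<in> \<Delta>"
    obtain W where "open W" "a \<in> W" "\<forall>t\<in>W \<inter> \<Delta>. positive_at vs a = positive_at vs t"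
      using positive_at_locally_constant[OF vs(1) a] by (elim exE conjE)
    then show "eventually (\<lambda>b. positive_at vs a = positive_at vs b) (at a within \<Delta>)"
      unfolding eventually_at_topological by (intro exI[of _ W]) auto
  qed
qed (use vs in auto)

lemma positive_at_swap:
  assumes vs: "[a, b, c, d] \<in> ordered_simplices K 3" and s: "s \<in> \<Delta>"
    and neg: "\<not> positive_at [a, b, c, d] (swap_matrix *v s)"
  shows "positive_at [a, c, b, d] s"
proof -
  have dist: "distinct [a, b, c, d]" using vs by (simp add: ordered_simplices_def)
  have vs': "[a, c, b, d] \<in> ordered_simplices K 3" using vs by (auto simp: ordered_simplices_def insert_commute)
  have Ps: "swap_matrix *v s \<in> \<Delta>" by (rule swap_matrix_interior[OF s])
  have s': "s \<in> std_3_simplex" using s interior_subset by (rule subsetD[rotated])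
  obtain U \<phi> where U: "(U, \<phi>) \<in> A" "point [a, c, b, d] s \<in> U" by (rule chart_at[OF vs' s'])
  have U': "point [a, b, c, d] (swap_matrix *v s) \<in> U" using U(2) unfolding bary_swap[OF dist] .
  let ?f = "\<lambda>r. \<phi> (point [a, b, c, d] r)"
  have lin: "((\<lambda>r. swap_matrix *v r) has_derivative (\<lambda>v. swap_matrix *v v)) (at s)"
    by (rule linear_imp_has_derivative) (rule matrix_vector_mul_linear)
  have d1: "(\<lambda>r. swap_matrix *v r) differentiable (at s)"
    using lin by (rule differentiableI)
  have d2: "?f differentiable (at (swap_matrix *v s))"
    by (rule interior_chart(1)[OF vs Ps U(1) U'])
  have "jacobian (\<lambda>r. \<phi> (point [a, c, b, d] r)) (at s) = jacobian ?f (at (swap_matrix *v s)) ** swap_matrix"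
    unfolding bary_swap[OF dist] jacobian_compose[OF d1 d2] jacobian_eqI[OF lin] ..
  then have "Determinants.det (jacobian (\<lambda>r. \<phi> (point [a, c, b, d] r)) (at s)) = - Determinants.det (jacobian ?f (at (swap_matrix *v s)))"
    by (simp add: det_mul det_swap_matrix)
  moreover have "Determinants.det (jacobian ?f (at (swap_matrix *v s))) < 0"
    using neg interior_chart(2)[OF vs Ps U(1) U'] unfolding positive_at_chart[OF vs Ps U(1) U'] by simp
  ultimately show ?thesis unfolding positive_at_chart[OF vs' s U] by simp
qed

text \<open>The integral ignores orderings that are not positively oriented, so this is what lets
  the inner product see every simplex. If an ordering fails at one point it fails on the whole open
  simplex, and the swapped ordering is then positive throughout.\<close>

lemma positive_ordering:
  assumes \<sigma>: "\<sigma> \<in> K"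
  obtains vs where "vs \<in> positive_simplices" "\<sigma> \<subseteq> set vs"
proof -
  have "\<forall>\<sigma>\<in>K. \<exists>\<tau>\<in>K. card \<tau> = 4 \<and> \<sigma> \<subseteq> \<tau>"
    using triangulation unfolding smooth_triangulation_def by (elim conjE)
  then obtain \<tau> where \<tau>: "\<tau> \<in> K" "card \<tau> = 4" "\<sigma> \<subseteq> \<tau>" using \<sigma> by (metis bspec)
  obtain vs where vs: "set vs = \<tau>" "distinct vs" using finite_distinct_list simplex[OF \<tau>(1)] by metis
  then have "length vs = 4" using \<tau>(2) distinct_card by fastforce
  then obtain a b c d where abcd: "vs = [a, b, c, d]" by (auto simp: numeral_eq_Suc length_Suc_conv)
  have ord: "[a, b, c, d] \<in> ordered_simplices K 3" "[a, c, b, d] \<in> ordered_simplices K 3"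
    using vs \<tau>(1) by (auto simp: ordered_simplices_def abcd insert_commute)
  show ?thesis
  proof (cases "positively_oriented A h [a, b, c, d]")
    case True
    then show ?thesis using ord \<tau>(3) vs by (intro that[of "[a, b, c, d]"]) (simp_all add: abcd)
  next
    case False
    then obtain s where s: "s \<in> \<Delta>" "\<not> positive_at [a, b, c, d] s" unfolding positively_oriented_eq by (metis)
    have "positive_at [a, c, b, d] t" if t: "t \<in> \<Delta>" for t
      using positive_at_swap[OF ord(1) t] positive_at_constant[OF ord(1) s(1) swap_matrix_interior[OF t]] s(2) by simp
    then have "positively_oriented A h [a, c, b, d]" unfolding positively_oriented_eq by (rule ballI)
    then show ?thesis using ord \<tau>(3) vs by (intro that[of "[a, c, b, d]"]) (simp_all add: abcd insert_commute)
  qed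
qed

section \<open>Definiteness in degrees 0 and 1\<close>

lemma ip_0_definite:
  assumes u: "u \<in> cochains K 0" and 0: "ip 0 u u = 0"
  shows "u = (\<lambda>_. 0)"
proof
  fix xs
  show "u xs = 0"
  proof (cases "xs \<in> ordered_simplices K 0")
    case False
    then show ?thesis using u by (simp add: cochains_def)
  next
    case True
    then obtain v where v: "xs = [v]" "{v} \<in> K" by (auto simp: ordered_simplices_def length_Suc_conv)
    obtain vs where vs: "vs \<in> positive_simplices" "{v} \<subseteq> set vs" by (rule positive_ordering[OF v(2)])
    have len: "length vs = 4" "distinct vs" using vs(1) by (auto simp: ordered_simplices_def)
    obtain i where i: "i < 4" "vs ! i = v" using vs(2) len by (metis in_set_conv_nth insert_subset)
    have "0 = whitney_map K 0 u vs (vertex_point i) (\<lambda>_. 0)"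
      by (rule ip_eq_0_whitney_map[OF _ 0 vs(1) vertex_point_in_simplex[OF i(1)], symmetric]) simp
    also have "\<dots> = (\<Sum>xs\<in>ordered_simplices K 0. if xs = [v] then u xs else 0)"
      unfolding whitney_map_0 bary_vertex_point[OF len i(1)] i(2)
      by (intro sum.cong refl) (auto simp: ordered_simplices_def length_Suc_conv)
    also have "\<dots> = u [v]" using True v(1) by (simp add: finite_ordered_simplices)
    finally show ?thesis using v(1) by simp
  qed
qed

lemma cochain_1_swap:
  assumes "u \<in> cochains K 1" "[v, w] \<in> ordered_simplices K 1"
  shows "u [w, v] = - u [v, w]"
proof -
  let ?\<pi> = "Transposition.transpose 0 (1::nat)"
  have "?\<pi> permutes {..<Suc 1}" by (rule permutes_swap_id) auto
  then have "u (permute_list ?\<pi> [v, w]) = of_int (sign ?\<pi>) * u [v, w]"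
    using assms unfolding cochains_def by blast
  moreover have "permute_list ?\<pi> [v, w] = [w, v]" by (simp add: permute_list_def Transposition.transpose_def)
  ultimately show ?thesis by (simp add: sign_swap_id)
qed

lemma ip_1_definite:
  assumes u: "u \<in> cochains K 1" and 0: "ip 1 u u = 0"
  shows "u = (\<lambda>_. 0)"
proof
  fix xs
  show "u xs = 0"
  proof (cases "xs \<in> ordered_simplices K 1")
    case False
    then show ?thesis using u by (simp add: cochains_def)
  next
    case True
    then obtain v w where v: "xs = [v, w]" "{v, w} \<in> K" "v \<noteq> w"
      by (auto simp: ordered_simplices_def numeral_eq_Suc length_Suc_conv)
    obtain vs where vs: "vs \<in> positive_simplices" "{v, w} \<subseteq> set vs" by (rule positive_ordering[OF v(2)])
    have len: "length vs = 4" "distinct vs" using vs(1) by (auto simp: ordered_simplices_def)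
    obtain i where i: "i < 4" "vs ! i = v" using vs(2) len by (metis in_set_conv_nth insert_subset)
    obtain k where k: "k < 4" "vs ! k = w" using vs(2) len by (metis in_set_conv_nth insert_subset)
    have vw: "[v, w] \<in> ordered_simplices K 1" "[w, v] \<in> ordered_simplices K 1"
      using True v by (auto simp: ordered_simplices_def insert_commute)
    \<comment> \<open>At the vertex \<open>v\<close> only the barycentric coordinate of
      \<open>v\<close> survives, and on the vector towards \<open>w\<close> only the differentials
      at \<open>v\<close> and \<open>w\<close> do. Since the vertices of an edge are distinct, just
      \<open>[v, w]\<close> and \<open>[w, v]\<close> contribute, and alternation makes the two
      contributions equal.\<close>
    have "0 = whitney_map K 1 u vs (vertex_point i) (\<lambda>_. vertex_point k - vertex_point i)"
      by (rule ip_eq_0_whitney_map[OF _ 0 vs(1) vertex_point_in_simplex[OF i(1)], symmetric]) simp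
    also have "\<dots> = (\<Sum>xs\<in>ordered_simplices K 1. (if xs = [v, w] then u xs else 0) - (if xs = [w, v] then u xs else 0)) / 2"
      unfolding whitney_map_1 bary_vertex_point[OF len i(1)] blin_edge[OF len i(1) k(1)] i(2) k(2)
      using v(3) by (intro arg_cong2[where f="(/)"] sum.cong refl) (auto simp: ordered_simplices_def numeral_eq_Suc length_Suc_conv)
    also have "\<dots> = (u [v, w] - u [w, v]) / 2"
      unfolding sum_subtractf using vw by (simp add: finite_ordered_simplices)
    also have "\<dots> = u [v, w]" using cochain_1_swap[OF u vw(1)] by simp
    finally show ?thesis using v(1) by simp
  qed
qed

end

section \<open>Orthogonality of the sectors\<close>

text \<open>Induction on a set \<open>S\<close> supporting the elements of \<open>V\<close>: the elements that vanish at a given point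
  form a subspace of codimension at most one, and a vector orthogonal to it supplies the missing
  dimension.\<close>

lemma finite_dimensional_riesz:
  fixes B :: "('i \<Rightarrow> real) \<Rightarrow> ('i \<Rightarrow> real) \<Rightarrow> real"
  assumes "finite S"
    and lin: "\<And>s t u v w. B (\<lambda>x. s * u x + t * v x) w = s * B u w + t * B v w"
    and sym: "\<And>u v. B u v = B v u"
    and "\<And>s t u v. u \<in> V \<Longrightarrow> v \<in> V \<Longrightarrow> (\<lambda>x. s * u x + t * v x) \<in> V" and "(\<lambda>_. 0) \<in> V"
    and "\<And>u x. u \<in> V \<Longrightarrow> x \<notin> S \<Longrightarrow> u x = 0"
    and "\<And>u. u \<in> V \<Longrightarrow> B u u = 0 \<Longrightarrow> u = (\<lambda>_. 0)"
    and "\<And>s t u v. u \<in> V \<Longrightarrow> v \<in> V \<Longrightarrow> L (\<lambda>x. s * u x + t * v x) = s * L u + t * (L v :: real)"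
  shows "\<exists>z\<in>V. \<forall>u\<in>V. L u = B u z"
  using assms(1,4-)
proof (induction S arbitrary: V L rule: finite_induct)
  case empty
  have z: "u = (\<lambda>_. 0)" if "u \<in> V" for u using empty.prems(3)[OF that] by auto
  have "L (\<lambda>_. 0) = 0" using empty.prems(5)[OF empty.prems(2,2), of 0 0] by simp
  moreover have "B (\<lambda>_. 0) (\<lambda>_. 0) = 0" using lin[of 0 "\<lambda>_. 0" 0 "\<lambda>_. 0"] by simp
  ultimately show ?case using empty.prems(2) z by (intro bexI[of _ "\<lambda>_. 0"] ballI) metis+
next
  case (insert s S)
  note closed = insert.prems(1) and zero = insert.prems(2) and supp = insert.prems(3)
    and def = insert.prems(4) and Llin = insert.prems(5)
  define V0 where "V0 = {v \<in> V. v s = 0}"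
  have lin_right: "B w (\<lambda>x. a * u x + t * v x) = a * B w u + t * B w v" for w a u t v
    using lin[of a u t v w] sym[of w] by (simp only: sym[of w])
  have V0: "\<exists>z\<in>V0. \<forall>u\<in>V0. L' u = B u z"
    if "\<And>a t u v. u \<in> V0 \<Longrightarrow> v \<in> V0 \<Longrightarrow> L' (\<lambda>x. a * u x + t * v x) = a * L' u + t * L' v" for L'
  proof (rule insert.IH)
    show "(\<lambda>x. a * u x + t * v x) \<in> V0" if "u \<in> V0" "v \<in> V0" for a t u v
      using that closed by (auto simp: V0_def)
    show "(\<lambda>_. 0) \<in> V0" using zero by (simp add: V0_def)
    show "u x = 0" if "u \<in> V0" "x \<notin> S" for u x
      using that supp[of u x] by (cases "x = s") (auto simp: V0_def)
    show "u = (\<lambda>_. 0)" if "u \<in> V0" "B u u = 0" for u using that def by (auto simp: V0_def)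
  qed (use that in auto)
  obtain z0 where z0: "z0 \<in> V0" "\<forall>u\<in>V0. L u = B u z0" using V0[of L] Llin by (auto simp: V0_def)
  show ?case
  proof (cases "\<forall>v\<in>V. v s = 0")
    case True
    then have "V0 = V" by (auto simp: V0_def)
    then show ?thesis using z0 by blast
  next
    case False
    then obtain v where v: "v \<in> V" "v s \<noteq> 0" by blast
    define e where "e = (\<lambda>x. (1 / v s) * v x + 0 * v x)"
    have e: "e \<in> V" "e s = 1" using closed[OF v(1) v(1), of "1 / v s" 0] v(2) by (simp_all add: e_def)
    \<comment> \<open>The induction hypothesis is used a second time, for the functional given by
      \<open>e\<close>: \<open>p\<close> is the orthogonal projection of \<open>e\<close> to
      \<open>V0\<close>, so \<open>e - p\<close> is orthogonal to \<open>V0\<close> and still has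
      the value 1 at \<open>s\<close>.\<close>
    obtain p where p: "p \<in> V0" "\<forall>u\<in>V0. B u e = B u p" using V0[of "\<lambda>u. B u e"] lin by blast
    define e' where "e' = (\<lambda>x. 1 * e x + (-1) * p x)"
    have pV: "p \<in> V" "p s = 0" using p(1) by (auto simp: V0_def)
    have e': "e' \<in> V" "e' s = 1" using closed[OF e(1) pV(1), of 1 "-1"] e(2) pV(2) by (simp_all add: e'_def)
    have orth: "B u e' = 0" if "u \<in> V0" for u
      unfolding e'_def lin_right using p(2) that by simp
    have "e' \<noteq> (\<lambda>_. 0)" using e'(2) by auto
    then have ne: "B e' e' \<noteq> 0" using def e'(1) by blast
    \<comment> \<open>Chosen so that \<open>z\<close> represents \<open>L\<close> at
      \<open>e'\<close> as well; as \<open>z0\<close> and \<open>e'\<close> are orthogonal, the two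
      conditions do not interfere.\<close>
    define c where "c = L e' / B e' e'"
    define z where "z = (\<lambda>x. 1 * z0 x + c * e' x)"
    have z0V: "z0 \<in> V" using z0(1) by (simp add: V0_def)
    have zV: "z \<in> V" unfolding z_def by (rule closed[OF z0V e'(1)])
    have "L u = B u z" if u: "u \<in> V" for u
    proof -
      define w where "w = (\<lambda>x. 1 * u x + (- u s) * e' x)"
      have wV: "w \<in> V" unfolding w_def by (rule closed[OF u e'(1)])
      then have w: "w \<in> V0" using e'(2) by (simp add: V0_def w_def)
      have uw: "u = (\<lambda>x. 1 * w x + u s * e' x)" by (simp add: w_def)
      have "L u = 1 * L w + u s * L e'" by (subst uw, rule Llin[OF wV e'(1)])
      also have "\<dots> = B w z0 + u s * L e'" using z0(2) w by simp
      finally have 1: "L u = B w z0 + u s * L e'" .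
      have "B u z = 1 * B w z + u s * B e' z" by (subst uw, rule lin)
      also have "B w z = B w z0" unfolding z_def lin_right using orth[OF w] by simp
      also have "B e' z = L e'" unfolding z_def lin_right using orth[OF z0(1)] sym[of e' z0] ne by (simp add: c_def)
      finally show ?thesis using 1 by simp
    qed
    then show ?thesis using zV by blast
  qed
qed

section \<open>The cochain complex in low degrees\<close>

lemma cochains_combination:
  assumes "u \<in> cochains K k" "v \<in> cochains K k"
  shows "(\<lambda>xs. s * u xs + t * v xs) \<in> cochains K k"
  using assms unfolding cochains_def by (auto simp: algebra_simps)

lemma zero_cochain: "(\<lambda>_. 0) \<in> cochains K k"
  by (simp add: cochains_def)

lemma coboundary_combination:
  "coboundary K k (\<lambda>xs. s * u xs + t * v xs) = (\<lambda>xs. s * coboundary K k u xs + t * coboundary K k v xs)"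
  by (auto simp: coboundary_def fun_eq_iff sum.distrib sum_distrib_left algebra_simps)

lemma permutes_lessThan_2:
  assumes "\<pi> permutes {..<2::nat}"
  shows "\<pi> = id \<or> \<pi> = Transposition.transpose 0 1"
proof -
  have 2: "{..<2::nat} = {0, 1}" by auto
  show ?thesis using assms unfolding 2 by (simp add: permutes_doubleton_iff)
qed

lemma coboundary_0_edge: "[v, w] \<in> ordered_simplices K 1 \<Longrightarrow> coboundary K 0 u [v, w] = u [w] - u [v]"
  by (simp add: coboundary_def)

lemma coboundary_0_in_cochains: "coboundary K 0 u \<in> cochains K 1"
  unfolding cochains_def
proof safe
  fix xs assume "xs \<notin> ordered_simplices K 1"
  then show "coboundary K 0 u xs = 0" by (simp add: coboundary_def)
next
  fix xs \<pi> assume xs: "xs \<in> ordered_simplices K 1" and \<pi>: "\<pi> permutes {..<Suc 1}"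
  obtain v w where v: "xs = [v, w]"
    using xs by (auto simp: ordered_simplices_def numeral_eq_Suc length_Suc_conv)
  have wv: "[w, v] \<in> ordered_simplices K 1" using xs by (auto simp: v ordered_simplices_def insert_commute)
  have "\<pi> = id \<or> \<pi> = Transposition.transpose 0 1" using permutes_lessThan_2 \<pi> by (simp add: numeral_2_eq_2)
  then show "coboundary K 0 u (permute_list \<pi> xs) = of_int (sign \<pi>) * coboundary K 0 u xs"
  proof
    assume "\<pi> = Transposition.transpose 0 1"
    moreover have "permute_list (Transposition.transpose 0 1) [v, w] = [w, v]"
      by (simp add: permute_list_def Transposition.transpose_def)
    ultimately show ?thesis
      using coboundary_0_edge[OF wv, of u] coboundary_0_edge[OF xs[unfolded v], of u] by (simp add: v sign_swap_id)
  qed simp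
qed

lemma coboundary_coboundary_0:
  assumes "finite_simplicial_complex K"
  shows "coboundary K 1 (coboundary K 0 u) = (\<lambda>_. 0)"
proof
  fix xs
  show "coboundary K 1 (coboundary K 0 u) xs = 0"
  proof (cases "xs \<in> ordered_simplices K (Suc 1)")
    case True
    then obtain a b c where abc: "xs = [a, b, c]" "distinct [a, b, c]" "{a, b, c} \<in> K"
      by (auto simp: ordered_simplices_def numeral_eq_Suc length_Suc_conv)
    have face: "\<sigma> \<in> K" if "\<sigma> \<subseteq> {a, b, c}" "\<sigma> \<noteq> {}" for \<sigma>
      using assms abc(3) that unfolding finite_simplicial_complex_def by blast
    have "[a, b] \<in> ordered_simplices K 1" "[a, c] \<in> ordered_simplices K 1" "[b, c] \<in> ordered_simplices K 1"
      using abc(2) by (auto simp: ordered_simplices_def intro!: face)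
    note e = this[THEN coboundary_0_edge, of u]
    have "coboundary K 1 (coboundary K 0 u) xs =
        coboundary K 0 u [b, c] - coboundary K 0 u [a, c] + coboundary K 0 u [a, b]"
      using True by (simp add: coboundary_def[of K 1] abc(1) del: One_nat_def) (simp add: numeral_eq_Suc)
    then show ?thesis using e by simp
  qed (simp add: coboundary_def)
qed

section \<open>Adjoint coboundaries and orthogonality\<close>

context triangulated_3_manifold
begin

lemma cochain_form_ip: "cochain_form (ip k) (ordered_simplices K k)"
proof
  show "finite (ordered_simplices K k)" by (rule finite_ordered_simplices)
  show "ip k (\<lambda>xs. s * u xs + t * v xs) w = s * ip k u w + t * ip k v w" for s u t v w
    by (rule ip_linear_left)
  show "ip k u w = ip k v w" if "\<And>xs. xs \<in> ordered_simplices K k \<Longrightarrow> u xs = v xs" for u v w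
    using that by (rule ip_local)
qed

lemma ip_linear_right:
  assumes "k = 0 \<or> k = 1"
  shows "ip k w (\<lambda>xs. s * u xs + t * v xs) = s * ip k w u + t * ip k w v"
  using ip_linear_left[of k s u t v w] ip_symmetric[OF assms] by metis

lemma ip_definite: "k = 0 \<or> k = 1 \<Longrightarrow> u \<in> cochains K k \<Longrightarrow> ip k u u = 0 \<Longrightarrow> u = (\<lambda>_. 0)"
  using ip_0_definite ip_1_definite by blast

text \<open>Justifies the \<open>THE\<close> of the definition: existence is the Riesz
  representation of a functional on \<open>k\<close>-cochains, uniqueness is definiteness in degree
  \<open>k\<close>. The product in degree \<open>Suc k\<close> enters only through linearity in its
  left argument.\<close>

lemma coboundary_adjoint:
  assumes k: "k = 0 \<or> k = 1"
  shows "coboundary_adjoint K ip k w \<in> cochains K k"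
    and "u \<in> cochains K k \<Longrightarrow> ip (Suc k) (coboundary K k u) w = ip k u (coboundary_adjoint K ip k w)"
proof -
  let ?P = "\<lambda>z. z \<in> cochains K k \<and> (\<forall>u\<in>cochains K k. ip (Suc k) (coboundary K k u) w = ip k u z)"
  have "\<exists>z\<in>cochains K k. \<forall>u\<in>cochains K k. ip (Suc k) (coboundary K k u) w = ip k u z"
  proof (rule finite_dimensional_riesz[OF finite_ordered_simplices[of k]])
    show "u xs = 0" if "u \<in> cochains K k" "xs \<notin> ordered_simplices K k" for u xs
      using that by (simp add: cochains_def)
    show "u = (\<lambda>_. 0)" if "u \<in> cochains K k" "ip k u u = 0" for u
      using ip_definite[OF k that] .
    show "ip k u v = ip k v u" for u v by (rule ip_symmetric[OF k])
    show "ip (Suc k) (coboundary K k (\<lambda>xs. s * u xs + t * v xs)) w = s * ip (Suc k) (coboundary K k u) w + t * ip (Suc k) (coboundary K k v) w"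
      for s t u v unfolding coboundary_combination by (rule ip_linear_left)
  qed (rule ip_linear_left cochains_combination zero_cochain | assumption)+
  then obtain z where z: "?P z" by blast
  moreover have "z' = z" if z': "?P z'" for z'
  proof -
    let ?d = "\<lambda>xs. 1 * z' xs + (-1) * z xs"
    have d: "?d \<in> cochains K k" using z z' by (intro cochains_combination) auto
    have "ip k ?d ?d = 1 * ip k ?d z' + (-1) * ip k ?d z" by (rule ip_linear_right[OF k])
    also have "ip k ?d z' = ip k ?d z" using z z' d by metis
    finally have "?d = (\<lambda>_. 0)" using ip_definite[OF k d] by simp
    then show ?thesis by (auto simp: fun_eq_iff)
  qed
  ultimately have "?P (coboundary_adjoint K ip k w)"
    unfolding coboundary_adjoint_def by (rule theI)
  then show "coboundary_adjoint K ip k w \<in> cochains K k"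
    and "u \<in> cochains K k \<Longrightarrow> ip (Suc k) (coboundary K k u) w = ip k u (coboundary_adjoint K ip k w)"
    by blast+
qed

lemma gauge_sector_subset: "gauge_sector K \<subseteq> cochains K 1"
  unfolding gauge_sector_def using coboundary_0_in_cochains by blast

lemma physical_sector_subset: "physical_sector K ip \<subseteq> cochains K 1"
proof
  fix x assume "x \<in> physical_sector K ip"
  then obtain a w where x: "x = (\<lambda>xs. a xs + coboundary_adjoint K ip 1 w xs)" "a \<in> cochains K 1"
    unfolding physical_sector_def harmonic_space_def by blast
  have "coboundary_adjoint K ip 1 w \<in> cochains K 1" by (rule coboundary_adjoint(1)) simp
  from cochains_combination[OF x(2) this, of 1 1] show "x \<in> cochains K 1" using x(1) by simp
qed

text \<open>Each summand of a physical cochain is treated by moving a coboundary across the product: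
  the harmonic one is annihilated by the adjoint, the coexact one meets two successive
  coboundaries.\<close>

lemma sectors_orthogonal:
  assumes "x \<in> physical_sector K ip" "y \<in> gauge_sector K"
  shows "ip 1 x y = 0"
proof -
  have 01: "(0::nat) = 0 \<or> (0::nat) = 1" "(1::nat) = 0 \<or> (1::nat) = 1" by simp_all
  obtain a w where x: "x = (\<lambda>xs. a xs + coboundary_adjoint K ip 1 w xs)" and a: "a \<in> harmonic_space K ip"
    using assms(1) unfolding physical_sector_def by blast
  obtain u where y: "y = coboundary K 0 u" and u: "u \<in> cochains K 0"
    using assms(2) unfolding gauge_sector_def by blast
  have zero: "ip k z (\<lambda>_. 0) = 0" if "k = 0 \<or> k = 1" for k z
    using ip_linear_right[OF that, of z 0 z 0 z] by simp
  have "ip (Suc 0) (coboundary K 0 u) a = ip 0 u (coboundary_adjoint K ip 0 a)"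
    by (rule coboundary_adjoint(2)[OF 01(1) u])
  also have "\<dots> = 0" using a zero[OF 01(1)] by (simp add: harmonic_space_def)
  finally have 1: "ip 1 y a = 0" using y by simp
  have "ip 1 y (coboundary_adjoint K ip 1 w) = ip (Suc 1) (coboundary K 1 y) w"
    by (rule coboundary_adjoint(2)[OF 01(2), symmetric]) (simp only: y coboundary_0_in_cochains)
  also have "coboundary K 1 y = (\<lambda>_. 0)" unfolding y by (rule coboundary_coboundary_0[OF complex_K])
  also have "ip (Suc 1) (\<lambda>_. 0) w = 0" using ip_linear_left[of "Suc 1" 0 w 0 w w] by simp
  finally have 2: "ip 1 y (coboundary_adjoint K ip 1 w) = 0" .
  have "ip 1 y x = ip 1 y a + ip 1 y (coboundary_adjoint K ip 1 w)"
    using ip_linear_right[OF 01(2), of y 1 a 1 "coboundary_adjoint K ip 1 w"] unfolding x by simp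
  then have "ip 1 y x = 0" using 1 2 by simp
  then show ?thesis using ip_symmetric[OF 01(2)] by metis
qed

lemma orthogonal_sectors_whitney:
  assumes "orthonormal_basis (ip 1) (physical_sector K ip) ep" "orthonormal_basis (ip 1) (gauge_sector K) eg"
  shows "orthogonal_sectors (ip 1) (ordered_simplices K 1) (cochains K 1) (physical_sector K ip) (gauge_sector K) ep eg"
proof -
  interpret cochain_form "ip 1" "ordered_simplices K 1" by (rule cochain_form_ip)
  show ?thesis
  proof
    show "(\<lambda>xs. x xs + y xs) \<in> cochains K 1" if "x \<in> physical_sector K ip" "y \<in> gauge_sector K" for x y
      using cochains_combination[of x K 1 y 1 1] that physical_sector_subset gauge_sector_subset by auto
    show "ip 1 u v = ip 1 v u" for u v by (rule ip_symmetric) simp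
  qed (use assms sectors_orthogonal in auto)
qed

end

theorem theorem2:
  fixes M :: "'m topology"
    and A :: "'m chart set"
    and g :: "'m chart \<Rightarrow> real^3 \<Rightarrow> real^3^3"
    and K :: "'v set set"
    and h :: "('v \<Rightarrow> real) \<Rightarrow> 'm"
    and ip :: "nat \<Rightarrow> 'v cochain \<Rightarrow> 'v cochain \<Rightarrow> real"
    and Vp Vg :: "'v cochain set"
    and ep eg :: "'v cochain list"
    and \<mu> \<nu> \<mu>p \<nu>p :: "'v cochain measure"
    and f\<mu> f\<nu> f\<mu>p f\<nu>p :: "'v cochain \<Rightarrow> real"
    and \<mu>g \<nu>g :: "'v cochain \<Rightarrow> 'v cochain measure"
    and I :: real
  assumes "closed_oriented_riemannian_3_manifold M A g"
    and "smooth_triangulation M A K h"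
    and "ip = whitney_inner A g K h"
    and "Vp = physical_sector K ip"
    and "Vg = gauge_sector K"
    and "orthonormal_basis (ip 1) Vp ep"
    and "orthonormal_basis (ip 1) Vg eg"
    and "nondegenerate_gaussian (ip 1) (cochains K 1) (ep @ eg) \<mu>"
    and "nondegenerate_gaussian (ip 1) (cochains K 1) (ep @ eg) \<nu>"
    and "\<mu>p = distr \<mu> (restrict_space borel Vp) (orth_projection (ip 1) Vp)"
    and "\<nu>p = distr \<nu> (restrict_space borel Vp) (orth_projection (ip 1) Vp)"
    and "has_density (cochains K 1) (ep @ eg) \<mu> f\<mu>"
    and "has_density (cochains K 1) (ep @ eg) \<nu> f\<nu>"
    and "has_density Vp ep \<mu>p f\<mu>p"
    and "has_density Vp ep \<nu>p f\<nu>p"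
    and "\<mu>g = conditional Vg eg f\<mu> f\<mu>p"
    and "\<nu>g = conditional Vg eg f\<nu> f\<nu>p"
    and "I = gauge_information \<mu>p \<mu>g \<nu>g"
  shows "relative_entropy \<mu> \<nu> = relative_entropy \<mu>p \<nu>p + I \<and>
    I \<ge> 0 \<and>
    relative_entropy \<mu>p \<nu>p \<le> relative_entropy \<mu> \<nu> \<and>
    (relative_entropy \<mu>p \<nu>p = relative_entropy \<mu> \<nu> \<longleftrightarrow> (AE x in \<mu>p. \<mu>g x = \<nu>g x))"
proof -
  have "triangulated_3_manifold M A g K h"
    using assms(1,2) by (intro triangulated_3_manifold.intro triangulated_3_manifold_axioms.intro)
  then have "orthogonal_sectors (ip 1) (ordered_simplices K 1) (cochains K 1) Vp Vg ep eg"
    unfolding assms(4,5) assms(3)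
    using assms(6,7) unfolding assms(4,5) assms(3)
    by (rule triangulated_3_manifold.orthogonal_sectors_whitney)
  then interpret S: orthogonal_sectors "ip 1" "ordered_simplices K 1" "cochains K 1" Vp Vg ep eg .
  note ratio = S.gaussian_log_ratio[OF S.orthonormal_append S.range_append assms(8,9,12,13)]
  have prob: "prob_space \<mu>" "prob_space \<nu>"
    by (rule assms(8,9)[unfolded nondegenerate_gaussian_def, THEN conjunct1])+
  \<comment> \<open>A Gaussian density is positive almost everywhere, so absolute continuity holds
    vacuously.\<close>
  have ac: "AE a in lebesgue_of (cochains K 1) (ep @ eg). f\<nu> a = 0 \<longrightarrow> f\<mu> a = 0"
    using ratio(1) by eventually_elim simp
  have I: "I = gauge_information \<mu>p (conditional Vg eg f\<mu> f\<mu>p) (conditional Vg eg f\<nu> f\<nu>p)"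
    unfolding assms(18) assms(16,17) ..
  note chain = S.relative_entropy_chain_rule[OF assms(12,13) prob ac ratio(2) assms(10,11,14,15) I]
  have "I = 0 \<longleftrightarrow> (AE x in \<mu>p. \<mu>g x = \<nu>g x)" using chain(3) unfolding assms(16,17) .
  \<comment> \<open>All terms of the chain rule are real numbers, so equality of the two entropies
    amounts to \<open>I = 0\<close>.\<close>
  moreover have "relative_entropy \<mu>p \<nu>p = relative_entropy \<mu> \<nu> \<longleftrightarrow> I = 0" using chain(1) by linarith
  ultimately show ?thesis using chain(1,2) by auto
qed

end
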